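(* Let $A$ be an anisotropic dilation matrix on $\mathbb{R}^n$, i.e. a real $n\times n$ matrix all of whose eigenvalues $\lambda$ satisfy $|\lambda|>1$. Then there exists a unique continuous group of dilations $\{A_t=\exp(P\ln t)\}_{t>0}$ such that: (1) its generator $P$ (a real $n\times n$ matrix) has all eigenvalues positive and $\operatorname{tr}(P)=1$, and (2) $A$ is equivalent to $A_t$ for all $t>1$. More precisely, uniqueness holds in the following sense: if $\{A'_t=\exp(P'\ln t)\}_{t>0}$ is another one-parameter group of dilations whose generator $P'$ has all eigenvalues positive and $\operatorname{tr}(P')=1$, and if $A$ is equivalent to $A'_t$ for some $t>1$, then $P=P'$.
   Context: A (anisotropic, or expansive) dilation is a real $n\times n$ matrix $A$ all of whose eigenvalues $\lambda\in\mathbb{C}$ satisfy $|\lambda|>1$. A quasi-norm associated with $A$ is a measurable map $\rho_A:\mathbb{R}^n\to[0,\infty)$ such that $\rho_A(x)=0$ iff $x=0$; $\rho_A(Ax)=|\det A|\,\rho_A(x)$ for all $x$; and for some $c>0$, $\rho_A(x+y)\le c(\rho_A(x)+\rho_A(y))$ for all $x,y$. Such quasi-norms exist, and any two associated with the same $A$ are equivalent. Two quasi-norms $\rho_1,\rho_2$ on $\mathbb{R}^n$ are equivalent if there is $C>0$ with $\frac1C\rho_1(x)\le\rho_2(x)\le C\rho_1(x)$ for all $x\in\mathbb{R}^n$. Two dilations are equivalent if their associated quasi-norms are equivalent. "All eigenvalues positive" means that all complex eigenvalues are real and $>0$. *)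

theory Defs
  imports "HOL-Analysis.Analysis"
begin

definition complex_eigenvalue :: "real^'n^'n \<Rightarrow> complex \<Rightarrow> bool" where
  "complex_eigenvalue A \<mu> \<longleftrightarrow>
     (\<exists>v::complex^'n. v \<noteq> 0 \<and> map_matrix complex_of_real A *v v = \<mu> *s v)"

definition expansive_dilation :: "real^'n^'n \<Rightarrow> bool" where
  "expansive_dilation A \<longleftrightarrow> (\<forall>\<mu>. complex_eigenvalue A \<mu> \<longrightarrow> cmod \<mu> > 1)"

definition all_eigenvalues_positive :: "real^'n^'n \<Rightarrow> bool" where
  "all_eigenvalues_positive P \<longleftrightarrow>
     (\<forall>\<mu>. complex_eigenvalue P \<mu> \<longrightarrow> \<mu> \<in> \<real> \<and> Re \<mu> > 0)"

definition is_quasi_norm :: "real^'n^'n \<Rightarrow> (real^'n \<Rightarrow> real) \<Rightarrow> bool" where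
  "is_quasi_norm A \<rho> \<longleftrightarrow>
     \<rho> \<in> borel_measurable lebesgue \<and>
     (\<forall>x. \<rho> x \<ge> 0) \<and>
     (\<forall>x. \<rho> x = 0 \<longleftrightarrow> x = 0) \<and>
     (\<forall>x. \<rho> (A *v x) = \<bar>det A\<bar> * \<rho> x) \<and>
     (\<exists>c>0. \<forall>x y. \<rho> (x + y) \<le> c * (\<rho> x + \<rho> y))"

definition equivalent_quasi_norms :: "(real^'n \<Rightarrow> real) \<Rightarrow> (real^'n \<Rightarrow> real) \<Rightarrow> bool" where
  "equivalent_quasi_norms \<rho>\<^sub>1 \<rho>\<^sub>2 \<longleftrightarrow>
     (\<exists>C>0. \<forall>x. 1 / C * \<rho>\<^sub>1 x \<le> \<rho>\<^sub>2 x \<and> \<rho>\<^sub>2 x \<le> C * \<rho>\<^sub>1 x)"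

text \<open>
  Every expansive dilation has an associated quasi-norm, and any two associated with the same
  dilation are equivalent; so, both matrices being expansive, the quantification over all
  associated quasi-norms below is not vacuous and does not depend on their choice.
\<close>
definition equivalent_dilations :: "real^'n^'n \<Rightarrow> real^'n^'n \<Rightarrow> bool" where
  "equivalent_dilations A B \<longleftrightarrow>
     expansive_dilation A \<and> expansive_dilation B \<and>
     (\<forall>\<rho>\<^sub>1 \<rho>\<^sub>2. is_quasi_norm A \<rho>\<^sub>1 \<longrightarrow> is_quasi_norm B \<rho>\<^sub>2 \<longrightarrow> equivalent_quasi_norms \<rho>\<^sub>1 \<rho>\<^sub>2)"

text \<open>
  The library's \<^const>\<open>exp\<close> is not available on \<^typ>\<open>real^'n^'n\<close>, and its \<^const>\<open>times\<close>
  is componentwise there; the exponential series is therefore written with powers for \<open>**\<close>.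
\<close>
definition matrix_exp :: "real^'n^'n \<Rightarrow> real^'n^'n" where
  "matrix_exp X = (\<Sum>k. (1 / fact k) *\<^sub>R (((**) X) ^^ k) (mat 1))"

text \<open>Only the values for \<open>t > 0\<close> are meaningful.\<close>
definition dilation_group :: "real^'n^'n \<Rightarrow> real \<Rightarrow> real^'n^'n" where
  "dilation_group P t = matrix_exp (ln t *\<^sub>R P)"

text \<open>
  A group \<open>exp (P ln t)\<close> contains the identity (\<open>t = 1\<close>) and contractions, so being a group of
  dilations refers to its members with \<open>t > 1\<close>.
\<close>
definition generates_dilations :: "real^'n^'n \<Rightarrow> bool" where
  "generates_dilations P \<longleftrightarrow> (\<forall>t>1. expansive_dilation (dilation_group P t))"

end

theory Submission
  imports Defs "HOL-Computational_Algebra.Fundamental_Theorem_Algebra"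
begin

text \<open>
  Over the complex numbers \<open>A = exp L * V\<close>, where \<open>L\<close> has the eigenvalues \<open>ln \<bar>\<lambda>\<bar> > 0\<close> and the
  commuting factor \<open>V\<close> has bounded powers, positive and negative. Two one-parameter groups
  \<open>exp (s P)\<close>, \<open>exp (s Q)\<close> with real spectra coincide as soon as \<open>exp (- s P) exp (s Q)\<close> is bounded
  over all real \<open>s\<close>, since its entries are exponential polynomials with real exponents.
  Applied to \<open>L\<close> and its complex conjugate this shows that \<open>L\<close> is real; \<open>P\<close> is \<open>L\<close> divided by its
  trace, which is positive because \<open>det (exp (s L)) = exp (s tr L)\<close> tends to \<open>0\<close> as \<open>s\<close> tends to
  \<open>-\<infinity>\<close>. Quasi-norms of two dilations are equivalent if their powers, suitably matched, have
  bounded quotients, and conversely; so \<open>A\<close> is equivalent to \<open>exp (a L)\<close> for each \<open>a > 0\<close>, and a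
  dilation \<open>exp (a P')\<close> equivalent to \<open>A\<close> makes \<open>exp (- c s P') exp (s L)\<close> bounded for some \<open>c\<close>,
  whence \<open>c P' = L\<close>, and \<open>c\<close> is determined by the trace.
\<close>

section \<open>One-parameter groups in Banach algebras\<close>

text \<open>No Jordan form appears: a spectrum enters only as a list of shifts whose product
  \<open>shift_prod\<close> annihilates the matrix, and the estimates on flows are inductions on
  such lists. The bounded factor \<open>V\<close> has no real logarithm in general (take
  \<open>A = -2\<close> in dimension one), so it is carried as a homomorphism on the integers, and
  flows are compared with \<open>A\<close> at integer times only. On the side of quasi-norms the
  obstacle is that they are merely measurable. Boundedness near 0 is therefore extracted from
  Lebesgue measure by a Steinhaus argument, and lower bounds on annuli come from compactness
  together with the quasi-triangle inequality instead of continuity. Homogeneity sees a dilation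
  only through the absolute value of its determinant, so powers of two dilations have to be matched
  by determinant. Since equivalence of dilations speaks about all quasi-norms, an equivalence can be
  exploited only after a quasi-norm has been exhibited for each side; \<open>step_norm\<close>
  serves for that.\<close>

lemma power_eq_0_mono:
  fixes x :: "'a::semiring_1"
  assumes "x ^ m = 0" "m \<le> n" shows "x ^ n = 0"
proof -
  obtain k where "n = m + k" using assms(2) le_Suc_ex by blast
  then show ?thesis using assms(1) by (simp add: power_add)
qed

lemma power_mult_commuting:
  fixes x y :: "'a::monoid_mult"
  assumes "x * y = y * x"
  shows "(x * y) ^ n = x ^ n * y ^ n"
proof (induction n)
  case (Suc n)
  have "y * x ^ n = x ^ n * y" by (metis assms power_commuting_commutes)
  then have "x * (y * x ^ n) * y ^ n = x * (x ^ n * y) * y ^ n" by simp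
  then show ?case using Suc by (simp add: mult.assoc)
qed simp

lemma exp_commutes_right:
  fixes X Y :: "'a::{real_normed_algebra_1,banach}"
  assumes "X * Y = Z * X"
  shows "X * exp Y = exp Z * X"
proof -
  have pow: "X * Y ^ n = Z ^ n * X" for n
  proof (induction n)
    case (Suc n)
    have "X * Y ^ Suc n = (X * Y) * Y ^ n" by (simp add: mult.assoc)
    also have "\<dots> = Z * (X * Y ^ n)" using assms by (simp add: mult.assoc)
    finally show ?case using Suc by (simp add: mult.assoc)
  qed simp
  have "(\<lambda>n. X * (Y ^ n /\<^sub>R fact n)) sums (X * exp Y)"
    by (intro sums_mult exp_converges)
  moreover have "(\<lambda>n. (Z ^ n /\<^sub>R fact n) * X) sums (exp Z * X)"
    by (intro sums_mult2 exp_converges)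
  moreover have "X * (Y ^ n /\<^sub>R fact n) = (Z ^ n /\<^sub>R fact n) * X" for n
    using pow by simp
  ultimately show ?thesis using sums_unique2 by force
qed

text \<open>With \<open>E\<close> a spectral projection, this evaluates the exponential of a sum of
  blocks on a single block.\<close>

lemma exp_mult_cong:
  fixes X Y E :: "'a::{real_normed_algebra_1,banach}"
  assumes "X * E = Y * E" "X * E = E * X" "Y * E = E * Y"
  shows "exp X * E = exp Y * E"
proof -
  have pow: "X ^ n * E = Y ^ n * E" for n
  proof (induction n)
    case (Suc n)
    have "X ^ Suc n * E = X * (X ^ n * E)" by (simp add: mult.assoc)
    also have "\<dots> = X * (Y ^ n * E)" using Suc by simp
    also have "\<dots> = X * (E * Y ^ n)" by (metis assms(3) power_commuting_commutes)
    also have "\<dots> = Y * (E * Y ^ n)" by (metis assms(1) mult.assoc)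
    also have "\<dots> = Y * (Y ^ n * E)" by (metis assms(3) power_commuting_commutes)
    finally show ?case by (simp add: mult.assoc)
  qed simp
  have "(\<lambda>n. (X ^ n /\<^sub>R fact n) * E) sums (exp X * E)"
    by (intro sums_mult2 exp_converges)
  moreover have "(\<lambda>n. (Y ^ n /\<^sub>R fact n) * E) sums (exp Y * E)"
    by (intro sums_mult2 exp_converges)
  ultimately show ?thesis using pow sums_unique2 by force
qed

lemma exp_minus_inverse_algebra:
  fixes X :: "'a::{real_normed_algebra_1,banach}"
  shows "exp X * exp (- X) = 1" "exp (- X) * exp X = 1"
  using exp_add_commuting[of X "- X"] exp_add_commuting[of "- X" X] by simp_all

lemma exp_scaleR_add:
  fixes X :: "'a::{real_normed_algebra_1,banach}"
  shows "exp ((s + t) *\<^sub>R X) = exp (s *\<^sub>R X) * exp (t *\<^sub>R X)"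
  by (simp add: scaleR_add_left exp_add_commuting)

lemma exp_of_real_algebra:
  "exp (of_real r :: 'a::{real_normed_algebra_1,banach}) = of_real (exp r)"
proof -
  have "(\<lambda>n. of_real (r ^ n /\<^sub>R fact n) :: 'a) sums of_real (exp r)"
    by (intro sums_of_real exp_converges)
  moreover have "(\<lambda>n. (of_real r :: 'a) ^ n /\<^sub>R fact n) sums exp (of_real r)"
    by (rule exp_converges)
  ultimately show ?thesis
    by (simp add: scaleR_conv_of_real sums_unique2)
qed

lemma exp_bounded_linear_hom:
  fixes f :: "'a::{real_normed_algebra_1,banach} \<Rightarrow> 'b::{real_normed_algebra_1,banach}"
  assumes "bounded_linear f" "\<And>X Y. f (X * Y) = f X * f Y" "f 1 = 1"
  shows "f (exp X) = exp (f X)"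
proof -
  interpret bounded_linear f by fact
  have pow: "f (X ^ n) = f X ^ n" for n
    by (induction n) (simp_all add: assms)
  have "(\<lambda>n. f (X ^ n /\<^sub>R fact n)) sums f (exp X)"
    by (intro sums exp_converges)
  moreover have "(\<lambda>n. f X ^ n /\<^sub>R fact n) sums exp (f X)"
    by (rule exp_converges)
  ultimately show ?thesis by (simp add: scaleR pow sums_unique2)
qed

section \<open>Annihilating products of shifts\<close>

text \<open>A polynomial in \<open>M\<close> given by its roots. That such a product vanishes for
  real or positive shifts is the form in which information on the spectrum is passed around.\<close>

definition shift_prod :: "'a::ring_1 \<Rightarrow> 'a list \<Rightarrow> 'a" where
  "shift_prod M cs = prod_list (map (\<lambda>c. M - c) cs)"

lemma shift_prod_simps [simp]:
  "shift_prod M [] = 1"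
  "shift_prod M (c # cs) = (M - c) * shift_prod M cs"
  by (simp_all add: shift_prod_def)

lemma shift_prod_append: "shift_prod M (cs @ ds) = shift_prod M cs * shift_prod M ds"
  by (simp add: shift_prod_def)

lemma shift_prod_commutes:
  assumes "Y * M = M * Y" "\<And>c. c \<in> set cs \<Longrightarrow> Y * c = c * Y"
  shows "Y * shift_prod M cs = shift_prod M cs * Y"
  using assms(2)
proof (induction cs)
  case (Cons c cs)
  have "Y * (M - c) = (M - c) * Y"
    using assms(1) Cons.prems[of c] by (simp add: algebra_simps)
  then have "Y * shift_prod M (c # cs) = (M - c) * (Y * shift_prod M cs)"
    by (simp add: mult.assoc[symmetric])
  also have "Y * shift_prod M cs = shift_prod M cs * Y" using Cons by simp
  finally show ?case by (simp add: mult.assoc)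
qed simp

lemma of_real_commutes: "of_real r * X = X * (of_real r :: 'a::real_algebra_1)"
  by (simp add: of_real_def)

lemma shift_prod_of_real_commutes:
  fixes M :: "'a::real_algebra_1"
  assumes "Y * M = M * Y"
  shows "Y * shift_prod M (map of_real ps) = shift_prod M (map of_real ps) * Y"
  using assms by (intro shift_prod_commutes) (auto simp: of_real_commutes)

section \<open>Bounded flows with real exponents\<close>

text \<open>The one-parameter group generated by the operator taking \<open>X\<close> to
  \<open>X * Q - P * X\<close>. At \<open>X = 1\<close> it is the quotient of the two exponential
  groups, and its boundedness is to force \<open>P = Q\<close>.\<close>

definition two_sided_flow :: "'a::{real_normed_algebra_1,banach} \<Rightarrow> 'a \<Rightarrow> 'a \<Rightarrow> real \<Rightarrow> 'a" where
  "two_sided_flow P Q X s = exp (- s *\<^sub>R P) * X * exp (s *\<^sub>R Q)"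

lemma two_sided_flow_derivative:
  "(two_sided_flow P Q X has_vector_derivative two_sided_flow P Q (X * Q - P * X) s) (at s)"
proof -
  have 1: "((\<lambda>s. exp (s *\<^sub>R (- P))) has_vector_derivative exp (s *\<^sub>R (- P)) * (- P)) (at s)"
    by (rule exp_scaleR_has_vector_derivative_right)
  have 2: "((\<lambda>s. exp (s *\<^sub>R Q)) has_vector_derivative Q * exp (s *\<^sub>R Q)) (at s)"
    by (rule exp_scaleR_has_vector_derivative_left)
  have "((\<lambda>s. exp (s *\<^sub>R (- P)) * X * exp (s *\<^sub>R Q)) has_vector_derivative
      exp (s *\<^sub>R (- P)) * X * (Q * exp (s *\<^sub>R Q)) + exp (s *\<^sub>R (- P)) * (- P) * X * exp (s *\<^sub>R Q)) (at s)"
    using has_vector_derivative_mult[OF has_vector_derivative_mult[OF 1 has_vector_derivative_const[of X]] 2]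
    by simp
  moreover have "(\<lambda>s. exp (s *\<^sub>R (- P)) * X * exp (s *\<^sub>R Q)) = two_sided_flow P Q X"
    by (simp add: two_sided_flow_def fun_eq_iff)
  moreover have "exp (s *\<^sub>R (- P)) * X * (Q * exp (s *\<^sub>R Q)) + exp (s *\<^sub>R (- P)) * (- P) * X * exp (s *\<^sub>R Q)
      = exp (s *\<^sub>R (- P)) * (X * Q - P * X) * exp (s *\<^sub>R Q)"
    by (simp only: right_diff_distrib left_diff_distrib mult.assoc mult_minus_left mult_minus_right
        add_uminus_conv_diff)
  ultimately show ?thesis
    by (simp add: two_sided_flow_def)
qed

lemma two_sided_flow_0 [simp]: "two_sided_flow P Q X 0 = X"
  by (simp add: two_sided_flow_def)

lemma two_sided_flow_linear:
  "two_sided_flow P Q (X - Y) s = two_sided_flow P Q X s - two_sided_flow P Q Y s"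
  "two_sided_flow P Q (X + Y) s = two_sided_flow P Q X s + two_sided_flow P Q Y s"
  "two_sided_flow P Q (c *\<^sub>R X) s = c *\<^sub>R two_sided_flow P Q X s"
  "two_sided_flow P Q (X * Q) s = two_sided_flow P Q X s * Q"
  "two_sided_flow P Q (P * X) s = P * two_sided_flow P Q X s"
proof -
  have "exp (s *\<^sub>R Q) * Q = Q * exp (s *\<^sub>R Q)" by (rule exp_times_scaleR_commute)
  then show "two_sided_flow P Q (X * Q) s = two_sided_flow P Q X s * Q"
    by (simp add: two_sided_flow_def mult.assoc)
  have "exp ((- s) *\<^sub>R P) * P = P * exp ((- s) *\<^sub>R P)" by (rule exp_times_scaleR_commute)
  then show "two_sided_flow P Q (P * X) s = P * two_sided_flow P Q X s"
    unfolding two_sided_flow_def by (metis mult.assoc)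
qed (simp_all only: two_sided_flow_def left_diff_distrib right_diff_distrib distrib_left distrib_right
      mult_scaleR_left mult_scaleR_right)

lemma has_vector_derivative_zero_constant_real:
  fixes f :: "real \<Rightarrow> 'a::real_normed_vector"
  assumes "\<And>s. (f has_vector_derivative 0) (at s)"
  shows "f s = f 0"
proof -
  obtain c where "\<And>x. x \<in> UNIV \<Longrightarrow> f x = c"
    by (rule has_vector_derivative_zero_constant[of UNIV f]) (simp_all add: assms)
  then show ?thesis by simp
qed

text \<open>Here \<open>X\<close> is an eigenvector of the generator, so rescaling the flow by
  \<open>exp (- \<theta> * s)\<close> leaves a function with derivative 0.\<close>

lemma two_sided_flow_eigen:
  assumes "X * Q - P * X = \<theta> *\<^sub>R X"
  shows "two_sided_flow P Q X s = exp (\<theta> * s) *\<^sub>R X"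
proof -
  have "((\<lambda>s. exp (- \<theta> * s) *\<^sub>R two_sided_flow P Q X s) has_vector_derivative 0) (at s)" for s
  proof -
    have "((\<lambda>s. exp (- \<theta> * s)) has_field_derivative (- \<theta> * exp (- \<theta> * s))) (at s)"
      by (auto intro!: derivative_eq_intros)
    then have "((\<lambda>s. exp (- \<theta> * s) *\<^sub>R two_sided_flow P Q X s) has_vector_derivative
       exp (- \<theta> * s) *\<^sub>R two_sided_flow P Q (X * Q - P * X) s + (- \<theta> * exp (- \<theta> * s)) *\<^sub>R two_sided_flow P Q X s) (at s)"
      by (rule has_vector_derivative_scaleR[OF _ two_sided_flow_derivative])
    then show ?thesis by (simp add: assms two_sided_flow_linear mult.commute)
  qed
  from has_vector_derivative_zero_constant_real[OF this, of s]
  have *: "exp (- \<theta> * s) *\<^sub>R two_sided_flow P Q X s = X" by simp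
  have "two_sided_flow P Q X s = exp (\<theta> * s) *\<^sub>R (exp (- \<theta> * s) *\<^sub>R two_sided_flow P Q X s)"
    by (simp add: exp_minus)
  then show ?thesis unfolding * .
qed

text \<open>The generator applied twice to \<open>X\<close> gives 0, so the flow has constant
  velocity \<open>Z\<close>.\<close>

lemma two_sided_flow_unipotent:
  assumes "Z = X * Q - P * X" "Z * Q = P * Z"
  shows "two_sided_flow P Q X s = X + s *\<^sub>R Z"
proof -
  have Z: "two_sided_flow P Q Z s = Z" for s
    using two_sided_flow_eigen[of Z Q P 0 s] assms(2) by simp
  have "((\<lambda>s. two_sided_flow P Q X s - s *\<^sub>R Z) has_vector_derivative (Z - Z)) (at s)" for s
  proof (rule has_vector_derivative_diff)
    show "(two_sided_flow P Q X has_vector_derivative Z) (at s)"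
      using two_sided_flow_derivative[of P Q X s] assms(1) Z[of s] by simp
    show "((\<lambda>s. s *\<^sub>R Z) has_vector_derivative Z) (at s)"
      by (auto intro!: derivative_eq_intros)
  qed
  then have "two_sided_flow P Q X s - s *\<^sub>R Z = two_sided_flow P Q X 0 - 0 *\<^sub>R Z"
    by (intro has_vector_derivative_zero_constant_real[where f = "\<lambda>s. two_sided_flow P Q X s - s *\<^sub>R Z"]) simp
  then show ?thesis by (simp add: algebra_simps)
qed

lemma bounded_exp_ray_zero:
  fixes Y :: "'a::real_normed_vector"
  assumes "bounded (range (\<lambda>s. exp (\<theta> * s) *\<^sub>R Y))" "\<theta> \<noteq> 0"
  shows "Y = 0"
proof (rule ccontr)
  assume "Y \<noteq> 0"
  obtain B where B: "\<And>s. norm (exp (\<theta> * s) *\<^sub>R Y) \<le> B"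
    using assms(1) by (auto simp: bounded_iff)
  \<comment> \<open>This time makes the exponent equal to \<open>B / norm Y\<close>, and
    \<open>exp x\<close> is at least \<open>1 + x\<close>.\<close>
  have "exp (\<theta> * (B / norm Y / \<theta>)) * norm Y \<le> B"
    using B[of "B / norm Y / \<theta>"] by simp
  then have "exp (B / norm Y) \<le> B / norm Y" using \<open>Y \<noteq> 0\<close> assms(2) by (simp add: field_simps)
  then show False using exp_ge_add_one_self[of "B / norm Y"] by simp
qed

lemma bounded_affine_ray_zero:
  fixes Y :: "'a::real_normed_vector"
  assumes "bounded (range (\<lambda>s. X + s *\<^sub>R Y))"
  shows "Y = 0"
proof (rule ccontr)
  assume "Y \<noteq> 0"
  obtain B where B: "\<And>s. norm (X + s *\<^sub>R Y) \<le> B"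
    using assms(1) by (auto simp: bounded_iff)
  define s where "s = (B + norm X + 1) / norm Y"
  have B0: "B \<ge> 0" using order_trans[OF norm_ge_zero B] .
  have "norm (s *\<^sub>R Y) \<le> norm (X + s *\<^sub>R Y) + norm X"
    by (metis add.commute add_diff_cancel_left' norm_triangle_ineq4)
  then have "\<bar>s\<bar> * norm Y \<le> B + norm X" using B[of s] by simp
  moreover have "\<bar>s\<bar> * norm Y = B + norm X + 1"
    using \<open>Y \<noteq> 0\<close> B0 by (simp add: s_def)
  ultimately show False by simp
qed

text \<open>Induction on the total number of shifts. Both \<open>(P - p) * X\<close> and
  \<open>X * (Q - q)\<close> need one shift less and still have bounded flows, because
  multiplication by \<open>P\<close> on the left and by \<open>Q\<close> on the right commutes with
  the flow; hence both intertwine. The defect \<open>D = X * Q - P * X\<close> is their difference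
  plus \<open>(q - p) *\<^sub>R X\<close>, so it is an eigenvector of the generator for
  \<open>q - p\<close>. If \<open>q \<noteq> p\<close>, its flow grows exponentially in one
  direction unless \<open>D = 0\<close>; if \<open>q = p\<close>, the flow of \<open>X\<close>
  itself is affine with slope \<open>D\<close>, and boundedness again gives
  \<open>D = 0\<close>.\<close>

lemma bounded_flow_intertwines:
  fixes P Q X :: "'a::{real_normed_algebra_1,banach}"
  assumes "shift_prod P (map of_real ps) * X = 0" "X * shift_prod Q (map of_real qs) = 0"
    and "bounded (range (two_sided_flow P Q X))"
  shows "X * Q = P * X"
  using assms
proof (induction "length ps + length qs" arbitrary: ps qs X rule: less_induct)
  case less
  show ?case
  proof (cases "ps = [] \<or> qs = []")
    case True
    then have "X = 0" using less.prems by auto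
    then show ?thesis by simp
  next
    case False
    then obtain p ps' q qs' where pq: "ps = p # ps'" "qs = q # qs'" by (metis list.exhaust)
    define F where "F = two_sided_flow P Q"
    obtain B where B: "\<And>s. norm (F X s) \<le> B"
      using less.prems(3) by (auto simp: bounded_iff F_def)
    have FP: "F (P * X') s = P * F X' s" and FQ: "F (X' * Q) s = F X' s * Q"
      and Fc: "F (c *\<^sub>R X') s = c *\<^sub>R F X' s" and Fd: "F (X' - Y') s = F X' s - F Y' s" for X' Y' s c
      unfolding F_def by (rule two_sided_flow_linear)+
    have "norm (F (P * X) s) \<le> norm P * B" for s
      unfolding FP by (rule order_trans[OF norm_mult_ineq mult_left_mono[OF B norm_ge_zero]])
    then have bP: "bounded (range (F (P * X)))" unfolding bounded_iff by blast
    have "norm (F (X * Q) s) \<le> B * norm Q" for s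
      unfolding FQ by (rule order_trans[OF norm_mult_ineq mult_right_mono[OF B norm_ge_zero]])
    then have bQ: "bounded (range (F (X * Q)))" unfolding bounded_iff by blast
    have "norm (c *\<^sub>R F X s) \<le> \<bar>c\<bar> * B" for s c
      using mult_left_mono[OF B[of s], of "\<bar>c\<bar>"] by simp
    then have bX: "bounded (range (\<lambda>s. c *\<^sub>R F X s))" for c unfolding bounded_iff by blast
    define Y where "Y = (P - of_real p) * X"
    define Z where "Z = X * (Q - of_real q)"
    have Y': "Y = P * X - p *\<^sub>R X" and Z': "Z = X * Q - q *\<^sub>R X"
      by (simp_all add: Y_def Z_def left_diff_distrib right_diff_distrib of_real_def)
    have FY: "F Y = (\<lambda>s. F (P * X) s - p *\<^sub>R F X s)"
      by (rule ext) (simp only: Y' Fd Fc)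
    have FZ: "F Z = (\<lambda>s. F (X * Q) s - q *\<^sub>R F X s)"
      by (rule ext) (simp only: Z' Fd Fc)
    have Y: "Y * Q = P * Y"
    proof (rule less.hyps[of ps' qs])
      have "(P - of_real p) * shift_prod P (map of_real ps') = shift_prod P (map of_real ps') * (P - of_real p)"
        by (rule shift_prod_of_real_commutes) (simp add: algebra_simps of_real_def)
      then show "shift_prod P (map of_real ps') * Y = 0"
        using less.prems(1) unfolding Y_def pq(1) by (simp add: mult.assoc[symmetric])
      show "Y * shift_prod Q (map of_real qs) = 0"
        using less.prems(2) by (simp add: Y_def mult.assoc)
      show "bounded (range (two_sided_flow P Q Y))"
        using bounded_minus_comp[OF bP bX[of p]] unfolding F_def[symmetric] FY .
    qed (simp add: pq)
    have Z: "Z * Q = P * Z"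
    proof (rule less.hyps[of ps qs'])
      show "Z * shift_prod Q (map of_real qs') = 0"
        using less.prems(2) by (simp add: Z_def pq(2) mult.assoc)
      show "shift_prod P (map of_real ps) * Z = 0"
        using less.prems(1) by (simp add: Z_def mult.assoc[symmetric])
      show "bounded (range (two_sided_flow P Q Z))"
        using bounded_minus_comp[OF bQ bX[of q]] unfolding F_def[symmetric] FZ .
    qed (simp add: pq)
    define D where "D = X * Q - P * X"
    have bD: "bounded (range (F D))"
    proof -
      have "F D = (\<lambda>s. F (X * Q) s - F (P * X) s)" by (rule ext) (simp only: D_def Fd)
      then show ?thesis using bounded_minus_comp[OF bQ bP] by simp
    qed
    have "D = Z - Y + (q - p) *\<^sub>R X"
      by (simp add: D_def Z' Y' scaleR_diff_left)
    then have "D * Q - P * D = (Z * Q - P * Z) - (Y * Q - P * Y) + (q - p) *\<^sub>R (X * Q - P * X)"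
      by (simp only: distrib_left distrib_right left_diff_distrib right_diff_distrib
          mult_scaleR_left mult_scaleR_right scaleR_diff_right) simp
    then have eig: "D * Q - P * D = (q - p) *\<^sub>R D" using Y Z by (simp add: D_def)
    show ?thesis
    proof (cases "q = p")
      case False
      have "F D = (\<lambda>s. exp ((q - p) * s) *\<^sub>R D)"
        using two_sided_flow_eigen[OF eig] by (auto simp: F_def)
      then have "D = 0" using bD False bounded_exp_ray_zero[of "q - p" D] by simp
      then show ?thesis by (simp add: D_def)
    next
      case True
      then have "D * Q = P * D" using eig by simp
      then have "F X = (\<lambda>s. X + s *\<^sub>R D)"
        using two_sided_flow_unipotent[of D X Q P] by (auto simp: F_def D_def)
      then have "D = 0" using less.prems(3) bounded_affine_ray_zero[of X D] by (simp add: F_def)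
      then show ?thesis by (simp add: D_def)
    qed
  qed
qed

lemma norm_exp_scaleR_le:
  fixes X :: "'a::{real_normed_algebra_1,banach}"
  assumes "\<bar>s\<bar> \<le> c"
  shows "norm (exp (s *\<^sub>R X)) \<le> exp (c * norm X)"
  by (rule order_trans[OF norm_exp]) (simp add: assms mult_right_mono)

text \<open>Integer times suffice: the fractional part of \<open>s\<close> contributes only
  exponentials with a coefficient in the unit interval, which are bounded. Then \<open>X = 1\<close>
  is taken in \<open>bounded_flow_intertwines\<close>.\<close>

lemma real_flow_unique:
  fixes P Q :: "'a::{real_normed_algebra_1,banach}"
  assumes "shift_prod P (map of_real ps) = 0" "shift_prod Q (map of_real qs) = 0"
    and bd: "\<And>k::int. norm (exp (- of_int k *\<^sub>R P) * exp (of_int k *\<^sub>R Q)) \<le> B"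
  shows "P = Q"
proof -
  have B0: "B \<ge> 0" using order_trans[OF norm_ge_zero bd] .
  have "norm (two_sided_flow P Q 1 s) \<le> exp (norm P) * B * exp (norm Q)" for s
  proof -
    define k where "k = \<lfloor>s\<rfloor>"
    define r where "r = s - of_int k"
    have r: "\<bar>r\<bar> \<le> 1" unfolding r_def k_def by linarith
    have s: "- s = - r + - of_int k" "s = of_int k + r" by (simp_all add: r_def)
    have "exp (- s *\<^sub>R P) = exp (- r *\<^sub>R P) * exp (- of_int k *\<^sub>R P)"
      "exp (s *\<^sub>R Q) = exp (of_int k *\<^sub>R Q) * exp (r *\<^sub>R Q)"
      unfolding exp_scaleR_add[symmetric] using s by metis+
    then have "two_sided_flow P Q 1 s =
       exp (- r *\<^sub>R P) * (exp (- of_int k *\<^sub>R P) * exp (of_int k *\<^sub>R Q)) * exp (r *\<^sub>R Q)"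
      by (simp only: two_sided_flow_def mult_1_right mult.assoc)
    also have "norm \<dots> \<le> norm (exp (- r *\<^sub>R P)) * norm (exp (- of_int k *\<^sub>R P) * exp (of_int k *\<^sub>R Q))
        * norm (exp (r *\<^sub>R Q))"
      by (meson mult_right_mono norm_ge_zero norm_mult_ineq order_trans)
    also have "\<dots> \<le> exp (1 * norm P) * B * exp (1 * norm Q)"
      using r B0 by (intro mult_mono norm_exp_scaleR_le bd) auto
    finally show ?thesis by simp
  qed
  then have "bounded (range (two_sided_flow P Q 1))" by (auto simp: bounded_iff)
  from bounded_flow_intertwines[OF _ _ this, of ps qs] assms show ?thesis by simp
qed

section \<open>Exponential decay for positive shifts\<close>

text \<open>Induction on the shifts. After rescaling by \<open>exp (l * s)\<close> the orbit of
  \<open>X\<close> has velocity \<open>F (- Y)\<close> with \<open>Y = (L - l) * X\<close>, which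
  the induction hypothesis controls; the mean value inequality then costs a factor \<open>s\<close>,
  absorbed by halving the rate. The factor \<open>X\<close> is there for the induction; the case of
  interest is \<open>X = 1\<close>.\<close>

lemma shift_prod_exp_decay:
  fixes L X :: "'a::{real_normed_algebra_1,banach}"
  assumes "shift_prod L (map of_real ls) * X = 0" "\<And>l. l \<in> set ls \<Longrightarrow> l > 0"
  shows "\<exists>C \<epsilon>. \<epsilon> > 0 \<and> (\<forall>s\<ge>0. norm (exp (- s *\<^sub>R L) * X) \<le> C * exp (- \<epsilon> * s))"
  using assms
proof (induction ls arbitrary: X)
  case Nil
  then show ?case by (intro exI[of _ 0] exI[of _ 1]) simp
next
  case (Cons l ls)
  define Y where "Y = (L - of_real l) * X"
  have "(L - of_real l) * shift_prod L (map of_real ls) = shift_prod L (map of_real ls) * (L - of_real l)"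
    by (rule shift_prod_of_real_commutes) (simp add: left_diff_distrib right_diff_distrib of_real_def)
  then have "shift_prod L (map of_real ls) * Y = 0"
    using Cons.prems(1) by (simp add: Y_def mult.assoc[symmetric])
  then obtain C0 \<epsilon>0 where e0: "\<epsilon>0 > 0"
    and C0: "\<And>s. s \<ge> 0 \<Longrightarrow> norm (exp (- s *\<^sub>R L) * Y) \<le> C0 * exp (- \<epsilon>0 * s)"
    using Cons.IH[of Y] Cons.prems(2) by auto
  have l: "l > 0" using Cons.prems(2) by simp
  \<comment> \<open>With \<open>\<epsilon> \<le> l\<close> the function
    \<open>exp ((l - \<epsilon>) * u)\<close> is nondecreasing, so on the interval from 0 to
    \<open>s\<close> its value at \<open>s\<close> bounds the velocity.\<close>
  define \<epsilon> where "\<epsilon> = min \<epsilon>0 l"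
  have e: "\<epsilon> > 0" "\<epsilon> \<le> \<epsilon>0" "\<epsilon> \<le> l" using e0 l by (auto simp: \<epsilon>_def)
  have C0_pos: "C0 \<ge> 0" using order_trans[OF norm_ge_zero C0[of 0]] by simp
  have C: "norm (exp (- s *\<^sub>R L) * Y) \<le> C0 * exp (- \<epsilon> * s)" if "s \<ge> 0" for s
  proof -
    have "C0 * exp (- \<epsilon>0 * s) \<le> C0 * exp (- \<epsilon> * s)"
      using C0_pos e that by (intro mult_left_mono) (auto intro: mult_right_mono)
    with C0[OF that] show ?thesis by linarith
  qed
  define F where "F = two_sided_flow L (of_real l)"
  have F: "F Z s = exp (l * s) *\<^sub>R (exp (- s *\<^sub>R L) * Z)" for Z s
  proof -
    have "exp (s *\<^sub>R of_real l :: 'a) = of_real (exp (l * s))"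
      using exp_of_real_algebra[of "l * s", where 'a='a] by (simp add: of_real_def mult.commute)
    then show ?thesis by (simp add: F_def two_sided_flow_def of_real_def)
  qed
  have der: "(F X has_vector_derivative F (- Y) s) (at s)" for s
  proof -
    have "X * of_real l - L * X = - Y"
      by (simp add: Y_def left_diff_distrib of_real_commutes)
    then show ?thesis using two_sided_flow_derivative[of L "of_real l" X s] by (simp add: F_def)
  qed
  have bound: "norm (F (- Y) u) \<le> C0 * exp ((l - \<epsilon>) * s)" if "u \<in> {0..s}" for u s
  proof -
    have "norm (F (- Y) u) \<le> exp (l * u) * (C0 * exp (- \<epsilon> * u))"
      unfolding F using C[of u] that by simp
    also have "\<dots> = C0 * exp ((l - \<epsilon>) * u)" by (simp add: exp_add[symmetric] algebra_simps)
    also have "\<dots> \<le> C0 * exp ((l - \<epsilon>) * s)"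
      using C0_pos e that by (intro mult_left_mono) (auto intro: mult_left_mono)
    finally show ?thesis .
  qed
  have diff: "norm (F X s - F X 0) \<le> C0 * exp ((l - \<epsilon>) * s) * norm (s - 0)" if "s \<ge> 0" for s
  proof (rule differentiable_bound[of "{0..s}"])
    show "(F X has_derivative (\<lambda>h. h *\<^sub>R F (- Y) u)) (at u within {0..s})" for u
      using der[of u] by (simp add: has_vector_derivative_def has_derivative_at_withinI)
    show "onorm (\<lambda>h. h *\<^sub>R F (- Y) u) \<le> C0 * exp ((l - \<epsilon>) * s)" if "u \<in> {0..s}" for u
      using mult_left_mono[OF bound[OF that], of "\<bar>h\<bar>" for h]
      by (intro onorm_le) (simp add: mult.commute)
  qed (use that in auto)
  have "norm (exp (- s *\<^sub>R L) * X) \<le> (norm X + C0 * (2 / \<epsilon>)) * exp (- (\<epsilon> / 2) * s)" if s: "s \<ge> 0" for s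
  proof -
    have "norm (F X s) \<le> norm X + norm (F X s - F X 0)"
      using norm_triangle_sub[of "F X s" X] by (simp add: F_def)
    also have "\<dots> \<le> norm X + C0 * exp ((l - \<epsilon>) * s) * s"
      using diff[OF s] s by simp
    finally have "exp (l * s) * norm (exp (- s *\<^sub>R L) * X) \<le> norm X + C0 * exp ((l - \<epsilon>) * s) * s"
      unfolding F by simp
    then have "exp (- l * s) * (exp (l * s) * norm (exp (- s *\<^sub>R L) * X))
        \<le> exp (- l * s) * (norm X + C0 * exp ((l - \<epsilon>) * s) * s)"
      by (rule mult_left_mono) simp
    also have "exp (- l * s) * (exp (l * s) * norm (exp (- s *\<^sub>R L) * X)) = norm (exp (- s *\<^sub>R L) * X)"
      by (simp add: mult.assoc[symmetric] exp_add[symmetric])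
    also have "exp (- l * s) * (norm X + C0 * exp ((l - \<epsilon>) * s) * s)
        = norm X * exp (- l * s) + C0 * (exp (- \<epsilon> * s) * s)"
    proof -
      have "exp (- l * s) * exp ((l - \<epsilon>) * s) = exp (- \<epsilon> * s)"
        by (simp add: exp_add[symmetric] left_diff_distrib)
      then show ?thesis by (simp only: distrib_left mult.assoc mult.left_commute mult.commute)
    qed
    also have "\<dots> \<le> norm X * exp (- (\<epsilon> / 2) * s) + C0 * (2 / \<epsilon> * exp (- (\<epsilon> / 2) * s))"
    proof (intro add_mono mult_left_mono C0_pos norm_ge_zero)
      have "\<epsilon> / 2 * s \<le> l * s" using e s by (intro mult_right_mono) auto
      then show "exp (- l * s) \<le> exp (- (\<epsilon> / 2) * s)" by simp
      \<comment> \<open>Half of the decay rate pays for the linear factor \<open>s\<close>.\<close>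
      have "\<epsilon> / 2 * s \<le> exp (\<epsilon> / 2 * s)" using exp_ge_add_one_self[of "\<epsilon> / 2 * s"] by linarith
      then have "s \<le> 2 / \<epsilon> * exp (\<epsilon> / 2 * s)" using e by (simp add: field_simps)
      then have "exp (- \<epsilon> * s) * s \<le> exp (- \<epsilon> * s) * (2 / \<epsilon> * exp (\<epsilon> / 2 * s))"
        by (rule mult_left_mono) simp
      also have "\<dots> = 2 / \<epsilon> * exp (- (\<epsilon> / 2) * s)"
        by (simp add: exp_add[symmetric])
      finally show "exp (- \<epsilon> * s) * s \<le> 2 / \<epsilon> * exp (- (\<epsilon> / 2) * s)" .
    qed
    finally show ?thesis by (simp add: algebra_simps)
  qed
  moreover have "\<epsilon> / 2 > 0" using e by simp
  ultimately show ?case by blast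
qed

section \<open>Logarithms of unipotent elements\<close>

text \<open>The remainder is a power series in \<open>N\<close>, so it commutes with whatever
  commutes with \<open>N\<close>. The recursion for the logarithm uses this as well as the factor
  \<open>N ^ 2\<close>.\<close>

lemma exp_second_order:
  fixes N :: "'a::{real_normed_algebra_1,banach}"
  shows "\<exists>R. exp N = 1 + N + N ^ 2 * R \<and> (\<forall>Y. Y * N = N * Y \<longrightarrow> Y * R = R * Y)"
proof -
  define c where "c = (\<lambda>n. N ^ n /\<^sub>R fact (n + 2))"
  have "summable c"
  proof (rule summable_comparison_test[OF _ summable_norm_exp[of N]])
    have "inverse (fact (n + 2)) \<le> (inverse (fact n) :: real)" for n
      by (intro le_imp_inverse_le fact_mono fact_gt_zero) simp
    then have "norm (c n) \<le> norm (N ^ n /\<^sub>R fact n)" for n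
      unfolding c_def norm_scaleR by (intro mult_right_mono norm_ge_zero) simp
    then show "\<exists>M. \<forall>n\<ge>M. norm (c n) \<le> norm (N ^ n /\<^sub>R fact n)" by blast
  qed
  have "exp N = 1 + N + (\<Sum>n. inverse (fact (n + 2)) *\<^sub>R N ^ (n + 2))"
    by (rule exp_first_two_terms)
  also have "(\<lambda>n. inverse (fact (n + 2)) *\<^sub>R N ^ (n + 2)) = (\<lambda>n. N ^ 2 * c n)"
    by (simp only: c_def mult_scaleR_right power_add power_commutes[of N] flip: power_add)
      (simp add: add.commute)
  also have "(\<Sum>n. N ^ 2 * c n) = N ^ 2 * suminf c" by (rule suminf_mult[OF \<open>summable c\<close>])
  finally have 1: "exp N = 1 + N + N ^ 2 * suminf c" .
  have 2: "Y * suminf c = suminf c * Y" if "Y * N = N * Y" for Y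
  proof -
    have "Y * N ^ n = N ^ n * Y" for n by (metis that power_commuting_commutes)
    then have "Y * c n = c n * Y" for n by (simp add: c_def)
    then show ?thesis
      using suminf_mult[OF \<open>summable c\<close>, of Y] suminf_mult2[OF \<open>summable c\<close>, of Y] by simp
  qed
  from 1 2 show ?thesis by blast
qed

text \<open>
  Multiplying \<open>1 + N\<close> by \<open>exp (- N)\<close> leaves \<open>1 + N'\<close> where \<open>N'\<close> is a multiple of \<open>N\<^sup>2\<close>, so the
  nilpotency order drops.
\<close>
lemma nilpotent_logarithm:
  fixes N :: "'a::{real_normed_algebra_1,banach}"
  assumes "N ^ m = 0"
  shows "\<exists>S. exp (N * S) = 1 + N \<and> (\<forall>Y. Y * N = N * Y \<longrightarrow> Y * S = S * Y)"
  using assms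
proof (induction m arbitrary: N rule: less_induct)
  case (less m)
  show ?case
  proof (cases "m \<le> 1")
    case True
    then have "N ^ 1 = 0" using power_eq_0_mono[OF less.prems] by blast
    then show ?thesis by (intro exI[of _ 0]) simp
  next
    case False
    obtain R where R: "exp (- N) = 1 + (- N) + (- N) ^ 2 * R"
      and R_comm: "\<And>Y. Y * (- N) = (- N) * Y \<Longrightarrow> Y * R = R * Y"
      using exp_second_order[of "- N"] by blast
    define W where "W = R * (1 + N) - 1"
    have W_comm: "Y * W = W * Y" if "Y * N = N * Y" for Y
    proof -
      have 1: "Y * (1 + N) = (1 + N) * Y" by (simp add: distrib_left distrib_right that)
      have "Y * (R * (1 + N)) = R * (1 + N) * Y"
        by (metis 1 R_comm that mult.assoc mult_minus_left mult_minus_right)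
      then show ?thesis by (simp add: W_def right_diff_distrib left_diff_distrib)
    qed
    have NW: "N * W = W * N" by (rule W_comm) simp
    define N' where "N' = N ^ 2 * W"
    have expN: "exp (- N) * (1 + N) = 1 + N'"
      unfolding R N'_def W_def
      by (simp add: distrib_left distrib_right right_diff_distrib left_diff_distrib mult.assoc power2_eq_square)
    have N'_comm: "Y * N' = N' * Y" if "Y * N = N * Y" for Y
      unfolding N'_def by (metis W_comm that power_commuting_commutes mult.assoc)
    have "N' ^ (m - 1) = (N ^ 2) ^ (m - 1) * W ^ (m - 1)"
      unfolding N'_def by (rule power_mult_commuting) (metis NW power_commuting_commutes)
    \<comment> \<open>The exponent is \<open>2 * (m - 1)\<close>, which is at least \<open>m\<close>
      because \<open>m \<ge> 2\<close> in this case.\<close>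
    also have "(N ^ 2) ^ (m - 1) = 0"
      unfolding power_mult[symmetric] using False by (intro power_eq_0_mono[OF less.prems]) simp
    finally have "N' ^ (m - 1) = 0" by simp
    then obtain S' where S': "exp (N' * S') = 1 + N'"
      and S'_comm: "\<And>Y. Y * N' = N' * Y \<Longrightarrow> Y * S' = S' * Y"
      using less.IH[of "m - 1" N'] False by auto
    \<comment> \<open>Chosen so that \<open>N * S = N + N' * S'\<close>, the sum of two commuting
      logarithms. Keeping \<open>N\<close> as an explicit factor is what later makes the logarithm
      nilpotent.\<close>
    define S where "S = 1 + N * W * S'"
    have S_comm: "Y * S = S * Y" if "Y * N = N * Y" for Y
    proof -
      have "Y * (N * W * S') = N * W * S' * Y"
        by (metis that W_comm[OF that] S'_comm[OF N'_comm[OF that]] mult.assoc)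
      then show ?thesis by (simp add: S_def distrib_left distrib_right)
    qed
    have NS: "N * S = N + N' * S'"
      by (simp add: S_def N'_def distrib_left power2_eq_square mult.assoc)
    have "N * (N' * S') = N' * S' * N"
      by (metis N'_comm S'_comm mult.assoc)
    then have "exp (N * S) = exp N * exp (N' * S')"
      unfolding NS by (rule exp_add_commuting)
    also have "\<dots> = exp N * exp (- N) * (1 + N)"
      by (simp only: S' expN[symmetric] mult.assoc)
    finally have "exp (N * S) = 1 + N" by (simp add: exp_minus_inverse_algebra)
    with S_comm show ?thesis by blast
  qed
qed

text \<open>Negative arguments are settled by the uniqueness of inverses in a monoid.\<close>

lemma int_hom_unique:
  fixes f g :: "int \<Rightarrow> 'a::monoid_mult"
  assumes "\<And>k l. f (k + l) = f k * f l" "\<And>k l. g (k + l) = g k * g l"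
    "f 0 = 1" "g 0 = 1" "f 1 = g 1"
  shows "f k = g k"
proof -
  have pos: "f (int n) = g (int n)" for n
  proof (induction n)
    case (Suc n)
    then show ?case using assms(1)[of "int n" 1] assms(2)[of "int n" 1] assms(5) by (simp add: add.commute)
  qed (simp add: assms)
  have neg: "f (- int n) = g (- int n)" for n
  proof -
    have "f (- int n) = f (- int n) * (g (int n) * g (- int n))"
      using assms(2)[of "int n" "- int n"] assms(4) by simp
    also have "\<dots> = (f (- int n) * f (int n)) * g (- int n)" by (simp add: pos mult.assoc)
    also have "\<dots> = g (- int n)" using assms(1)[of "- int n" "int n"] assms(3) by simp
    finally show ?thesis .
  qed
  show ?thesis using pos neg by (cases k rule: int_cases2) auto
qed

section \<open>The Banach algebra of complex matrices\<close>

text \<open>A copy of the matrix type on which \<open>*\<close> can be the matrix product and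
  \<open>norm\<close> a submultiplicative norm, so that all of the preceding section
  applies.\<close>

typedef (overloaded) ('n::finite) cmat = "UNIV :: (complex^'n^'n) set"
  morphisms cmat_rep cmat_abs by simp

setup_lifting type_definition_cmat

lemma cmat_eq_iff: "A = B \<longleftrightarrow> (\<forall>i j. cmat_rep A $ i $ j = cmat_rep B $ i $ j)"
  by (simp add: cmat_rep_inject[symmetric] vec_eq_iff)

instantiation cmat :: (finite) real_algebra_1
begin

lift_definition zero_cmat :: "'a cmat" is 0 .
lift_definition one_cmat :: "'a cmat" is "mat 1" .
lift_definition plus_cmat :: "'a cmat \<Rightarrow> 'a cmat \<Rightarrow> 'a cmat" is "(+)" .
lift_definition minus_cmat :: "'a cmat \<Rightarrow> 'a cmat \<Rightarrow> 'a cmat" is "(-)" .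
lift_definition uminus_cmat :: "'a cmat \<Rightarrow> 'a cmat" is "uminus" .
lift_definition times_cmat :: "'a cmat \<Rightarrow> 'a cmat \<Rightarrow> 'a cmat" is "(**)" .
lift_definition scaleR_cmat :: "real \<Rightarrow> 'a cmat \<Rightarrow> 'a cmat" is "scaleR" .

instance
proof
  fix a b c :: "'a cmat" and r s :: real
  show "a * b * c = a * (b * c)" by transfer (simp add: matrix_mul_assoc)
  show "(a + b) * c = a * c + b * c" by transfer (simp add: vec_eq_iff matrix_matrix_mult_def distrib_right sum.distrib)
  show "a * (b + c) = a * b + a * c" by transfer (simp add: matrix_add_ldistrib)
  show "1 * a = a" "a * 1 = a" by (transfer, simp)+
  show "(0::'a cmat) \<noteq> 1" by transfer (simp add: vec_eq_iff mat_def)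
  show "r *\<^sub>R a * b = r *\<^sub>R (a * b)" "a * r *\<^sub>R b = r *\<^sub>R (a * b)"
    by (transfer, simp add: vec_eq_iff matrix_matrix_mult_def scaleR_sum_right)+
qed (transfer, simp add: algebra_simps)+

end

lemma cmat_rep_simps [simp]:
  "cmat_rep 0 = 0" "cmat_rep 1 = mat 1" "cmat_rep (A + B) = cmat_rep A + cmat_rep B"
  "cmat_rep (A - B) = cmat_rep A - cmat_rep B" "cmat_rep (- A) = - cmat_rep A"
  "cmat_rep (A * B) = cmat_rep A ** cmat_rep B" "cmat_rep (r *\<^sub>R A) = r *\<^sub>R cmat_rep A"
  by (transfer, simp)+

instantiation cmat :: (finite) real_normed_algebra_1
begin

text \<open>The operator norm belonging to the maximum norm on vectors; it is submultiplicative and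
  gives the identity norm 1.\<close>

definition norm_cmat :: "'a cmat \<Rightarrow> real" where
  "norm_cmat A = Max (range (\<lambda>i. \<Sum>j\<in>UNIV. cmod (cmat_rep A $ i $ j)))"
definition sgn_cmat :: "'a cmat \<Rightarrow> 'a cmat" where "sgn_cmat A = A /\<^sub>R norm A"
definition dist_cmat :: "'a cmat \<Rightarrow> 'a cmat \<Rightarrow> real" where "dist_cmat A B = norm (A - B)"
definition uniformity_cmat :: "('a cmat \<times> 'a cmat) filter" where
  "uniformity_cmat = (INF e\<in>{0<..}. principal {(x, y). dist x y < e})"
definition open_cmat :: "'a cmat set \<Rightarrow> bool" where
  "open_cmat U \<longleftrightarrow> (\<forall>x\<in>U. eventually (\<lambda>(x', y). x' = x \<longrightarrow> y \<in> U) uniformity)"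

lemma cmat_row_le_norm: "(\<Sum>j\<in>UNIV. cmod (cmat_rep A $ i $ j)) \<le> norm A"
  unfolding norm_cmat_def by (rule Max_ge) auto

lemma cmat_norm_le_iff: "norm A \<le> c \<longleftrightarrow> (\<forall>i. (\<Sum>j\<in>UNIV. cmod (cmat_rep A $ i $ j)) \<le> c)"
  unfolding norm_cmat_def by (subst Max_le_iff) auto

lemma cmat_entry_le_norm: "cmod (cmat_rep A $ i $ j) \<le> norm A"
  by (rule order_trans[OF member_le_sum cmat_row_le_norm]) auto

instance
proof
  fix a b :: "'a cmat" and r :: real and U :: "'a cmat set"
  have nonneg: "0 \<le> norm a" using order_trans[OF norm_ge_zero cmat_entry_le_norm] .
  show "norm a = 0 \<longleftrightarrow> a = 0"
  proof
    assume "norm a = 0"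
    then have "cmod (cmat_rep a $ i $ j) \<le> 0" for i j by (metis cmat_entry_le_norm)
    then show "a = 0" by (simp add: cmat_eq_iff)
  next
    assume "a = 0"
    then have "norm a \<le> 0" by (simp add: cmat_norm_le_iff)
    with nonneg show "norm a = 0" by simp
  qed
  show "norm (a + b) \<le> norm a + norm b"
    unfolding cmat_norm_le_iff
  proof
    fix i
    have "(\<Sum>j\<in>UNIV. cmod (cmat_rep (a + b) $ i $ j))
        \<le> (\<Sum>j\<in>UNIV. cmod (cmat_rep a $ i $ j) + cmod (cmat_rep b $ i $ j))"
      by (intro sum_mono) (simp add: norm_triangle_ineq)
    also have "\<dots> \<le> norm a + norm b"
      unfolding sum.distrib by (intro add_mono cmat_row_le_norm)
    finally show "(\<Sum>j\<in>UNIV. cmod (cmat_rep (a + b) $ i $ j)) \<le> norm a + norm b" .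
  qed
  show "norm (r *\<^sub>R a) = \<bar>r\<bar> * norm a"
  proof -
    have le: "norm (s *\<^sub>R c) \<le> \<bar>s\<bar> * norm c" for s and c :: "'a cmat"
      unfolding cmat_norm_le_iff
      by (auto simp: sum_distrib_left[symmetric] intro!: mult_left_mono cmat_row_le_norm)
    show ?thesis
    proof (cases "r = 0")
      case True
      then show ?thesis using le[of 0 a] order_trans[OF norm_ge_zero cmat_entry_le_norm[of "0 *\<^sub>R a"]] by auto
    next
      case False
      have "norm (inverse r *\<^sub>R (r *\<^sub>R a)) \<le> \<bar>inverse r\<bar> * norm (r *\<^sub>R a)" by (rule le)
      then have "norm a \<le> norm (r *\<^sub>R a) / \<bar>r\<bar>" using False by (simp add: divide_inverse mult.commute)
      then have "\<bar>r\<bar> * norm a \<le> norm (r *\<^sub>R a)" using False by (simp add: field_simps)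
      with le[of r a] show ?thesis by linarith
    qed
  qed
  show "norm (a * b) \<le> norm a * norm b"
    unfolding cmat_norm_le_iff
  proof
    fix i
    have "(\<Sum>j\<in>UNIV. cmod (cmat_rep (a * b) $ i $ j))
        \<le> (\<Sum>j\<in>UNIV. \<Sum>k\<in>UNIV. cmod (cmat_rep a $ i $ k) * cmod (cmat_rep b $ k $ j))"
      by (intro sum_mono) (auto simp: matrix_matrix_mult_def norm_mult[symmetric] intro!: norm_sum)
    also have "\<dots> = (\<Sum>k\<in>UNIV. cmod (cmat_rep a $ i $ k) * (\<Sum>j\<in>UNIV. cmod (cmat_rep b $ k $ j)))"
      by (subst sum.swap) (simp add: sum_distrib_left)
    also have "\<dots> \<le> (\<Sum>k\<in>UNIV. cmod (cmat_rep a $ i $ k) * norm b)"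
      by (intro sum_mono mult_left_mono cmat_row_le_norm norm_ge_zero)
    also have "\<dots> = (\<Sum>k\<in>UNIV. cmod (cmat_rep a $ i $ k)) * norm b" by (simp add: sum_distrib_right)
    also have "\<dots> \<le> norm a * norm b"
      by (intro mult_right_mono cmat_row_le_norm order_trans[OF norm_ge_zero cmat_entry_le_norm])
    finally show "(\<Sum>j\<in>UNIV. cmod (cmat_rep (a * b) $ i $ j)) \<le> norm a * norm b" .
  qed
  have "(\<Sum>j\<in>UNIV. cmod ((mat 1 :: complex^'a^'a) $ i $ j)) = 1" for i
    by (simp add: mat_def if_distrib[of cmod] sum.delta' cong: if_cong)
  then show "norm (1::'a cmat) = 1"
    unfolding norm_cmat_def by simp
qed (simp_all add: sgn_cmat_def dist_cmat_def uniformity_cmat_def open_cmat_def)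

end

lemma cmat_norm_le_sum: "norm A \<le> (\<Sum>i\<in>UNIV. \<Sum>j\<in>UNIV. cmod (cmat_rep A $ i $ j))"
  unfolding cmat_norm_le_iff by (auto intro!: member_le_sum sum_nonneg)

instance cmat :: (finite) banach
proof
  fix X :: "nat \<Rightarrow> 'a cmat"
  assume X: "Cauchy X"
  define E where "E i j n = cmat_rep (X n) $ i $ j" for i j n
  have "Cauchy (E i j)" for i j
    unfolding Cauchy_def
  proof (intro allI impI)
    fix e :: real assume "e > 0"
    then obtain N where N: "\<And>m n. m \<ge> N \<Longrightarrow> n \<ge> N \<Longrightarrow> dist (X m) (X n) < e"
      using X unfolding Cauchy_def by blast
    have "dist (E i j m) (E i j n) \<le> dist (X m) (X n)" for m n
      using cmat_entry_le_norm[of "X m - X n" i j] by (simp add: E_def dist_norm)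
    with N show "\<exists>M. \<forall>m\<ge>M. \<forall>n\<ge>M. dist (E i j m) (E i j n) < e"
      by (meson order_le_less_trans)
  qed
  then have lim: "E i j \<longlonglongrightarrow> lim (E i j)" for i j
    using Cauchy_convergent convergent_LIMSEQ_iff by blast
  define L where "L = cmat_abs (\<chi> i j. lim (E i j))"
  have L: "cmat_rep L $ i $ j = lim (E i j)" for i j
    by (simp add: L_def cmat_abs_inverse)
  have "(\<lambda>n. \<Sum>i\<in>UNIV. \<Sum>j\<in>UNIV. cmod (E i j n - lim (E i j))) \<longlonglongrightarrow> (\<Sum>i\<in>(UNIV::'a set). \<Sum>j\<in>(UNIV::'a set). 0)"
    by (intro tendsto_sum tendsto_norm_zero LIM_zero lim)
  then have "(\<lambda>n. \<Sum>i\<in>UNIV. \<Sum>j\<in>UNIV. cmod (E i j n - lim (E i j))) \<longlonglongrightarrow> 0" by simp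
  then have "(\<lambda>n. X n - L) \<longlonglongrightarrow> 0"
  proof (rule Lim_null_comparison[rotated])
    show "\<forall>\<^sub>F n in sequentially. norm (X n - L) \<le> (\<Sum>i\<in>UNIV. \<Sum>j\<in>UNIV. cmod (E i j n - lim (E i j)))"
      using cmat_norm_le_sum[of "X n - L" for n] by (auto simp: L E_def)
  qed
  then show "convergent X" using LIM_zero_cancel convergentI by blast
qed

section \<open>Scalars, conjugation and real matrices\<close>

lift_definition cmat_scalar :: "complex \<Rightarrow> ('n::finite) cmat" is "mat" .
lift_definition cmat_cnj :: "('n::finite) cmat \<Rightarrow> 'n cmat" is "map_matrix cnj" .
lift_definition cmat_of_real :: "real^'n^'n \<Rightarrow> ('n::finite) cmat" is "map_matrix complex_of_real" .
lift_definition cmat_Re :: "('n::finite) cmat \<Rightarrow> real^'n^'n" is "map_matrix Re" .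

lemma cmat_scalar_entry: "cmat_rep (cmat_scalar z) $ i $ j = (if i = j then z else 0)"
  by (simp add: cmat_scalar.rep_eq mat_def)

lemma cmat_cnj_entry [simp]: "cmat_rep (cmat_cnj A) $ i $ j = cnj (cmat_rep A $ i $ j)"
  by (simp add: cmat_cnj.rep_eq map_matrix_def)

lemma cmat_of_real_entry [simp]: "cmat_rep (cmat_of_real R) $ i $ j = complex_of_real (R $ i $ j)"
  by (simp add: cmat_of_real.rep_eq map_matrix_def)

lemma cmat_Re_entry [simp]: "cmat_Re A $ i $ j = Re (cmat_rep A $ i $ j)"
  by (simp add: cmat_Re.rep_eq map_matrix_def)

lemma cmat_scalar_mult_entry:
  "cmat_rep (cmat_scalar z * A) $ i $ j = z * cmat_rep A $ i $ j"
  "cmat_rep (A * cmat_scalar z) $ i $ j = z * cmat_rep A $ i $ j"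
  by (simp_all add: matrix_matrix_mult_def cmat_scalar_entry if_distrib if_distribR
      sum.delta sum.delta' mult.commute cong: if_cong)

lemma cmat_scalar_commutes: "cmat_scalar z * A = A * cmat_scalar z"
  unfolding cmat_eq_iff cmat_scalar_mult_entry by simp

lemma cmat_scalar_add: "cmat_scalar (z + w) = cmat_scalar z + cmat_scalar w"
  and cmat_scalar_diff: "cmat_scalar (z - w) = cmat_scalar z - cmat_scalar w"
  and cmat_scalar_uminus: "cmat_scalar (- z) = - cmat_scalar z"
  and cmat_scalar_0 [simp]: "cmat_scalar 0 = 0"
  and cmat_scalar_1 [simp]: "cmat_scalar 1 = 1"
  by (auto simp: cmat_eq_iff cmat_scalar_entry mat_def)

lemma cmat_scalar_of_real: "cmat_scalar (complex_of_real r) = (of_real r :: ('n::finite) cmat)"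
  unfolding of_real_def[where 'a="'n cmat"]
  by (auto simp: cmat_eq_iff cmat_scalar_entry mat_def scaleR_conv_of_real[where 'a=complex])

lemma cmat_scalar_mult: "cmat_scalar (z * w) = cmat_scalar z * cmat_scalar w"
  unfolding cmat_eq_iff cmat_scalar_mult_entry by (simp add: cmat_scalar_entry)

lemma cmat_scalar_mult_eq_0_iff: "cmat_scalar z * A = 0 \<longleftrightarrow> z = 0 \<or> A = 0"
  unfolding cmat_eq_iff cmat_scalar_mult_entry by auto

lemma norm_cmat_scalar [simp]: "norm (cmat_scalar z :: ('n::finite) cmat) = cmod z"
proof -
  have "(\<Sum>j\<in>UNIV. cmod (cmat_rep (cmat_scalar z :: 'n cmat) $ i $ j)) = cmod z" for i
    by (simp add: cmat_scalar_entry if_distrib[of cmod] sum.delta' cong: if_cong)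
  then show ?thesis unfolding norm_cmat_def by simp
qed

lemma cmat_cnj_simps [simp]:
  "cmat_cnj 0 = 0" "cmat_cnj 1 = 1" "cmat_cnj (A + B) = cmat_cnj A + cmat_cnj B"
  "cmat_cnj (A - B) = cmat_cnj A - cmat_cnj B" "cmat_cnj (A * B) = cmat_cnj A * cmat_cnj B"
  "cmat_cnj (r *\<^sub>R A) = r *\<^sub>R cmat_cnj A"
  by (auto simp: cmat_eq_iff mat_def matrix_matrix_mult_def scaleR_conv_of_real[where 'a=complex])

lemma cmat_cnj_of_real [simp]: "cmat_cnj (of_real r) = of_real r"
  by (simp add: of_real_def)

lemma norm_cmat_cnj [simp]: "norm (cmat_cnj A) = norm A"
  by (simp add: norm_cmat_def)

lemma bounded_linear_cmat_cnj: "bounded_linear cmat_cnj"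
  by (rule bounded_linear_intro[of _ 1]) simp_all

lemma cmat_cnj_exp: "cmat_cnj (exp A) = exp (cmat_cnj A)"
  by (rule exp_bounded_linear_hom[OF bounded_linear_cmat_cnj]) simp_all

lemma cmat_of_real_simps [simp]:
  "cmat_of_real 0 = 0" "cmat_of_real (mat 1) = 1"
  "cmat_of_real (R + S) = cmat_of_real R + cmat_of_real S"
  "cmat_of_real (R - S) = cmat_of_real R - cmat_of_real S"
  "cmat_of_real (R ** S) = cmat_of_real R * cmat_of_real S"
  "cmat_of_real (r *\<^sub>R R) = r *\<^sub>R cmat_of_real R"
  by (auto simp: cmat_eq_iff mat_def matrix_matrix_mult_def scaleR_conv_of_real[where 'a=complex])

lemma cmat_Re_of_real [simp]: "cmat_Re (cmat_of_real R) = R"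
  by (simp add: vec_eq_iff)

lemma cmat_of_real_inject [simp]: "cmat_of_real R = cmat_of_real S \<longleftrightarrow> R = S"
  by (metis cmat_Re_of_real)

lemma cmat_of_real_Re: "cmat_of_real (cmat_Re A) = A \<longleftrightarrow> cmat_cnj A = A"
  by (auto simp: cmat_eq_iff complex_eq_iff)

lemma cmat_cnj_cmat_of_real [simp]: "cmat_cnj (cmat_of_real R) = cmat_of_real R"
  by (simp add: cmat_eq_iff)

lemma bounded_linear_cmat_Re: "bounded_linear (cmat_Re :: ('n::finite) cmat \<Rightarrow> real^'n^'n)"
proof (rule bounded_linear_intro[of _ "real CARD('n)"])
  fix A :: "'n cmat"
  have "norm (cmat_Re A) \<le> (\<Sum>i\<in>UNIV. norm (cmat_Re A $ i))"
    by (simp add: norm_vec_def L2_set_le_sum)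
  also have "\<dots> \<le> (\<Sum>i\<in>(UNIV::'n set). norm A)"
  proof (rule sum_mono)
    fix i
    have "norm (cmat_Re A $ i) \<le> (\<Sum>j\<in>UNIV. norm (cmat_Re A $ i $ j))"
      by (simp only: norm_vec_def[of "cmat_Re A $ i"] L2_set_le_sum norm_ge_zero)
    also have "\<dots> \<le> (\<Sum>j\<in>UNIV. cmod (cmat_rep A $ i $ j))"
      by (intro sum_mono) (simp add: abs_Re_le_cmod)
    also have "\<dots> \<le> norm A" by (rule cmat_row_le_norm)
    finally show "norm (cmat_Re A $ i) \<le> norm A" .
  qed
  finally show "norm (cmat_Re A) \<le> norm A * real CARD('n)" by (simp add: mult.commute)
qed (simp_all add: vec_eq_iff)

text \<open>Conjugation commutes with \<open>exp\<close>, so the exponential of a real matrix is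
  fixed by it and equals its own real part, which is the defining series of
  \<open>matrix_exp\<close>.\<close>

lemma cmat_of_real_matrix_exp: "cmat_of_real (matrix_exp X) = exp (cmat_of_real X)"
proof -
  have pow: "cmat_of_real ((((**) X) ^^ k) (mat 1)) = cmat_of_real X ^ k" for k
    by (induction k) simp_all
  have entry: "cmat_Re (cmat_of_real X ^ k /\<^sub>R fact k) = (1 / fact k) *\<^sub>R (((**) X) ^^ k) (mat 1)" for k
    by (simp add: pow[symmetric] flip: cmat_of_real_simps(6)) (simp add: divide_inverse)
  have "(\<lambda>k. cmat_Re (cmat_of_real X ^ k /\<^sub>R fact k)) sums cmat_Re (exp (cmat_of_real X))"
    by (intro bounded_linear.sums[OF bounded_linear_cmat_Re] exp_converges)
  then have "cmat_Re (exp (cmat_of_real X)) = matrix_exp X"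
    unfolding entry matrix_exp_def by (simp add: sums_iff)
  moreover have "cmat_of_real (cmat_Re (exp (cmat_of_real X))) = exp (cmat_of_real X)"
    by (simp add: cmat_of_real_Re cmat_cnj_exp)
  ultimately show ?thesis by simp
qed

text \<open>With \<open>norm_cmat_of_real_le\<close> as its counterpart, this moves bounds between
  the action on vectors and the algebra norm at the cost of a factor depending on the dimension
  only.\<close>

lemma norm_matrix_vector_le:
  fixes R :: "real^'n^'n"
  shows "norm (R *v x) \<le> real CARD('n) * norm (cmat_of_real R) * norm x"
proof -
  have "norm (R *v x) \<le> (\<Sum>i\<in>UNIV. \<bar>(R *v x) $ i\<bar>)" by (rule norm_le_l1_cart)
  also have "\<dots> \<le> (\<Sum>i\<in>(UNIV::'n set). norm (cmat_of_real R) * norm x)"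
  proof (rule sum_mono)
    fix i
    have "\<bar>(R *v x) $ i\<bar> \<le> (\<Sum>j\<in>UNIV. \<bar>R $ i $ j\<bar> * \<bar>x $ j\<bar>)"
      unfolding matrix_vector_mult_def by (simp add: abs_mult[symmetric] sum_abs)
    also have "\<dots> \<le> (\<Sum>j\<in>UNIV. \<bar>R $ i $ j\<bar> * norm x)"
      by (intro sum_mono mult_left_mono component_le_norm_cart) simp
    also have "\<dots> = (\<Sum>j\<in>UNIV. \<bar>R $ i $ j\<bar>) * norm x" by (simp add: sum_distrib_right)
    also have "\<dots> \<le> norm (cmat_of_real R) * norm x"
      using cmat_row_le_norm[of "cmat_of_real R" i] by (intro mult_right_mono) simp_all
    finally show "\<bar>(R *v x) $ i\<bar> \<le> norm (cmat_of_real R) * norm x" .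
  qed
  finally show ?thesis by simp
qed

lemma matrix_entry_le:
  fixes R :: "real^'n^'n"
  assumes "\<And>x. norm (R *v x) \<le> c * norm x"
  shows "\<bar>R $ i $ j\<bar> \<le> c"
proof -
  have "\<bar>R $ i $ j\<bar> = \<bar>(R *v axis j 1) $ i\<bar>"
    by (simp add: matrix_vector_mul_component inner_axis)
  also have "\<dots> \<le> norm (R *v axis j 1)" by (rule component_le_norm_cart)
  also have "\<dots> \<le> c * 1" using assms[of "axis j 1"] by simp
  finally show ?thesis by simp
qed

lemma norm_cmat_of_real_le:
  fixes R :: "real^'n^'n"
  assumes "\<And>x. norm (R *v x) \<le> c * norm x"
  shows "norm (cmat_of_real R) \<le> real CARD('n) * c"
  unfolding cmat_norm_le_iff
  proof
  fix i
  have "(\<Sum>j\<in>UNIV. \<bar>R $ i $ j\<bar>) \<le> (\<Sum>j\<in>(UNIV::'n set). c)"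
    by (intro sum_mono matrix_entry_le assms)
  then show "(\<Sum>j\<in>UNIV. cmod (cmat_rep (cmat_of_real R) $ i $ j)) \<le> real CARD('n) * c" by simp
qed

section \<open>Eigenvalues and annihilating polynomials\<close>

text \<open>A matrix takes the place of an eigenvector, each of its nonzero columns being one, so
  that arguments about eigenvalues stay inside the algebra.\<close>

definition cmat_eigenvalue :: "('n::finite) cmat \<Rightarrow> complex \<Rightarrow> bool" where
  "cmat_eigenvalue A \<mu> \<longleftrightarrow> (\<exists>V. V \<noteq> 0 \<and> A * V = cmat_scalar \<mu> * V)"

lemma complex_eigenvalue_iff: "complex_eigenvalue A \<mu> \<longleftrightarrow> cmat_eigenvalue (cmat_of_real A) \<mu>"
proof
  assume "complex_eigenvalue A \<mu>"
  then obtain v where v: "v \<noteq> 0" "map_matrix complex_of_real A *v v = \<mu> *s v"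
    by (auto simp: complex_eigenvalue_def)
  define V where "V = cmat_abs (\<chi> i j. v $ i)"
  have V: "cmat_rep V $ i $ j = v $ i" for i j by (simp add: V_def cmat_abs_inverse)
  have "(\<Sum>k\<in>UNIV. complex_of_real (A $ i $ k) * v $ k) = \<mu> * v $ i" for i
    using v(2) by (simp add: vec_eq_iff matrix_vector_mult_def map_matrix_def)
  then have "cmat_of_real A * V = cmat_scalar \<mu> * V"
    unfolding cmat_eq_iff cmat_scalar_mult_entry by (simp add: V matrix_matrix_mult_def)
  moreover have "V \<noteq> 0" using v(1) by (auto simp: cmat_eq_iff V vec_eq_iff)
  ultimately show "cmat_eigenvalue (cmat_of_real A) \<mu>" by (auto simp: cmat_eigenvalue_def)
next
  assume "cmat_eigenvalue (cmat_of_real A) \<mu>"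
  then obtain V where V: "V \<noteq> 0" "cmat_of_real A * V = cmat_scalar \<mu> * V"
    by (auto simp: cmat_eigenvalue_def)
  then obtain i j where ij: "cmat_rep V $ i $ j \<noteq> 0" by (auto simp: cmat_eq_iff)
  define v where "v = (\<chi> i. cmat_rep V $ i $ j)"
  have "v \<noteq> 0" using ij by (auto simp: v_def vec_eq_iff)
  moreover have "map_matrix complex_of_real A *v v = \<mu> *s v"
    using V(2) unfolding cmat_eq_iff cmat_scalar_mult_entry
    by (simp add: v_def vec_eq_iff matrix_vector_mult_def matrix_matrix_mult_def map_matrix_def)
  ultimately show "complex_eigenvalue A \<mu>" by (auto simp: complex_eigenvalue_def)
qed

definition cmat_poly :: "('n::finite) cmat \<Rightarrow> complex poly \<Rightarrow> 'n cmat" where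
  "cmat_poly M p = fold_coeffs (\<lambda>a X. cmat_scalar a + M * X) p 0"

lemma cmat_poly_0 [simp]: "cmat_poly M 0 = 0"
  by (simp add: cmat_poly_def)

lemma cmat_poly_pCons [simp]: "cmat_poly M (pCons a p) = cmat_scalar a + M * cmat_poly M p"
  by (cases "p = 0 \<and> a = 0") (auto simp: cmat_poly_def)

lemma cmat_poly_add: "cmat_poly M (p + q) = cmat_poly M p + cmat_poly M q"
  by (induction p q rule: poly_induct2) (simp_all add: cmat_scalar_add distrib_left)

lemma cmat_poly_smult: "cmat_poly M (smult c p) = cmat_scalar c * cmat_poly M p"
proof (induction p)
  case (pCons a p)
  have "M * (cmat_scalar c * cmat_poly M p) = cmat_scalar c * (M * cmat_poly M p)"
    by (metis cmat_scalar_commutes mult.assoc)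
  then show ?case using pCons by (simp add: cmat_scalar_mult distrib_left)
qed simp

lemma cmat_poly_linear_mult: "cmat_poly M ([:- z, 1:] * q) = (M - cmat_scalar z) * cmat_poly M q"
proof -
  have "[:- z, 1:] * q = pCons 0 q + smult (- z) q" by simp
  then show ?thesis
    by (simp only: cmat_poly_add cmat_poly_smult cmat_scalar_uminus left_diff_distrib cmat_poly_pCons) simp
qed

lemma cmat_poly_monom: "cmat_poly M (monom c k) = cmat_scalar c * M ^ k"
proof (induction k)
  case (Suc k)
  have "M * (cmat_scalar c * M ^ k) = cmat_scalar c * (M * M ^ k)"
    by (metis cmat_scalar_commutes mult.assoc)
  then show ?case using Suc by (simp add: monom_Suc)
qed (simp add: monom_0)

lemma cmat_poly_sum: "cmat_poly M (\<Sum>i\<in>I. f i) = (\<Sum>i\<in>I. cmat_poly M (f i))"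
  by (induction I rule: infinite_finite_induct) (simp_all add: cmat_poly_add)

lemma cmat_poly_commutes: "X * M = M * X \<Longrightarrow> X * cmat_poly M p = cmat_poly M p * X"
proof (induction p)
  case (pCons a p)
  have "X * (M * cmat_poly M p) = M * cmat_poly M p * X"
    by (metis pCons.IH pCons.prems mult.assoc)
  then show ?case by (simp add: distrib_left distrib_right cmat_scalar_commutes)
qed simp

text \<open>There are more powers than the real dimension of the matrix space. If two of them
  coincide, the family of powers has fewer members as a set, and their difference is the
  relation.\<close>

lemma cmat_powers_dependent:
  fixes M :: "('n::finite) cmat"
  shows "\<exists>d a. (\<Sum>k\<le>d. a k *\<^sub>R M ^ k) = 0 \<and> (\<exists>k\<le>d. a k \<noteq> (0::real))"
proof -
  define d where "d = DIM(complex^'n^'n)"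
  define f where "f k = cmat_rep (M ^ k)" for k :: nat
  show ?thesis
  proof (cases "inj_on f {..d}")
    case True
    then have "dependent (f ` {..d})"
      by (intro dependent_biggerset) (simp add: card_image d_def)
    then obtain u where u: "\<exists>v\<in>f ` {..d}. u v \<noteq> 0" "(\<Sum>v\<in>f ` {..d}. u v *\<^sub>R v) = 0"
      by (auto simp: dependent_finite)
    have "(\<Sum>k\<le>d. u (f k) *\<^sub>R f k) = 0" using u(2) True by (simp add: sum.reindex)
    moreover have "cmat_rep (\<Sum>k\<in>K. a k *\<^sub>R M ^ k) = (\<Sum>k\<in>K. a k *\<^sub>R f k)" for a K
      by (induction K rule: infinite_finite_induct) (simp_all add: f_def)
    ultimately have "(\<Sum>k\<le>d. u (f k) *\<^sub>R M ^ k) = 0"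
      by (metis cmat_rep_inject cmat_rep_simps(1))
    with u(1) show ?thesis by (intro exI[of _ d] exI[of _ "\<lambda>k. u (f k)"]) auto
  next
    case False
    then obtain i j where ij: "i \<le> d" "j \<le> d" "i \<noteq> j" "M ^ i = M ^ j"
      by (auto simp: inj_on_def f_def cmat_rep_inject)
    define a where "a k = (if k = i then 1 else 0) - (if k = j then 1 else 0 :: real)" for k
    have "(\<Sum>k\<le>d. a k *\<^sub>R M ^ k) = M ^ i - M ^ j"
      using ij by (simp add: a_def scaleR_diff_left sum_subtractf if_distrib[of "\<lambda>r. r *\<^sub>R _"] sum.delta cong: if_cong)
    then show ?thesis using ij by (intro exI[of _ d] exI[of _ a]) (auto simp: a_def)
  qed
qed

text \<open>Induction on the degree, splitting off a root \<open>z\<close>. If \<open>z\<close> is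
  an eigenvalue, the factor \<open>M - z\<close> is moved onto \<open>X\<close> and recorded in the
  list. Otherwise left multiplication by \<open>M - z\<close> is injective and the factor is
  dropped. Thus only eigenvalues survive as shifts.\<close>

lemma cmat_poly_zero_factors:
  assumes "p \<noteq> 0" "cmat_poly M p * X = 0"
  shows "\<exists>ls. shift_prod M (map cmat_scalar ls) * X = 0 \<and> (\<forall>l\<in>set ls. cmat_eigenvalue M l)"
  using assms
proof (induction "degree p" arbitrary: p X)
  case 0
  then obtain c where "p = [:c:]" "c \<noteq> 0" by (metis degree_eq_zeroE pCons_0_0)
  then have "X = 0" using 0 by (simp add: cmat_scalar_mult_eq_0_iff)
  then show ?case by (intro exI[of _ "[]"]) simp
next
  case (Suc n)
  have "\<not> constant (poly p)" using Suc.hyps(2) by (simp add: constant_degree)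
  then obtain z where "poly p z = 0" using fundamental_theorem_of_algebra by blast
  then obtain q where q: "p = [:- z, 1:] * q" by (metis poly_eq_0_iff_dvd dvd_def)
  have "q \<noteq> 0" using Suc.prems(1) q by auto
  have "degree p = degree [:- z, 1:] + degree q"
    unfolding q using \<open>q \<noteq> 0\<close> by (intro degree_mult_eq) auto
  then have deg: "n = degree q" using Suc.hyps(2) by simp
  have prod: "(M - cmat_scalar z) * (cmat_poly M q * X) = 0"
    using Suc.prems(2) unfolding q cmat_poly_linear_mult by (simp add: mult.assoc)
  show ?case
  proof (cases "cmat_eigenvalue M z")
    case True
    have "(M - cmat_scalar z) * cmat_poly M q = cmat_poly M q * (M - cmat_scalar z)"
      by (rule cmat_poly_commutes)
        (simp add: left_diff_distrib right_diff_distrib cmat_scalar_commutes)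
    then have "cmat_poly M q * ((M - cmat_scalar z) * X) = 0"
      using prod by (simp add: mult.assoc[symmetric])
    then obtain ls where "shift_prod M (map cmat_scalar ls) * ((M - cmat_scalar z) * X) = 0"
      "\<forall>l\<in>set ls. cmat_eigenvalue M l"
      using Suc.hyps(1)[OF deg \<open>q \<noteq> 0\<close>] by blast
    with True show ?thesis
      by (intro exI[of _ "ls @ [z]"]) (auto simp: shift_prod_append mult.assoc)
  next
    case False
    have "M * (cmat_poly M q * X) = cmat_scalar z * (cmat_poly M q * X)"
      using prod by (simp add: left_diff_distrib)
    then have "cmat_poly M q * X = 0" using False unfolding cmat_eigenvalue_def by blast
    then show ?thesis by (rule Suc.hyps(1)[OF deg \<open>q \<noteq> 0\<close>])
  qed
qed

lemma cmat_eigenvalue_annihilator: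
  fixes M :: "('a::finite) cmat"
  shows "\<exists>ls. shift_prod M (map cmat_scalar ls) = 0 \<and> (\<forall>l\<in>set ls. cmat_eigenvalue M l)"
proof -
  obtain d a k0 where a: "(\<Sum>k\<le>d. a k *\<^sub>R M ^ k) = 0" "k0 \<le> d" "a k0 \<noteq> (0::real)"
    using cmat_powers_dependent by blast
  define p where "p = (\<Sum>k\<le>d. monom (complex_of_real (a k)) k)"
  have "coeff p k0 = a k0"
    using a(2) by (simp add: p_def coeff_sum)
  then have "p \<noteq> 0" using a(3) by auto
  moreover have "cmat_poly M p = 0"
    using a(1) by (simp add: p_def cmat_poly_sum cmat_poly_monom cmat_scalar_of_real scaleR_conv_of_real[where 'a="'a cmat"])
  ultimately show ?thesis using cmat_poly_zero_factors[of p M 1] by auto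
qed

text \<open>On an eigenmatrix the product acts as the scalar with the factors
  \<open>\<mu> - l\<close>, one of which has to vanish.\<close>

lemma shift_prod_eigenvalue:
  assumes "shift_prod M (map cmat_scalar ls) = 0" "cmat_eigenvalue M \<mu>"
  shows "\<mu> \<in> set ls"
proof -
  obtain V where V: "V \<noteq> 0" "M * V = cmat_scalar \<mu> * V"
    using assms(2) by (auto simp: cmat_eigenvalue_def)
  have "shift_prod M (map cmat_scalar ks) * V = cmat_scalar (\<Prod>l\<leftarrow>ks. \<mu> - l) * V" for ks
  proof (induction ks)
    case (Cons l ks)
    have "shift_prod M (map cmat_scalar (l # ks)) * V
        = (M - cmat_scalar l) * (cmat_scalar (\<Prod>l\<leftarrow>ks. \<mu> - l) * V)"
      using Cons by (simp add: mult.assoc)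
    also have "\<dots> = cmat_scalar (\<Prod>l\<leftarrow>ks. \<mu> - l) * ((M - cmat_scalar l) * V)"
    proof -
      have "(M - cmat_scalar l) * cmat_scalar c = cmat_scalar c * (M - cmat_scalar l)" for c
        by (rule cmat_scalar_commutes[symmetric])
      then show ?thesis by (simp only: mult.assoc[symmetric])
    qed
    also have "(M - cmat_scalar l) * V = cmat_scalar (\<mu> - l) * V"
      by (simp add: left_diff_distrib V cmat_scalar_diff)
    finally show ?case
      by (simp add: mult.assoc[symmetric] cmat_scalar_mult[symmetric] mult.commute)
  qed simp
  from this[of ls] assms(1) V(1) have "(\<Prod>l\<leftarrow>ls. \<mu> - l) = 0"
    by (simp add: cmat_scalar_mult_eq_0_iff)
  then show ?thesis by (auto simp: prod_list_zero_iff)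
qed

section \<open>Polar form of an expansive dilation\<close>

text \<open>Membership stands in for being a polynomial in \<open>A\<close>: the projections,
  nilpotent parts, logarithms and the two polar factors built below all belong to it, and any two
  members commute.\<close>

definition bicommutant :: "'a::ring_1 \<Rightarrow> 'a set" where
  "bicommutant A = {X. \<forall>Y. Y * A = A * Y \<longrightarrow> Y * X = X * Y}"

lemma bicommutantD: "X \<in> bicommutant A \<Longrightarrow> Y * A = A * Y \<Longrightarrow> Y * X = X * Y"
  by (simp add: bicommutant_def)

lemma bicommutant_self: "A \<in> bicommutant A"
  and bicommutant_0: "0 \<in> bicommutant A"
  and bicommutant_1: "1 \<in> bicommutant A"
  and bicommutant_add: "X \<in> bicommutant A \<Longrightarrow> Y \<in> bicommutant A \<Longrightarrow> X + Y \<in> bicommutant A"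
  and bicommutant_diff: "X \<in> bicommutant A \<Longrightarrow> Y \<in> bicommutant A \<Longrightarrow> X - Y \<in> bicommutant A"
  by (auto simp: bicommutant_def distrib_left distrib_right left_diff_distrib right_diff_distrib)

lemma bicommutant_mult:
  assumes "X \<in> bicommutant A" "Y \<in> bicommutant A" shows "X * Y \<in> bicommutant A"
  unfolding bicommutant_def
proof (intro CollectI allI impI)
  fix Z assume "Z * A = A * Z"
  then have "Z * X = X * Z" "Z * Y = Y * Z" using assms by (auto dest: bicommutantD)
  then have "Z * X * Y = X * (Z * Y)" by (simp add: mult.assoc)
  with \<open>Z * Y = Y * Z\<close> show "Z * (X * Y) = X * Y * Z" by (simp add: mult.assoc)
qed

lemma bicommutant_sum: "(\<And>i. i \<in> I \<Longrightarrow> f i \<in> bicommutant A) \<Longrightarrow> sum f I \<in> bicommutant A"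
  by (induction I rule: infinite_finite_induct) (auto intro: bicommutant_0 bicommutant_add)

lemma bicommutant_power: "X \<in> bicommutant A \<Longrightarrow> X ^ n \<in> bicommutant A"
  by (induction n) (simp_all add: bicommutant_1 bicommutant_mult)

lemma bicommutant_commute:
  assumes "X \<in> bicommutant A" "Y \<in> bicommutant A" shows "X * Y = Y * X"
proof -
  have "X * A = A * X" using bicommutantD[OF assms(1), of A] by simp
  then show ?thesis by (rule bicommutantD[OF assms(2)])
qed

lemma bicommutant_cmat_scalar: "cmat_scalar z \<in> bicommutant A"
  by (simp add: bicommutant_def cmat_scalar_commutes)

lemmas bicommutant_intros =
  bicommutant_self bicommutant_0 bicommutant_1 bicommutant_add bicommutant_diff bicommutant_mult
  bicommutant_sum bicommutant_cmat_scalar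

lemma cmat_scalar_left_commute: "X * (cmat_scalar z * Y) = cmat_scalar z * (X * Y)"
  by (simp only: mult.assoc[symmetric] cmat_scalar_commutes[of z X])

section \<open>Primary decomposition and spectral projections\<close>

text \<open>\<open>c + N\<close> is invertible where \<open>N\<close> is nilpotent. The geometric
  series is summed recursively: if \<open>Z'\<close> solves the equation for \<open>N * Y\<close>,
  then \<open>(Y - Z') / c\<close> solves it for \<open>Y\<close>.\<close>

lemma shifted_nilpotent_solve:
  assumes "c \<noteq> 0" "N ^ m * Y = 0" "N \<in> bicommutant A" "Y \<in> bicommutant A"
  shows "\<exists>Z \<in> bicommutant A. (cmat_scalar c + N) * Z = Y \<and> N ^ m * Z = 0"
  using assms(2,4)
proof (induction m arbitrary: Y)
  case 0
  then show ?case by (intro bexI[of _ 0]) (simp_all add: bicommutant_0)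
next
  case (Suc m)
  have "N ^ m * (N * Y) = 0" using Suc.prems(1) by (simp add: power_Suc2 mult.assoc del: power_Suc)
  moreover have "N * Y \<in> bicommutant A" using assms(3) Suc.prems(2) by (rule bicommutant_mult)
  ultimately obtain Z' where Z': "Z' \<in> bicommutant A" "(cmat_scalar c + N) * Z' = N * Y" "N ^ m * Z' = 0"
    using Suc.IH[of "N * Y"] by auto
  define Z where "Z = cmat_scalar (1 / c) * (Y - Z')"
  have Z: "X * Z = cmat_scalar (1 / c) * (X * (Y - Z'))" for X
    unfolding Z_def by (rule cmat_scalar_left_commute)
  have "(cmat_scalar c + N) * (Y - Z') = cmat_scalar c * Y"
    using Z'(2) by (simp add: right_diff_distrib distrib_right)
  then have "(cmat_scalar c + N) * Z = Y"
    using assms(1) by (simp add: Z mult.assoc[symmetric] cmat_scalar_mult[symmetric])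
  moreover have "N ^ Suc m * (Y - Z') = 0"
    using Suc.prems(1) Z'(3) by (simp add: right_diff_distrib mult.assoc)
  then have "N ^ Suc m * Z = 0" unfolding Z by simp
  moreover have "Z \<in> bicommutant A"
    unfolding Z_def by (intro bicommutant_intros Suc.prems(2) Z'(1))
  ultimately show ?case by blast
qed

text \<open>\<open>N\<close> acts on \<open>W\<close> as the nonzero scalar \<open>- c\<close>, and
  so does no power of it vanish unless \<open>W = 0\<close>.\<close>

lemma shifted_nilpotent_kernel:
  assumes "c \<noteq> 0" "N ^ m * W = 0" "(cmat_scalar c + N) * W = 0"
  shows "W = 0"
proof -
  have NW: "N * W = cmat_scalar (- c) * W"
    using assms(3) by (simp add: distrib_right cmat_scalar_uminus eq_neg_iff_add_eq_0 add.commute)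
  have "N ^ j * W = cmat_scalar ((- c) ^ j) * W" for j
  proof (induction j)
    case (Suc j)
    have "N ^ Suc j * W = N * (cmat_scalar ((- c) ^ j) * W)" using Suc by (simp add: mult.assoc)
    also have "\<dots> = cmat_scalar ((- c) ^ j) * (N * W)"
      by (rule cmat_scalar_left_commute)
    also have "\<dots> = cmat_scalar ((- c) ^ Suc j) * W"
      by (simp add: NW mult.assoc[symmetric] cmat_scalar_mult[symmetric] mult.commute)
    finally show ?case .
  qed simp
  from this[of m] assms(1,2) show ?thesis by (simp add: cmat_scalar_mult_eq_0_iff)
qed

text \<open>\<open>A - \<mu>\<close> is \<open>l - \<mu>\<close> plus something nilpotent on
  \<open>Z\<close>, hence injective there, so its powers can be cancelled one by one.\<close>

lemma generalized_eigenspaces_disjoint: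
  assumes "l \<noteq> \<mu>" "(A - cmat_scalar l) ^ m * Z = 0" "(A - cmat_scalar \<mu>) ^ k * Z = 0"
  shows "Z = 0"
  using assms(3)
proof (induction k)
  case (Suc k)
  define W where "W = (A - cmat_scalar \<mu>) ^ k * Z"
  have "(A - cmat_scalar l) ^ m * (A - cmat_scalar \<mu>) ^ k = (A - cmat_scalar \<mu>) ^ k * (A - cmat_scalar l) ^ m"
    by (intro bicommutant_commute[of _ A] bicommutant_power bicommutant_intros)
  then have 1: "(A - cmat_scalar l) ^ m * W = 0"
    unfolding W_def mult.assoc[symmetric] by (simp add: mult.assoc assms(2))
  have "(cmat_scalar (l - \<mu>) + (A - cmat_scalar l)) * W = (A - cmat_scalar \<mu>) ^ Suc k * Z"
    by (simp add: W_def cmat_scalar_diff mult.assoc)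
  then have "W = 0"
    using shifted_nilpotent_kernel[OF _ 1, of "l - \<mu>"] assms(1) Suc.prems by simp
  then show ?case using Suc.IH by (simp add: W_def)
qed simp

text \<open>The induction hypothesis decomposes \<open>W = (A - \<mu>) * X\<close> into blocks
  \<open>f l\<close>. For \<open>l \<noteq> \<mu>\<close> the equation
  \<open>(A - \<mu>) * Z l = f l\<close> is solvable inside the block of \<open>l\<close>.
  Subtracting these solutions from \<open>X\<close> leaves \<open>Y\<close>, for which
  \<open>(A - \<mu>) * Y\<close> is the old \<open>\<mu>\<close> block, or 0 if \<open>\<mu>\<close>
  did not occur yet; so \<open>Y\<close> is the new \<open>\<mu>\<close> block.\<close>

lemma primary_decomposition:
  assumes "shift_prod A (map cmat_scalar ls) * X = 0" "X \<in> bicommutant A"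
  shows "\<exists>f. (\<forall>l\<in>set ls. f l \<in> bicommutant A \<and> (\<exists>m. (A - cmat_scalar l) ^ m * f l = 0)) \<and>
             X = (\<Sum>l\<in>set ls. f l)"
  using assms
proof (induction ls arbitrary: X)
  case Nil
  then show ?case by simp
next
  case (Cons \<mu> ls)
  define W where "W = (A - cmat_scalar \<mu>) * X"
  have "(A - cmat_scalar \<mu>) * shift_prod A (map cmat_scalar ls)
      = shift_prod A (map cmat_scalar ls) * (A - cmat_scalar \<mu>)"
  proof (rule shift_prod_commutes)
    show "(A - cmat_scalar \<mu>) * A = A * (A - cmat_scalar \<mu>)"
      by (intro bicommutant_commute[of _ A] bicommutant_intros)
    show "(A - cmat_scalar \<mu>) * c = c * (A - cmat_scalar \<mu>)" if "c \<in> set (map cmat_scalar ls)" for c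
      using that by (auto intro: cmat_scalar_commutes[symmetric])
  qed
  then have "shift_prod A (map cmat_scalar ls) * W = 0"
    using Cons.prems(1) by (simp add: W_def mult.assoc[symmetric])
  moreover have "W \<in> bicommutant A" unfolding W_def by (intro bicommutant_intros Cons.prems(2))
  ultimately obtain f where f: "\<And>l. l \<in> set ls \<Longrightarrow> f l \<in> bicommutant A"
    "\<And>l. l \<in> set ls \<Longrightarrow> \<exists>m. (A - cmat_scalar l) ^ m * f l = 0" "W = (\<Sum>l\<in>set ls. f l)"
    using Cons.IH[of W] by auto
  have "\<exists>Z \<in> bicommutant A. (A - cmat_scalar \<mu>) * Z = f l \<and> (\<exists>m. (A - cmat_scalar l) ^ m * Z = 0)"
    if l: "l \<in> set ls - {\<mu>}" for l
  proof -
    obtain m where "(A - cmat_scalar l) ^ m * f l = 0" using f(2)[of l] l by auto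
    then obtain Z where "Z \<in> bicommutant A" "(cmat_scalar (l - \<mu>) + (A - cmat_scalar l)) * Z = f l"
      "(A - cmat_scalar l) ^ m * Z = 0"
      using shifted_nilpotent_solve[of "l - \<mu>" "A - cmat_scalar l" m "f l" A] l f(1)
      by (auto intro: bicommutant_intros)
    moreover have "cmat_scalar (l - \<mu>) + (A - cmat_scalar l) = A - cmat_scalar \<mu>"
      by (simp add: cmat_scalar_diff)
    ultimately show ?thesis by auto
  qed
  then obtain Z where Z: "\<And>l. l \<in> set ls - {\<mu>} \<Longrightarrow> Z l \<in> bicommutant A"
    "\<And>l. l \<in> set ls - {\<mu>} \<Longrightarrow> (A - cmat_scalar \<mu>) * Z l = f l"
    "\<And>l. l \<in> set ls - {\<mu>} \<Longrightarrow> \<exists>m. (A - cmat_scalar l) ^ m * Z l = 0" by metis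
  define Y where "Y = X - (\<Sum>l\<in>set ls - {\<mu>}. Z l)"
  define g where "g l = (if l = \<mu> then Y else Z l)" for l
  have Y_bi: "Y \<in> bicommutant A"
    unfolding Y_def by (intro bicommutant_intros Cons.prems(2) Z(1))
  have "(A - cmat_scalar \<mu>) * Y = W - (\<Sum>l\<in>set ls - {\<mu>}. f l)"
    unfolding Y_def W_def right_diff_distrib[of "A - cmat_scalar \<mu>"] sum_distrib_left
    by (simp add: Z(2))
  also have "\<dots> = (if \<mu> \<in> set ls then f \<mu> else 0)"
    by (simp add: f(3) sum.remove)
  finally have Y_shift: "(A - cmat_scalar \<mu>) * Y = (if \<mu> \<in> set ls then f \<mu> else 0)" .
  have "\<exists>m. (A - cmat_scalar \<mu>) ^ m * Y = 0"
  proof (cases "\<mu> \<in> set ls")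
    case True
    then obtain m where "(A - cmat_scalar \<mu>) ^ m * f \<mu> = 0" using f(2) by blast
    then have "(A - cmat_scalar \<mu>) ^ Suc m * Y = 0"
      using Y_shift True by (simp add: power_Suc2 mult.assoc del: power_Suc)
    then show ?thesis by blast
  next
    case False
    then have "(A - cmat_scalar \<mu>) ^ 1 * Y = 0" using Y_shift by simp
    then show ?thesis by blast
  qed
  then have 1: "\<forall>l\<in>set (\<mu> # ls). g l \<in> bicommutant A \<and> (\<exists>m. (A - cmat_scalar l) ^ m * g l = 0)"
    using Y_bi Z(1,3) by (auto simp: g_def)
  have "(\<Sum>l\<in>set (\<mu> # ls). g l) = g \<mu> + (\<Sum>l\<in>set ls - {\<mu>}. g l)"
    by (simp add: sum.insert_remove)
  also have "\<dots> = Y + (\<Sum>l\<in>set ls - {\<mu>}. Z l)" by (simp add: g_def)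
  also have "\<dots> = X" by (simp add: Y_def)
  finally show ?case using 1 by metis
qed

lemma shift_prod_replicate: "shift_prod M (replicate m c) = (M - c) ^ m"
  by (induction m) simp_all

text \<open>The blocks of the identity. A product of two different blocks lies in two generalized
  eigenspaces at once and vanishes; multiplying the decomposition of 1 by a block then shows that it
  is idempotent.\<close>

lemma spectral_projections:
  assumes "shift_prod A (map cmat_scalar ls) = 0"
  obtains \<pi> where "\<And>l. l \<in> set ls \<Longrightarrow> \<pi> l \<in> bicommutant A"
    "\<And>l. l \<in> set ls \<Longrightarrow> \<exists>m. (A - cmat_scalar l) ^ m * \<pi> l = 0"
    "(\<Sum>l\<in>set ls. \<pi> l) = 1"
    "\<And>l k. l \<in> set ls \<Longrightarrow> k \<in> set ls \<Longrightarrow> \<pi> k * \<pi> l = (if k = l then \<pi> l else 0)"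
proof -
  obtain f where f: "\<And>l. l \<in> set ls \<Longrightarrow> f l \<in> bicommutant A"
    "\<And>l. l \<in> set ls \<Longrightarrow> \<exists>m. (A - cmat_scalar l) ^ m * f l = 0" "1 = (\<Sum>l\<in>set ls. f l)"
    using primary_decomposition[of A ls 1] assms by (auto simp: bicommutant_1)
  have orth: "f k * f l = 0" if kl: "k \<in> set ls" "l \<in> set ls" "k \<noteq> l" for k l
  proof -
    obtain m n where m: "(A - cmat_scalar k) ^ m * f k = 0" and n: "(A - cmat_scalar l) ^ n * f l = 0"
      using f(2) kl by metis
    have "f k * f l = f l * f k" using f(1) kl by (intro bicommutant_commute)
    then have "(A - cmat_scalar l) ^ n * (f k * f l) = 0"
      using n by (simp add: mult.assoc[symmetric])
    moreover have "(A - cmat_scalar k) ^ m * (f k * f l) = 0"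
      using m by (simp add: mult.assoc[symmetric])
    ultimately show ?thesis using generalized_eigenspaces_disjoint[OF \<open>k \<noteq> l\<close>] by blast
  qed
  have idem: "f l * f l = f l" if l: "l \<in> set ls" for l
  proof -
    have "f l = (\<Sum>k\<in>set ls. f k) * f l" using f(3) by simp
    also have "\<dots> = (\<Sum>k\<in>set ls. if k = l then f l * f l else 0)"
      unfolding sum_distrib_right using orth l by (intro sum.cong) auto
    also have "\<dots> = f l * f l" using l by (simp add: sum.delta)
    finally show ?thesis by simp
  qed
  show thesis using that[of f] f orth idem by auto
qed

text \<open>
  On the generalized eigenspace of \<open>\<lambda>\<close> write \<open>A = \<lambda> (1 + N)\<close> with \<open>N\<close> nilpotent and split
  \<open>\<lambda> = \<bar>\<lambda>\<bar> w\<close>: the logarithm of \<open>\<bar>\<lambda>\<bar> (1 + N)\<close> goes into \<open>L\<close>, the unimodular \<open>w\<close> into \<open>V\<close>.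
\<close>
lemma cmat_polar_form:
  fixes A :: "('n::finite) cmat"
  assumes "shift_prod A (map cmat_scalar ls) = 0" "0 \<notin> set ls"
  obtains L V ks B where
    "shift_prod L (map of_real ks) = 0" "set ks \<subseteq> (\<lambda>l. ln (cmod l)) ` set ls"
    "\<And>j k :: int. V (j + k) = V j * V k" "V 0 = 1" "\<And>k. norm (V k) \<le> B"
    "\<And>k. V k * L = L * V k" "A = exp L * V 1"
proof -
  obtain \<pi> where bi: "\<And>l. l \<in> set ls \<Longrightarrow> \<pi> l \<in> bicommutant A"
    and nil: "\<And>l. l \<in> set ls \<Longrightarrow> \<exists>m. (A - cmat_scalar l) ^ m * \<pi> l = 0"
    and one: "(\<Sum>l\<in>set ls. \<pi> l) = 1"
    and orth: "\<And>l k. l \<in> set ls \<Longrightarrow> k \<in> set ls \<Longrightarrow> \<pi> k * \<pi> l = (if k = l then \<pi> l else 0)"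
    by (rule spectral_projections[OF assms(1)]) blast
  \<comment> \<open>As the projections sum to 1, equations may be checked block by block.\<close>
  have proj_eqI: "X = Y" if "\<And>l. l \<in> set ls \<Longrightarrow> X * \<pi> l = Y * \<pi> l" for X Y
  proof -
    have "X = X * (\<Sum>l\<in>set ls. \<pi> l)" by (simp add: one)
    also have "\<dots> = Y * (\<Sum>l\<in>set ls. \<pi> l)" unfolding sum_distrib_left using that by simp
    finally show ?thesis by (simp add: one)
  qed
  have pick: "(\<Sum>k\<in>set ls. F k * \<pi> k) * \<pi> l = F l * \<pi> l" if l: "l \<in> set ls" for F l
  proof -
    have "(\<Sum>k\<in>set ls. F k * \<pi> k) * \<pi> l = (\<Sum>k\<in>set ls. if k = l then F l * \<pi> l else 0)"
      unfolding sum_distrib_right using orth l by (intro sum.cong) (auto simp: mult.assoc)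
    then show ?thesis using l by (simp add: sum.delta)
  qed
  define N where "N l = cmat_scalar (1 / l) * (A - cmat_scalar l) * \<pi> l" for l
  have N_bi: "N l \<in> bicommutant A" if "l \<in> set ls" for l
    unfolding N_def by (intro bicommutant_intros bi that)
  have N_nil: "\<exists>m. N l ^ m = 0" if l: "l \<in> set ls" for l
  proof -
    obtain m where m: "(A - cmat_scalar l) ^ m * \<pi> l = 0" using nil l by blast
    \<comment> \<open>The exponent is \<open>Suc m\<close>, not \<open>m\<close>, so that a factor
      \<open>\<pi> l\<close> is present even when \<open>m = 0\<close>.\<close>
    have "N l ^ Suc m = (cmat_scalar (1 / l) * (A - cmat_scalar l)) ^ Suc m * \<pi> l ^ Suc m"
      unfolding N_def by (intro power_mult_commuting bicommutant_commute[of _ A] bicommutant_intros bi l)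
    also have "\<dots> = (cmat_scalar (1 / l) ^ Suc m * (A - cmat_scalar l) ^ Suc m) * \<pi> l ^ Suc m"
      by (subst power_mult_commuting) (rule cmat_scalar_commutes, rule refl)
    also have "\<dots> = cmat_scalar (1 / l) ^ Suc m * (A - cmat_scalar l) * ((A - cmat_scalar l) ^ m * \<pi> l) * \<pi> l ^ m"
      by (simp add: mult.assoc)
    finally have "N l ^ Suc m = 0" by (simp add: m)
    then show ?thesis by blast
  qed
  have "\<exists>S. exp (N l * S) = 1 + N l \<and> (\<forall>Y. Y * N l = N l * Y \<longrightarrow> Y * S = S * Y)" if "l \<in> set ls" for l
    using N_nil[OF that] nilpotent_logarithm by blast
  then obtain S where S: "\<And>l. l \<in> set ls \<Longrightarrow> exp (N l * S l) = 1 + N l"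
    and S_comm: "\<And>l Y. l \<in> set ls \<Longrightarrow> Y * N l = N l * Y \<Longrightarrow> Y * S l = S l * Y" by metis
  define Q where "Q l = N l * S l" for l
  have S_bi: "S l \<in> bicommutant A" if "l \<in> set ls" for l
    unfolding bicommutant_def using S_comm[OF that] bicommutantD[OF N_bi[OF that]] by blast
  have Q_bi: "Q l \<in> bicommutant A" if "l \<in> set ls" for l
    unfolding Q_def by (intro bicommutant_mult N_bi S_bi that)
  have Q_nil: "\<exists>m. Q l ^ m = 0" if l: "l \<in> set ls" for l
  proof -
    obtain m where "N l ^ m = 0" using N_nil[OF l] by blast
    moreover have "Q l ^ m = N l ^ m * S l ^ m"
      unfolding Q_def by (intro power_mult_commuting bicommutant_commute[of _ A] N_bi S_bi l)
    ultimately show ?thesis by auto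
  qed
  then obtain q where q: "\<And>l. l \<in> set ls \<Longrightarrow> Q l ^ q l = 0" by metis
  define \<kappa> where "\<kappa> l = ln (cmod l)" for l
  define C where "C l = of_real (\<kappa> l) + Q l" for l
  define L where "L = (\<Sum>l\<in>set ls. C l * \<pi> l)"
  have real_bi: "(of_real r :: 'n cmat) \<in> bicommutant A" for r
    unfolding cmat_scalar_of_real[symmetric] by (rule bicommutant_cmat_scalar)
  have C_bi: "C l \<in> bicommutant A" if "l \<in> set ls" for l
    unfolding C_def by (intro bicommutant_add real_bi Q_bi that)
  have L_bi: "L \<in> bicommutant A"
    unfolding L_def by (intro bicommutant_sum bicommutant_mult C_bi bi)
  have L_\<pi>: "L * \<pi> l = C l * \<pi> l" if "l \<in> set ls" for l
    unfolding L_def by (rule pick[OF that])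
  define w where "w l = l / complex_of_real (cmod l)" for l
  have w: "cmod (w l) = 1" "w l \<noteq> 0" if "l \<in> set ls" for l
  proof -
    have "l \<noteq> 0" using that assms(2) by auto
    then show "cmod (w l) = 1" "w l \<noteq> 0" by (auto simp: w_def norm_divide)
  qed
  \<comment> \<open>All integer powers are written down at once. Since \<open>w l\<close> is
    unimodular, the sum of the norms of the projections bounds them uniformly in
    \<open>k\<close>.\<close>
  define V where "V k = (\<Sum>l\<in>set ls. cmat_scalar (w l powi k) * \<pi> l)" for k :: int
  have V_bi: "V k \<in> bicommutant A" for k
    unfolding V_def by (intro bicommutant_intros bi)
  have V_\<pi>: "V k * \<pi> l = cmat_scalar (w l powi k) * \<pi> l" if "l \<in> set ls" for k l
    unfolding V_def by (rule pick[OF that])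
  have V_add: "V (j + k) = V j * V k" for j k
  proof (rule proj_eqI)
    fix l assume l: "l \<in> set ls"
    have "V j * V k * \<pi> l = V j * (cmat_scalar (w l powi k) * \<pi> l)"
      by (simp add: mult.assoc V_\<pi>[OF l])
    also have "\<dots> = cmat_scalar (w l powi k) * (V j * \<pi> l)"
      by (rule cmat_scalar_left_commute)
    also have "\<dots> = V (j + k) * \<pi> l"
      using w[OF l]
      by (simp add: V_\<pi>[OF l] mult.assoc[symmetric] cmat_scalar_mult[symmetric] power_int_add mult.commute)
    finally show "V (j + k) * \<pi> l = V j * V k * \<pi> l" by simp
  qed
  have V_0: "V 0 = 1" using one by (simp add: V_def)
  have V_norm: "norm (V k) \<le> (\<Sum>l\<in>set ls. norm (\<pi> l))" for k
  proof -
    have "norm (V k) \<le> (\<Sum>l\<in>set ls. norm (cmat_scalar (w l powi k) * \<pi> l))"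
      unfolding V_def by (rule norm_sum)
    also have "\<dots> \<le> (\<Sum>l\<in>set ls. norm (\<pi> l))"
    proof (rule sum_mono)
      fix l assume "l \<in> set ls"
      then have "cmod (w l powi k) = 1" by (simp add: norm_power_int w)
      then show "norm (cmat_scalar (w l powi k) * \<pi> l) \<le> norm (\<pi> l)"
        using norm_mult_ineq[of "cmat_scalar (w l powi k)" "\<pi> l"] by simp
    qed
    finally show ?thesis .
  qed
  have V_L: "V k * L = L * V k" for k by (rule bicommutant_commute[OF V_bi L_bi])
  have A_eq: "A = exp L * V 1"
  proof (rule proj_eqI)
    fix l assume l: "l \<in> set ls"
    then have "l \<noteq> 0" using assms(2) by auto
    have "exp L * V 1 * \<pi> l = exp L * (cmat_scalar (w l) * \<pi> l)"
      by (simp add: mult.assoc V_\<pi>[OF l])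
    also have "\<dots> = cmat_scalar (w l) * (exp L * \<pi> l)"
      by (rule cmat_scalar_left_commute)
    also have "exp L * \<pi> l = exp (C l) * \<pi> l"
      by (rule exp_mult_cong[OF L_\<pi>[OF l] bicommutant_commute[OF L_bi bi[OF l]]
          bicommutant_commute[OF C_bi[OF l] bi[OF l]]])
    also have "exp (C l) = exp (of_real (\<kappa> l)) * exp (Q l)"
      unfolding C_def by (rule exp_add_commuting) (rule of_real_commutes)
    also have "exp (of_real (\<kappa> l)) = (cmat_scalar (cmod l) :: 'n cmat)"
      using \<open>l \<noteq> 0\<close> by (simp add: exp_of_real_algebra \<kappa>_def cmat_scalar_of_real)
    also have "exp (Q l) = 1 + N l" unfolding Q_def by (rule S[OF l])
    also have "cmat_scalar (w l) * (cmat_scalar (cmod l) * (1 + N l) * \<pi> l)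
        = cmat_scalar l * ((1 + N l) * \<pi> l)"
    proof -
      have "w l * complex_of_real (cmod l) = l" using \<open>l \<noteq> 0\<close> by (simp add: w_def)
      then show ?thesis by (simp only: mult.assoc[symmetric] cmat_scalar_mult[symmetric])
    qed
    also have "(1 + N l) * \<pi> l = \<pi> l + cmat_scalar (1 / l) * (A - cmat_scalar l) * \<pi> l"
      using orth[OF l l] by (simp add: distrib_right N_def mult.assoc)
    also have "cmat_scalar l * \<dots> = cmat_scalar l * \<pi> l + (A - cmat_scalar l) * \<pi> l"
    proof -
      have "cmat_scalar l * (cmat_scalar (1 / l) * (A - cmat_scalar l) * \<pi> l)
          = (cmat_scalar l * cmat_scalar (1 / l)) * ((A - cmat_scalar l) * \<pi> l)"
        by (simp only: mult.assoc)
      then show ?thesis using \<open>l \<noteq> 0\<close> by (simp add: distrib_left flip: cmat_scalar_mult)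
    qed
    also have "\<dots> = A * \<pi> l" by (simp add: left_diff_distrib)
    finally show "A * \<pi> l = exp L * V 1 * \<pi> l" by simp
  qed
  \<comment> \<open>On the block of \<open>l\<close> the difference \<open>L - \<kappa> l\<close>
    acts as the nilpotent \<open>Q l\<close>, so \<open>q l\<close> copies of the shift
    \<open>\<kappa> l\<close> annihilate it.\<close>
  define F where "F l = replicate (q l) (\<kappa> l)" for l
  have L_nil: "shift_prod L (map of_real (F l)) * \<pi> l = 0" if l: "l \<in> set ls" for l
  proof -
    have "(L - of_real (\<kappa> l)) ^ j * \<pi> l = Q l ^ j * \<pi> l" for j
    proof (induction j)
      case (Suc j)
      have "(L - of_real (\<kappa> l)) ^ Suc j * \<pi> l = (L - of_real (\<kappa> l)) * (Q l ^ j * \<pi> l)"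
        using Suc by (simp add: mult.assoc)
      also have "Q l ^ j * \<pi> l = \<pi> l * Q l ^ j"
        by (intro bicommutant_commute[of _ A] bicommutant_power Q_bi bi l)
      also have "(L - of_real (\<kappa> l)) * (\<pi> l * Q l ^ j) = (L * \<pi> l - of_real (\<kappa> l) * \<pi> l) * Q l ^ j"
        by (simp add: mult.assoc[symmetric] left_diff_distrib)
      also have "L * \<pi> l - of_real (\<kappa> l) * \<pi> l = Q l * \<pi> l"
        by (simp add: L_\<pi>[OF l] C_def distrib_right)
      also have "Q l * \<pi> l * Q l ^ j = Q l * (\<pi> l * Q l ^ j)" by (simp add: mult.assoc)
      also have "\<pi> l * Q l ^ j = Q l ^ j * \<pi> l"
        by (intro bicommutant_commute[of _ A] bicommutant_power Q_bi bi l)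
      finally show ?case by (simp add: mult.assoc)
    qed simp
    from this[of "q l"] show ?thesis
      by (simp add: F_def shift_prod_replicate q[OF l])
  qed
  define ks where "ks = concat (map F ls)"
  \<comment> \<open>The induction runs over a separate list \<open>ls'\<close>, while the
    projections remain those of the full list \<open>ls\<close>.\<close>
  have "shift_prod L (map of_real (concat (map F ls'))) * \<pi> l = 0"
    if l: "l \<in> set ls" "l \<in> set ls'" for l ls'
    using l(2)
  proof (induction ls')
    case (Cons a ls')
    let ?R = "shift_prod L (map of_real (concat (map F ls')))"
    have "\<pi> l * ?R = ?R * \<pi> l"
      by (intro shift_prod_of_real_commutes bicommutant_commute[of _ A] bi l(1) L_bi)
    have eq: "shift_prod L (map of_real (concat (map F (a # ls')))) = shift_prod L (map of_real (F a)) * ?R"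
      by (simp add: shift_prod_append)
    show ?case
    proof (cases "a = l")
      case True
      then have G: "shift_prod L (map of_real (F a)) * \<pi> l = 0" using L_nil[OF l(1)] by simp
      have "shift_prod L (map of_real (F a)) * ?R * \<pi> l = shift_prod L (map of_real (F a)) * (\<pi> l * ?R)"
        by (simp only: mult.assoc \<open>\<pi> l * ?R = ?R * \<pi> l\<close>)
      also have "\<dots> = 0" unfolding mult.assoc[symmetric] G by simp
      finally show ?thesis unfolding eq .
    next
      case False
      then have "?R * \<pi> l = 0" using Cons by simp
      then show ?thesis unfolding eq mult.assoc by simp
    qed
  qed simp
  then have "shift_prod L (map of_real ks) = 0"
    unfolding ks_def by (intro proj_eqI[where Y = 0]) simp
  moreover have "set ks \<subseteq> (\<lambda>l. ln (cmod l)) ` set ls"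
    by (auto simp: ks_def F_def \<kappa>_def)
  ultimately show thesis using V_add V_0 V_norm V_L A_eq by (rule that)
qed

lemma exp_of_int_scaleR_add:
  fixes L :: "'a::{real_normed_algebra_1,banach}"
  shows "exp (of_int (j + k) *\<^sub>R L) = exp (of_int j *\<^sub>R L) * exp (of_int k *\<^sub>R L)"
  by (simp add: exp_scaleR_add)

lemma polar_powers_hom:
  fixes L :: "'a::{real_normed_algebra_1,banach}"
  assumes "\<And>j k :: int. V (j + k) = V j * V k" "\<And>k. V k * L = L * V k"
  shows "exp (of_int (j + k) *\<^sub>R L) * V (j + k) =
    (exp (of_int j *\<^sub>R L) * V j) * (exp (of_int k *\<^sub>R L) * V k)"
proof -
  have "V j * exp (of_int k *\<^sub>R L) = exp (of_int k *\<^sub>R L) * V j"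
    by (rule exp_commutes_right) (simp add: assms(2))
  then have "exp (of_int j *\<^sub>R L) * (V j * exp (of_int k *\<^sub>R L)) * V k
      = exp (of_int j *\<^sub>R L) * (exp (of_int k *\<^sub>R L) * V j) * V k" by simp
  then show ?thesis by (simp only: exp_of_int_scaleR_add assms(1) mult.assoc)
qed

text \<open>
  The complex conjugate of \<open>L\<close> belongs to the same real matrix, so \<open>real_flow_unique\<close> makes \<open>L\<close>
  real, although the construction of \<open>L\<close> is complex.
\<close>
lemma expansive_polar_form:
  fixes A :: "real^'n^'n"
  assumes "expansive_dilation A"
  obtains L :: "real^'n^'n" and V ks B where
    "shift_prod (cmat_of_real L) (map of_real ks) = 0" "\<And>\<kappa>. \<kappa> \<in> set ks \<Longrightarrow> \<kappa> > 0"
    "\<And>j k :: int. V (j + k) = V j * V k" "V 0 = 1" "\<And>k. norm (V k) \<le> B"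
    "\<And>k. V k * cmat_of_real L = cmat_of_real L * V k" "\<And>k. cmat_cnj (V k) = V k"
    "cmat_of_real A = exp (cmat_of_real L) * V 1"
proof -
  obtain ls where ls: "shift_prod (cmat_of_real A) (map cmat_scalar ls) = 0"
    "\<forall>l\<in>set ls. cmat_eigenvalue (cmat_of_real A) l"
    using cmat_eigenvalue_annihilator by blast
  have ls_gt: "cmod l > 1" if "l \<in> set ls" for l
    using that ls(2) assms by (auto simp: expansive_dilation_def complex_eigenvalue_iff)
  have "0 \<notin> set ls" using ls_gt by force
  obtain L V ks B where L: "shift_prod L (map of_real ks) = 0"
    and ks: "set ks \<subseteq> (\<lambda>l. ln (cmod l)) ` set ls"
    and V: "\<And>j k :: int. V (j + k) = V j * V k" "V 0 = 1" "\<And>k. norm (V k) \<le> B"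
    and VL: "\<And>k. V k * L = L * V k" and A: "cmat_of_real A = exp L * V 1"
    by (rule cmat_polar_form[OF ls(1) \<open>0 \<notin> set ls\<close>]) blast
  define L' where "L' = cmat_cnj L"
  define V' where "V' k = cmat_cnj (V k)" for k
  have L': "shift_prod L' (map of_real ks) = 0"
  proof -
    have "cmat_cnj (shift_prod L (map of_real cs)) = shift_prod L' (map of_real cs)" for cs
      by (induction cs) (simp_all add: L'_def)
    from this[of ks] L show ?thesis by simp
  qed
  have V': "V' (j + k) = V' j * V' k" "V' 0 = 1" "V' k * L' = L' * V' k" for j k
    using V arg_cong[OF VL[of k], of cmat_cnj] by (simp_all add: V'_def L'_def)
  \<comment> \<open>Both sides are homomorphisms on the integers with value \<open>A\<close> at 1,
    because \<open>A\<close> is its own conjugate.\<close>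
  have powers: "exp (of_int k *\<^sub>R L) * V k = exp (of_int k *\<^sub>R L') * V' k" for k
  proof (rule int_hom_unique)
    have "cmat_cnj (exp L * V 1) = exp L * V 1" by (simp flip: A)
    then show "exp (of_int 1 *\<^sub>R L) * V 1 = exp (of_int 1 *\<^sub>R L') * V' 1"
      by (simp add: L'_def V'_def cmat_cnj_exp)
    show "exp (of_int (j + k) *\<^sub>R L) * V (j + k) =
      (exp (of_int j *\<^sub>R L) * V j) * (exp (of_int k *\<^sub>R L) * V k)" for j k
      by (rule polar_powers_hom[OF V(1) VL])
    show "exp (of_int (j + k) *\<^sub>R L') * V' (j + k) =
      (exp (of_int j *\<^sub>R L') * V' j) * (exp (of_int k *\<^sub>R L') * V' k)" for j k
      by (rule polar_powers_hom[OF V'(1) V'(3)])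
  qed (simp_all add: V V')
  have V_inv: "V k * V (- k) = 1" for k using V(1)[of k "- k"] V(2) by simp
  have exp_inv: "exp (- of_int k *\<^sub>R X) * exp (of_int k *\<^sub>R X) = 1" for k :: int and X :: "'n cmat"
    using exp_scaleR_add[of "- of_int k" "of_int k" X] by simp
  \<comment> \<open>The quotient of the two flows is expressed by the bounded factors alone.\<close>
  have quot: "exp (- of_int k *\<^sub>R L') * exp (of_int k *\<^sub>R L) = V' k * V (- k)" for k
  proof -
    have "exp (- of_int k *\<^sub>R L') * exp (of_int k *\<^sub>R L)
        = exp (- of_int k *\<^sub>R L') * (exp (of_int k *\<^sub>R L) * V k) * V (- k)"
      by (simp add: mult.assoc V_inv)
    also have "\<dots> = (exp (- of_int k *\<^sub>R L') * exp (of_int k *\<^sub>R L')) * V' k * V (- k)"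
      by (simp only: powers mult.assoc)
    finally show ?thesis by (simp only: exp_inv mult_1_left)
  qed
  have "L' = L"
  proof (rule real_flow_unique[OF L' L])
    fix k :: int
    have "norm (V' k * V (- k)) \<le> norm (V' k) * norm (V (- k))" by (rule norm_mult_ineq)
    also have "\<dots> \<le> B * B"
      using V(3) order_trans[OF norm_ge_zero V(3)] by (intro mult_mono) (auto simp: V'_def)
    finally show "norm (exp (- of_int k *\<^sub>R L') * exp (of_int k *\<^sub>R L)) \<le> B * B"
      unfolding quot .
  qed
  then have real_L: "cmat_of_real (cmat_Re L) = L" unfolding cmat_of_real_Re L'_def .
  have "cmat_cnj (V k) = V k" for k
  proof -
    have "exp (- of_int k *\<^sub>R L) * exp (of_int k *\<^sub>R L) * V' k
        = exp (- of_int k *\<^sub>R L) * exp (of_int k *\<^sub>R L) * V k"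
      using powers[of k] \<open>L' = L\<close> by (simp add: mult.assoc)
    then show ?thesis unfolding exp_inv V'_def by simp
  qed
  moreover have "\<kappa> > 0" if \<kappa>: "\<kappa> \<in> set ks" for \<kappa>
  proof -
    obtain l where "l \<in> set ls" "\<kappa> = ln (cmod l)" using \<kappa> ks by blast
    with ls_gt[of l] show ?thesis by (simp only: ln_gt_zero)
  qed
  ultimately show thesis using that[of "cmat_Re L" ks V B] L V VL A real_L by simp
qed

section \<open>Quasi-norms\<close>

text \<open>A crude Leibniz estimate, by which bounds on quotients of matrix powers become bounds on
  quotients of determinants.\<close>

lemma abs_det_bounded:
  fixes R :: "real^'n^'n"
  assumes "\<And>i j. \<bar>R $ i $ j\<bar> \<le> c"
  shows "\<bar>det R\<bar> \<le> fact CARD('n) * c ^ CARD('n)"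
proof -
  have "\<bar>det R\<bar> \<le> (\<Sum>p\<in>{p. p permutes (UNIV::'n set)}. \<bar>of_int (sign p) * (\<Prod>i\<in>UNIV. R $ i $ p i)\<bar>)"
    unfolding det_def by (rule sum_abs)
  also have "\<dots> \<le> (\<Sum>p\<in>{p. p permutes (UNIV::'n set)}. c ^ CARD('n))"
  proof (rule sum_mono)
    fix p :: "'n \<Rightarrow> 'n"
    have "\<bar>of_int (sign p) * (\<Prod>i\<in>UNIV. R $ i $ p i)\<bar> = (\<Prod>i\<in>UNIV. \<bar>R $ i $ p i\<bar>)"
      by (simp add: abs_mult abs_prod sign_def)
    also have "\<dots> \<le> (\<Prod>i\<in>(UNIV::'n set). c)" by (intro prod_mono) (simp add: assms)
    finally show "\<bar>of_int (sign p) * (\<Prod>i\<in>UNIV. R $ i $ p i)\<bar> \<le> c ^ CARD('n)" by simp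
  qed
  also have "\<dots> = fact CARD('n) * c ^ CARD('n)" by (simp add: card_permutations)
  finally show ?thesis .
qed

lemma norm_matrix_vector_le_onorm:
  fixes R :: "real^'n^'n"
  shows "norm (R *v x) \<le> onorm ((*v) R) * norm x"
  by (rule onorm) (rule matrix_vector_mul_bounded_linear)

section \<open>Exit times and the step quasi-norm\<close>

text \<open>\<open>M\<close> lists the integer powers of \<open>A\<close>, so that negative powers
  are handled without matrix inverses. The locale is instantiated both for the given dilation and
  for the members of the group.\<close>

locale expanding_powers =
  fixes A :: "real^'n^'n" and M :: "int \<Rightarrow> real^'n^'n"
  assumes M_0 [simp]: "M 0 = mat 1" and M_1: "M 1 = A"
    and M_add: "\<And>k l. M (k + l) = M k ** M l"
    and contracting: "\<And>\<epsilon>. \<epsilon> > 0 \<Longrightarrow> \<exists>N. \<forall>k\<ge>N. \<forall>x. norm (M (- int k) *v x) \<le> \<epsilon> * norm x"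
begin

definition b :: real where "b = \<bar>det A\<bar>"

lemma M_apply_add: "M (k + l) *v x = M k *v (M l *v x)"
  by (simp add: M_add matrix_vector_mul_assoc)

lemma M_apply_inverse [simp]: "M k *v (M (- k) *v x) = x" "M (- k) *v (M k *v x) = x"
  using M_apply_add[of k "- k" x] M_apply_add[of "- k" k x] by simp_all

lemma M_eq_0_iff [simp]: "M k *v x = 0 \<longleftrightarrow> x = 0"
  by (metis M_apply_inverse(2) matrix_vector_mult_0_right)

lemma b_nonzero: "b \<noteq> 0"
proof -
  have "det (M 1) * det (M (-1)) = 1" using arg_cong[OF M_add[of 1 "-1"], of det] by (simp add: det_mul)
  then show ?thesis by (auto simp: b_def M_1)
qed

lemma abs_det_M: "\<bar>det (M k)\<bar> = b powi k"
proof -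
  have pos: "\<bar>det (M (int n))\<bar> = b ^ n" for n
  proof (induction n)
    case (Suc n)
    have "M (int (Suc n)) = A ** M (int n)" using M_add[of 1 "int n"] by (simp add: M_1)
    then show ?case using Suc by (simp add: det_mul abs_mult b_def)
  qed simp
  have neg: "\<bar>det (M (- int n))\<bar> = inverse (b ^ n)" for n
  proof -
    have "det (M (int n)) * det (M (- int n)) = 1"
      using arg_cong[OF M_add[of "int n" "- int n"], of det] by (simp add: det_mul)
    then have "\<bar>det (M (int n))\<bar> * \<bar>det (M (- int n))\<bar> = 1" by (simp flip: abs_mult)
    then show ?thesis unfolding pos by (metis inverse_unique)
  qed
  show ?thesis using pos neg by (cases k rule: int_cases2) (auto simp: power_int_minus)
qed

lemma b_gt_1: "b > 1"
proof -
  \<comment> \<open>Makes the Leibniz bound \<open>fact CARD('n) * c ^ CARD('n)\<close> at most 1/2,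
    as \<open>c \<le> 1\<close> and the dimension is positive; a sufficiently negative power then
    has determinant below 1 in absolute value.\<close>
  define c :: real where "c = 1 / (2 * fact CARD('n))"
  have "1 \<le> 2 * (fact CARD('n) :: real)"
    using fact_ge_1[where 'a=real, of "CARD('n)"] by linarith
  then have c: "c > 0" "c \<le> 1" by (simp_all only: c_def divide_le_eq_1_pos) simp_all
  obtain N where N: "\<And>k x. k \<ge> N \<Longrightarrow> norm (M (- int k) *v x) \<le> c * norm x"
    using contracting[OF c(1)] by blast
  define k where "k = N + 1"
  have "\<bar>det (M (- int k))\<bar> \<le> fact CARD('n) * c ^ CARD('n)"
    by (intro abs_det_bounded matrix_entry_le N) (simp add: k_def)
  also have "\<dots> \<le> fact CARD('n) * c ^ 1"
    using c by (intro mult_left_mono power_decreasing) (auto simp: Suc_leI)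
  also have "\<dots> < 1" by (simp add: c_def)
  finally have "inverse (b ^ k) < 1" by (simp add: abs_det_M power_int_minus)
  show ?thesis
  proof (rule ccontr)
    assume "\<not> b > 1"
    then have "b ^ k \<le> 1" by (intro power_le_one) (auto simp: b_def)
    moreover have "b ^ k > 0" using b_nonzero by (simp add: b_def)
    ultimately have "1 \<le> inverse (b ^ k)" by (rule one_le_inverse[rotated])
    with \<open>inverse (b ^ k) < 1\<close> show False by simp
  qed
qed

text \<open>The norms along the orbit need not be monotone. Demanding that all earlier points lie in
  the unit ball makes the time unique and makes it drop by one when \<open>A\<close> is
  applied.\<close>

definition exits_at :: "real^'n \<Rightarrow> int \<Rightarrow> bool" where
  "exits_at x k \<longleftrightarrow> 1 \<le> norm (M k *v x) \<and> (\<forall>j<k. norm (M j *v x) < 1)"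

lemma exits_at_unique: "exits_at x k \<Longrightarrow> exits_at x l \<Longrightarrow> k = l"
  unfolding exits_at_def by (metis linorder_neqE not_le)

lemma exits_at_ex:
  assumes "x \<noteq> 0"
  shows "\<exists>k. exits_at x k"
proof -
  \<comment> \<open>Contraction by the factor \<open>norm x\<close> forces the point
    \<open>M N1 x\<close>, which is contracted back to \<open>x\<close>, to have norm at least
    1.\<close>
  obtain N1 where N1: "\<And>k y. k \<ge> N1 \<Longrightarrow> norm (M (- int k) *v y) \<le> norm x * norm y"
    using contracting[of "norm x"] assms by auto
  have big: "1 \<le> norm (M (int N1) *v x)"
  proof -
    have "norm (M (- int N1) *v (M (int N1) *v x)) \<le> norm x * norm (M (int N1) *v x)"
      by (rule N1) simp
    then show ?thesis using assms by simp
  qed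
  obtain N2 where N2: "\<And>k y. k \<ge> N2 \<Longrightarrow> norm (M (- int k) *v y) \<le> 1 / (2 * norm x) * norm y"
    using contracting[of "1 / (2 * norm x)"] assms by auto
  have small: "norm (M j *v x) < 1" if "j \<le> - int N2" for j
  proof -
    have "norm (M (- int (nat (- j))) *v x) \<le> 1 / (2 * norm x) * norm x"
      using that by (intro N2) linarith
    then show ?thesis using that assms by simp
  qed
  \<comment> \<open>Times are shifted by \<open>N2\<close>, before which the orbit stays in the unit
    ball, so that a least natural number can be taken.\<close>
  define P where "P n \<longleftrightarrow> 1 \<le> norm (M (int n - int N2) *v x)" for n
  have "P (N1 + N2)" using big by (simp add: P_def)
  define n where "n = (LEAST n. P n)"
  have "P n" using \<open>P (N1 + N2)\<close> unfolding n_def by (rule LeastI)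
  moreover have "norm (M j *v x) < 1" if "j < int n - int N2" for j
  proof (cases "j \<le> - int N2")
    case False
    then have "nat (j + int N2) < n" using that by linarith
    then have "\<not> P (nat (j + int N2))" unfolding n_def by (rule not_less_Least)
    moreover have "int (nat (j + int N2)) - int N2 = j" using False by simp
    ultimately show ?thesis unfolding P_def by simp
  qed (rule small)
  ultimately show ?thesis unfolding exits_at_def P_def by blast
qed

lemma exits_at_shift: "exits_at (A *v x) k \<longleftrightarrow> exits_at x (k + 1)"
proof -
  have "M j *v (A *v x) = M (j + 1) *v x" for j by (simp add: M_apply_add M_1)
  moreover have "(\<forall>j<k. P (j + 1)) \<longleftrightarrow> (\<forall>j<k + 1. P j)" for P :: "int \<Rightarrow> bool"
    by (metis add_less_cancel_right diff_add_cancel)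
  ultimately show ?thesis
    unfolding exits_at_def using \<open>\<And>P. _ = (\<forall>j<k + 1. P j)\<close>[of "\<lambda>j. norm (M j *v x) < 1"] by presburger
qed

definition A_norm :: real where "A_norm = max 1 (onorm ((*v) A))"

text \<open>One step before the exit the point is still in the unit ball, and a single application
  of \<open>A\<close> carries it at most to radius \<open>A_norm\<close>. Every nonzero vector thus
  has an iterate in one fixed compact annulus.\<close>

lemma exits_at_annulus:
  assumes "exits_at x k"
  shows "1 \<le> norm (M k *v x)" "norm (M k *v x) \<le> A_norm"
proof -
  show "1 \<le> norm (M k *v x)" using assms by (simp add: exits_at_def)
  have "norm (M (k - 1) *v x) \<le> 1" using assms by (simp add: exits_at_def less_imp_le)
  have "M k *v x = A *v (M (k - 1) *v x)"
    using M_apply_add[of 1 "k - 1" x] by (simp add: M_1)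
  then have "norm (M k *v x) \<le> onorm ((*v) A) * norm (M (k - 1) *v x)"
    by (simp add: norm_matrix_vector_le_onorm)
  also have "\<dots> \<le> A_norm * 1"
    using \<open>norm (M (k - 1) *v x) \<le> 1\<close> by (intro mult_mono) (auto simp: A_norm_def)
  finally show "norm (M k *v x) \<le> A_norm" by simp
qed

definition exit_time :: "real^'n \<Rightarrow> int" where
  "exit_time x = (if x = 0 then 0 else (THE k. exits_at x k))"

lemma exit_time: "x \<noteq> 0 \<Longrightarrow> exits_at x k \<longleftrightarrow> k = exit_time x"
  unfolding exit_time_def using exits_at_ex exits_at_unique by (metis the_equality)

text \<open>Constant on the set of points with a given exit time, and scaled by \<open>b\<close>
  from one such set to the next. It witnesses that quasi-norms exist, which the uniqueness proof
  needs.\<close>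

definition step_norm :: "real^'n \<Rightarrow> real" where
  "step_norm x = (if x = 0 then 0 else b powi (- exit_time x))"

lemma exit_time_measurable: "exit_time \<in> borel \<rightarrow>\<^sub>M count_space UNIV"
proof -
  have "exit_time -` {k} \<inter> space borel \<in> sets borel" for k
  proof -
    have norm_meas: "(\<lambda>x. norm (M j *v x)) \<in> borel_measurable borel" for j
      by (intro borel_measurable_continuous_onI continuous_intros)
    have "{x. exits_at x k} \<in> sets borel"
    proof -
      note [measurable] = norm_meas
      have "Measurable.pred borel (\<lambda>x. exits_at x k)"
        unfolding exits_at_def by measurable
      then show ?thesis by simp
    qed
    moreover from this have "{x. exits_at x k} \<union> {0} \<in> sets borel" by (rule sets.Un) simp
    moreover have "exit_time -` {k} = (if k = 0 then {x. exits_at x k} \<union> {0} else {x. exits_at x k})"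
    proof -
      have "\<not> exits_at 0 k" by (simp add: exits_at_def)
      then have "exit_time x = k \<longleftrightarrow> (if k = 0 then exits_at x k \<or> x = 0 else exits_at x k)" for x
      proof (cases "x = 0")
        case False
        then show ?thesis using exit_time[OF False, of k] by auto
      qed (auto simp: exit_time_def[of 0])
      then show ?thesis by (cases "k = 0") (simp_all add: set_eq_iff vimage_def disj_commute)
    qed
    ultimately show ?thesis by (auto simp only: space_borel Int_UNIV_right split: if_split)
  qed
  then show ?thesis by (subst measurable_count_space_eq2_countable) auto
qed

lemma step_norm_quasi_norm: "is_quasi_norm A step_norm"
  unfolding is_quasi_norm_def
proof (intro conjI allI)
  have "(\<lambda>x. b powi (- exit_time x)) \<in> borel_measurable borel"
    by (rule measurable_compose[OF exit_time_measurable]) simp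
  then have "step_norm \<in> borel_measurable borel"
    unfolding step_norm_def[abs_def] by measurable
  then show "step_norm \<in> borel_measurable lebesgue"
    by (simp add: measurable_completion)
  show "0 \<le> step_norm x" for x using b_gt_1 by (simp add: step_norm_def)
  show "step_norm x = 0 \<longleftrightarrow> x = 0" for x using b_gt_1 by (simp add: step_norm_def)
  show "step_norm (A *v x) = \<bar>det A\<bar> * step_norm x" for x
  proof (cases "x = 0")
    case False
    then have "A *v x \<noteq> 0" using M_eq_0_iff[of 1 x] by (simp add: M_1)
    then have "exit_time (A *v x) = exit_time x - 1"
      using exits_at_shift[of x "exit_time x - 1"] exit_time False by (metis diff_add_cancel)
    then have "b powi (- exit_time (A *v x)) = b powi (1 + (- exit_time x))" by simp
    also have "\<dots> = b * b powi (- exit_time x)"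
      using b_nonzero by (subst power_int_add) auto
    finally show ?thesis using False \<open>A *v x \<noteq> 0\<close> by (simp add: step_norm_def b_def)
  qed (simp add: step_norm_def)
  \<comment> \<open>\<open>N\<close> steps backwards halve norms: if both summands are in the unit
    ball at time \<open>j + N\<close>, their sum has norm below 2 there and below 1 at time
    \<open>j\<close>. The exit time of a sum is thus at most \<open>N\<close> earlier, whence the
    constant \<open>b ^ N\<close>.\<close>
  obtain N where N: "\<And>k x. k \<ge> N \<Longrightarrow> norm (M (- int k) *v x) \<le> 1 / 2 * norm x"
    using contracting[of "1/2"] by auto
  have pos: "step_norm x \<ge> 0" for x using b_gt_1 by (simp add: step_norm_def)
  have "step_norm (x + y) \<le> b ^ N * (step_norm x + step_norm y)" for x y
  proof (cases "x = 0 \<or> y = 0 \<or> x + y = 0")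
    case True
    have "1 \<le> b ^ N" using b_gt_1 by (simp add: one_le_power)
    then have "step_norm z \<le> b ^ N * step_norm z" for z
      using pos[of z] mult_right_mono by fastforce
    then show ?thesis using True pos[of x] pos[of y] b_gt_1
      by (auto simp: step_norm_def intro!: mult_nonneg_nonneg add_nonneg_nonneg)
  next
    case False
    define k where "k = min (exit_time x) (exit_time y)"
    have small: "norm (M j *v x) < 1" "norm (M j *v y) < 1" if "j < k" for j
      using that False exit_time[of x "exit_time x"] exit_time[of y "exit_time y"]
      by (auto simp: exits_at_def k_def)
    have "norm (M j *v (x + y)) < 1" if "j < k - int N" for j
    proof -
      have "norm (M (- int N) *v (M (j + int N) *v (x + y))) \<le> 1 / 2 * norm (M (j + int N) *v (x + y))"
        by (rule N) simp
      also have "norm (M (j + int N) *v (x + y)) \<le> norm (M (j + int N) *v x) + norm (M (j + int N) *v y)"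
        by (simp add: matrix_vector_right_distrib norm_triangle_ineq)
      also have "1 / 2 * (norm (M (j + int N) *v x) + norm (M (j + int N) *v y)) < 1"
        using small[of "j + int N"] that by simp
      finally have "norm (M (- int N) *v (M (j + int N) *v (x + y))) < 1" by simp
      then show ?thesis by (simp flip: M_apply_add)
    qed
    then have "k - int N \<le> exit_time (x + y)"
      using exit_time[of "x + y" "exit_time (x + y)"] False by (auto simp: exits_at_def) (meson not_le)
    then have "b powi (- exit_time (x + y)) \<le> b powi (int N + (- k))"
      using b_gt_1 by (intro power_int_increasing) auto
    also have "\<dots> = b ^ N * b powi (- k)" using b_nonzero by (subst power_int_add) auto
    also have "\<dots> \<le> b ^ N * (b powi (- exit_time x) + b powi (- exit_time y))"
      using b_gt_1 by (intro mult_left_mono) (auto simp: k_def min_def)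
    finally show ?thesis using False by (simp add: step_norm_def)
  qed
  moreover have "b ^ N > 0" using b_gt_1 by simp
  ultimately show "\<exists>c>0. \<forall>x y. step_norm (x + y) \<le> c * (step_norm x + step_norm y)" by blast
qed

end

section \<open>Estimates for arbitrary measurable quasi-norms\<close>

text \<open>Steinhaus argument. Some sublevel set \<open>E m\<close> fills most of the unit ball.
  For small \<open>x\<close> the reflected set \<open>x - E m\<close> has the same measure and lies
  in a slightly larger ball, too small to contain both disjointly. A common point gives
  \<open>x = e + e'\<close> with both summands in \<open>E m\<close>.\<close>

lemma quasi_norm_locally_bounded:
  fixes \<rho> :: "real^'n \<Rightarrow> real"
  assumes meas: "\<rho> \<in> borel_measurable lebesgue"
    and c: "c > 0" "\<And>x y. \<rho> (x + y) \<le> c * (\<rho> x + \<rho> y)"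
  shows "\<exists>\<delta> K. \<delta> > 0 \<and> (\<forall>x. norm x < \<delta> \<longrightarrow> \<rho> x \<le> K)"
proof -
  define B where "B r = ball (0::real^'n) r" for r
  define v where "v = measure lebesgue (B 1)"
  have v: "v > 0" by (simp add: v_def B_def content_ball_pos)
  define E where "E m = {x \<in> B 1. \<rho> x \<le> real m}" for m :: nat
  have E_meas: "E m \<in> sets lebesgue" for m
  proof -
    have "{x \<in> space lebesgue. \<rho> x \<le> real m} \<in> sets lebesgue"
      using meas by measurable
    then have "B 1 \<inter> {x \<in> space lebesgue. \<rho> x \<le> real m} \<in> sets lebesgue"
      by (intro sets.Int) (simp_all add: B_def)
    moreover have "E m = B 1 \<inter> {x \<in> space lebesgue. \<rho> x \<le> real m}" by (auto simp: E_def)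
    ultimately show ?thesis by (simp only:)
  qed
  have UE: "(\<Union>m. E m) = B 1"
    by (auto simp: E_def real_arch_simple)
  have "(\<lambda>m. measure lebesgue (E m)) \<longlonglongrightarrow> measure lebesgue (\<Union>m. E m)"
  proof (rule Lim_measure_incseq)
    show "range E \<subseteq> sets lebesgue" using E_meas by auto
    show "incseq E" unfolding incseq_def E_def by force
    show "emeasure lebesgue (\<Union>m. E m) \<noteq> \<infinity>"
      unfolding UE B_def using emeasure_lborel_ball_finite[of "0::real^'n" 1] by simp
  qed
  then have "(\<lambda>m. measure lebesgue (E m)) \<longlonglongrightarrow> v" unfolding UE v_def .
  then have "\<forall>\<^sub>F m in sequentially. measure lebesgue (E m) > 3 / 4 * v"
    by (rule order_tendstoD(1)) (use v in simp)
  then obtain m where m: "measure lebesgue (E m) > 3 / 4 * v"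
    by (metis eventually_sequentially order_refl)
  \<comment> \<open>\<open>\<delta>\<close> is chosen so that the ball of radius
    \<open>1 + \<delta>\<close> has volume below \<open>3/2 * v\<close>, that is, below twice the
    \<open>3/4 * v\<close> exceeded by each of the two sets.\<close>
  have "((\<lambda>d. (1 + d) ^ CARD('n)) \<longlongrightarrow> (1 + 0) ^ CARD('n)) (at_right (0::real))"
    by (intro tendsto_intros)
  then have "\<forall>\<^sub>F d in at_right 0. (1 + d) ^ CARD('n) < (3/2 :: real)"
    by (rule order_tendstoD(2)) simp
  then obtain \<delta> where \<delta>: "\<delta> > 0" "(1 + \<delta>) ^ CARD('n) < (3/2 :: real)"
    by (metis (no_types, lifting) dense eventually_at_right_field)
  have "\<rho> x \<le> c * (2 * real m)" if x: "norm x < \<delta>" for x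
  proof -
    define F where "F = (\<lambda>e. (-1) *\<^sub>R e + x) ` E m"
    have F_measure: "measure lebesgue F = measure lebesgue (E m)"
      unfolding F_def using measure_lebesgue_affine[of "-1" x "E m"] by (simp add: add.commute)
    have Bd: "measure lebesgue (B (1 + \<delta>)) = (1 + \<delta>) ^ CARD('n) * v"
      using content_ball_conv_unit_ball[of "1 + \<delta>" "0::real^'n"] \<delta> by (simp add: B_def v_def)
    have subs: "E m \<subseteq> B (1 + \<delta>)" "F \<subseteq> B (1 + \<delta>)"
    proof -
      show "E m \<subseteq> B (1 + \<delta>)" using \<delta> by (auto simp: E_def B_def)
      show "F \<subseteq> B (1 + \<delta>)"
      proof
        fix y assume "y \<in> F"
        then obtain e where e: "e \<in> E m" "y = x - e" by (auto simp: F_def)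
        have "norm y \<le> norm x + norm e" unfolding e(2) by (rule norm_triangle_ineq4)
        then show "y \<in> B (1 + \<delta>)" using x e(1) by (simp add: E_def B_def)
      qed
    qed
    have F_meas: "F \<in> sets lebesgue"
    proof -
      have "(\<lambda>y. (-1) *\<^sub>R y + x) \<in> lebesgue \<rightarrow>\<^sub>M lebesgue"
        using lebesgue_affine_measurable[of "\<lambda>_. -1" x]
        by (simp add: sum_negf euclidean_representation)
      moreover have "F = (\<lambda>y. (-1) *\<^sub>R y + x) -` E m \<inter> space lebesgue"
        by (force simp: F_def)
      ultimately show ?thesis using E_meas[of m] measurable_sets by metis
    qed
    have BL: "B (1 + \<delta>) \<in> lmeasurable" by (simp add: B_def)
    have EL: "E m \<in> lmeasurable" and FL: "F \<in> lmeasurable"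
      using fmeasurableI2[OF BL subs(1) E_meas] fmeasurableI2[OF BL subs(2) F_meas] .
    have "E m \<inter> F \<noteq> {}"
    proof
      assume "E m \<inter> F = {}"
      then have "measure lebesgue (E m \<union> F) = measure lebesgue (E m) + measure lebesgue F"
        using EL FL by (intro measure_Un2[THEN trans]) (auto simp: Int_commute Diff_triv)
      moreover have "measure lebesgue (E m \<union> F) \<le> measure lebesgue (B (1 + \<delta>))"
        using subs E_meas F_meas BL by (intro measure_mono_fmeasurable) auto
      ultimately have "3 / 2 * v < (1 + \<delta>) ^ CARD('n) * v"
        using m F_measure Bd by linarith
      then show False using \<delta>(2) v by simp
    qed
    then obtain e e' where e: "e \<in> E m" "e' \<in> E m" "e' = x - e" by (auto simp: F_def)
    have "\<rho> (e + e') \<le> c * (\<rho> e + \<rho> e')" by (rule c)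
    also have "\<dots> \<le> c * (2 * real m)" using e c(1) by (intro mult_left_mono) (auto simp: E_def)
    finally show ?thesis using e(3) by simp
  qed
  with \<delta>(1) show ?thesis by blast
qed

locale quasi_normed_powers = expanding_powers A M
  for A :: "real^'n^'n" and M +
  fixes \<rho> :: "real^'n \<Rightarrow> real"
  assumes quasi: "is_quasi_norm A \<rho>"
begin

lemma \<rho>_nonneg: "\<rho> x \<ge> 0" and \<rho>_eq_0: "\<rho> x = 0 \<longleftrightarrow> x = 0" and \<rho>_A: "\<rho> (A *v x) = b * \<rho> x"
  using quasi by (auto simp: is_quasi_norm_def b_def)

lemma \<rho>_M: "\<rho> (M k *v x) = b powi k * \<rho> x"
proof -
  have pos: "\<rho> (M (int n) *v x) = b ^ n * \<rho> x" for n x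
  proof (induction n)
    case (Suc n)
    have "M (int (Suc n)) *v x = A *v (M (int n) *v x)"
      using M_apply_add[of 1 "int n" x] by (simp add: M_1)
    then show ?case using Suc by (simp add: \<rho>_A)
  qed simp
  have neg: "\<rho> (M (- int n) *v x) = inverse (b ^ n) * \<rho> x" for n
    using pos[of n "M (- int n) *v x"] b_nonzero by (simp add: field_simps)
  show ?thesis using pos neg by (cases k rule: int_cases2) (auto simp: power_int_minus)
qed

text \<open>A negative power of \<open>A\<close> shrinks the ball into the neighbourhood of 0 where
  \<open>\<rho>\<close> is bounded; homogeneity transports the bound back.\<close>

lemma \<rho>_bounded_on_ball: "\<exists>K>0. \<forall>x. norm x \<le> R \<longrightarrow> \<rho> x \<le> K"
proof -
  obtain c where "c > 0" "\<And>x y. \<rho> (x + y) \<le> c * (\<rho> x + \<rho> y)"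
    using quasi by (auto simp: is_quasi_norm_def)
  then obtain \<delta> K where \<delta>: "\<delta> > 0" "\<And>x. norm x < \<delta> \<Longrightarrow> \<rho> x \<le> K"
    using quasi_norm_locally_bounded[of \<rho> c] quasi unfolding is_quasi_norm_def by metis
  define a where "a = \<bar>R\<bar> + 1"
  have a: "a > 0" "R \<le> a" by (simp_all add: a_def)
  define e where "e = \<delta> / (2 * a)"
  have e: "e > 0" using \<delta>(1) a by (simp add: e_def)
  obtain N where N: "\<And>k x. k \<ge> N \<Longrightarrow> norm (M (- int k) *v x) \<le> e * norm x"
    using contracting[OF e] by blast
  have "\<rho> x \<le> b ^ N * K" if "norm x \<le> R" for x
  proof -
    have "norm (M (- int N) *v x) \<le> e * norm x" by (rule N) simp
    also have "\<dots> \<le> e * a" using that e a by (intro mult_left_mono) auto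
    also have "\<dots> = \<delta> / 2" using a by (simp add: e_def)
    also have "\<dots> < \<delta>" using \<delta>(1) by simp
    finally have "\<rho> (M (- int N) *v x) \<le> K" by (rule \<delta>(2))
    moreover have "\<rho> x = b ^ N * \<rho> (M (- int N) *v x)"
      using \<rho>_M[of "int N" "M (- int N) *v x"] by simp
    ultimately show ?thesis using b_gt_1 by (simp add: mult_left_mono)
  qed
  then have "\<forall>x. norm x \<le> R \<longrightarrow> \<rho> x \<le> max 1 (b ^ N * K)" by (simp add: le_max_iff_disj)
  then show ?thesis by (intro exI[of _ "max 1 (b ^ N * K)"]) auto
qed

text \<open>A vector so short that \<open>M N\<close> keeps it in the unit ball has
  \<open>\<rho>\<close> at most \<open>K / b ^ N\<close>.\<close>

lemma \<rho>_small_near_0: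
  assumes "\<epsilon> > 0"
  shows "\<exists>\<delta>>0. \<forall>x. norm x < \<delta> \<longrightarrow> \<rho> x < \<epsilon>"
proof -
  obtain K where K: "K > 0" "\<And>x. norm x \<le> 1 \<Longrightarrow> \<rho> x \<le> K" using \<rho>_bounded_on_ball[of 1] by auto
  obtain N where N: "K / \<epsilon> < b ^ N" using real_arch_pow[OF b_gt_1] by blast
  define o1 where "o1 = onorm ((*v) (M (int N))) + 1"
  have o1: "o1 > 0"
    unfolding o1_def using onorm_pos_le[OF matrix_vector_mul_bounded_linear, of "M (int N)"] by linarith
  have "\<rho> x < \<epsilon>" if "norm x < 1 / o1" for x
  proof -
    have "norm (M (int N) *v x) \<le> onorm ((*v) (M (int N))) * norm x"
      by (rule norm_matrix_vector_le_onorm)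
    also have "\<dots> \<le> o1 * norm x" by (intro mult_right_mono) (auto simp: o1_def)
    also have "\<dots> \<le> 1" using that o1 by (simp add: field_simps)
    finally have "\<rho> (M (int N) *v x) \<le> K" by (rule K(2))
    then have "b ^ N * \<rho> x \<le> K" using \<rho>_M[of "int N" x] by simp
    also have "K < b ^ N * \<epsilon>" using N assms by (simp add: field_simps)
    finally show ?thesis using b_gt_1 by simp
  qed
  moreover have "1 / o1 > 0" using o1 by simp
  ultimately show ?thesis by blast
qed

text \<open>Otherwise points of the annulus with \<open>\<rho>\<close> tending to 0 accumulate at
  some \<open>l \<noteq> 0\<close>. Splitting \<open>l\<close> as \<open>(l - x) + x\<close>, with
  \<open>x\<close> such a point close to \<open>l\<close>, makes both terms small and contradicts
  \<open>\<rho> l > 0\<close>.\<close>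

lemma \<rho>_lower_bound_annulus:
  assumes "r > 0"
  shows "\<exists>m>0. \<forall>x. r \<le> norm x \<and> norm x \<le> R \<longrightarrow> m \<le> \<rho> x"
proof (rule ccontr)
  assume contra: "\<not> ?thesis"
  obtain c where c: "c > 0" "\<And>x y. \<rho> (x + y) \<le> c * (\<rho> x + \<rho> y)"
    using quasi by (auto simp: is_quasi_norm_def)
  have "\<exists>x. (r \<le> norm x \<and> norm x \<le> R) \<and> \<rho> x < 1 / real (Suc n)" for n
    using contra by (metis not_le of_nat_0_less_iff zero_less_Suc zero_less_divide_1_iff)
  then obtain x where x: "\<And>n. r \<le> norm (x n) \<and> norm (x n) \<le> R" "\<And>n. \<rho> (x n) < 1 / real (Suc n)"
    by metis
  define S where "S = {y::real^'n. r \<le> norm y} \<inter> cball 0 R"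
  have "compact S" unfolding S_def
    by (intro closed_Int_compact closed_Collect_le continuous_intros compact_cball)
  moreover have "\<forall>n. x n \<in> S" using x(1) by (simp add: S_def)
  ultimately obtain l s where l: "l \<in> S" "strict_mono (s :: nat \<Rightarrow> nat)" "(x \<circ> s) \<longlonglongrightarrow> l"
    unfolding compact_def by blast
  have "l \<noteq> 0" using l(1) assms by (auto simp: S_def)
  then have "\<rho> l > 0" using \<rho>_nonneg[of l] \<rho>_eq_0[of l] by linarith
  \<comment> \<open>Then \<open>c * (e + e)\<close> is exactly \<open>\<rho> l\<close>.\<close>
  define e where "e = \<rho> l / (2 * c)"
  have e: "e > 0" using \<open>\<rho> l > 0\<close> c(1) by (simp add: e_def)
  obtain \<delta> where \<delta>: "\<delta> > 0" "\<And>y. norm y < \<delta> \<Longrightarrow> \<rho> y < e" using \<rho>_small_near_0[OF e] by auto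
  have "\<forall>\<^sub>F n in sequentially. dist ((x \<circ> s) n) l < \<delta>"
    using l(3) \<delta>(1) by (rule tendstoD)
  moreover have "(\<lambda>n. 1 / real (Suc n)) \<longlonglongrightarrow> 0" by (rule LIMSEQ_Suc[OF lim_1_over_n])
  then have "\<forall>\<^sub>F n in sequentially. 1 / real (Suc n) < e"
    using e by (rule order_tendstoD(2))
  ultimately have "\<forall>\<^sub>F n in sequentially. dist ((x \<circ> s) n) l < \<delta> \<and> 1 / real (Suc n) < e"
    by (rule eventually_conj)
  then obtain n where n: "dist (x (s n)) l < \<delta>" "1 / real (Suc n) < e"
    by (auto simp: eventually_sequentially)
  have "n \<le> s n" using l(2) by (rule seq_suble)
  then have "1 / real (Suc (s n)) \<le> 1 / real (Suc n)" by (simp add: field_simps)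
  then have 1: "\<rho> (x (s n)) < e" using x(2)[of "s n"] n(2) by linarith
  have 2: "\<rho> (l - x (s n)) < e" using n(1) by (intro \<delta>(2)) (simp add: dist_norm norm_minus_commute)
  have "\<rho> l \<le> c * (\<rho> (l - x (s n)) + \<rho> (x (s n)))" using c(2)[of "l - x (s n)" "x (s n)"] by simp
  also have "\<dots> < c * (e + e)" using 1 2 c(1) by (intro mult_strict_left_mono add_strict_mono)
  also have "\<dots> = \<rho> l" using c(1) by (simp add: e_def)
  finally show False by simp
qed

text \<open>At the exit time \<open>k\<close> of \<open>y\<close> the value
  \<open>b powi k * \<rho> y\<close> is at least \<open>m\<close>, so a bound on
  \<open>\<rho> y\<close> keeps \<open>k\<close> above \<open>- N\<close>. Then
  \<open>M (- N) *v y\<close> is in the unit ball, and \<open>M N\<close> maps that ball to a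
  bounded set.\<close>

lemma sublevel_bounded: "\<exists>R>0. \<forall>y. \<rho> y \<le> K \<longrightarrow> norm y \<le> R"
proof -
  obtain m where m: "m > 0" "\<And>x. 1 \<le> norm x \<Longrightarrow> norm x \<le> A_norm \<Longrightarrow> m \<le> \<rho> x"
    using \<rho>_lower_bound_annulus[of 1 A_norm] by auto
  obtain N where N: "K / m < b ^ N" using real_arch_pow[OF b_gt_1] by blast
  define R where "R = onorm ((*v) (M (int N))) + 1"
  have R: "onorm ((*v) (M (int N))) \<le> R" "R > 0"
    unfolding R_def using onorm_pos_le[OF matrix_vector_mul_bounded_linear, of "M (int N)"] by linarith+
  have "norm y \<le> R" if "\<rho> y \<le> K" for y
  proof (cases "y = 0")
    case False
    then obtain k where k: "exits_at y k" using exits_at_ex by blast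
    have "m \<le> b powi k * \<rho> y"
      using m(2)[OF exits_at_annulus[OF k]] by (simp add: \<rho>_M)
    also have "\<dots> \<le> b powi k * K" using that b_gt_1 by (intro mult_left_mono) auto
    also have "\<dots> < b powi k * (m * b ^ N)"
      using N m(1) b_gt_1 by (intro mult_strict_left_mono) (auto simp: field_simps)
    finally have "1 < b powi k * b ^ N" using m(1) by (simp add: field_simps)
    also have "\<dots> = b powi (k + int N)" using b_nonzero by (subst power_int_add) auto
    finally have "- int N < k"
      using b_gt_1 power_int_increasing[of "k + int N" 0 b] by fastforce
    then have "norm (M (- int N) *v y) < 1" using k by (simp add: exits_at_def)
    have "norm y = norm (M (int N) *v (M (- int N) *v y))" by simp
    also have "\<dots> \<le> onorm ((*v) (M (int N))) * norm (M (- int N) *v y)"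
      by (rule norm_matrix_vector_le_onorm)
    also have "\<dots> \<le> R * 1"
      using \<open>norm (M (- int N) *v y) < 1\<close> R by (intro mult_mono) auto
    finally show ?thesis by simp
  qed (use R in auto)
  with R(2) show ?thesis by blast
qed

end

section \<open>Equivalence of quasi-norms in terms of quotients of powers\<close>

text \<open>At the exit time \<open>k\<close> of \<open>x\<close> the vector \<open>M k *v x\<close>
  is in a fixed annulus, and the two bounded quotients keep \<open>M' m *v x\<close> in another one.
  So \<open>\<alpha> * \<rho>\<^sub>1 x\<close> and \<open>\<beta> * \<rho>\<^sub>2 x\<close> lie
  between positive constants, where \<open>\<alpha>\<close> and \<open>\<beta>\<close> are the
  determinants of the two powers in absolute value. These are comparable because the determinants of
  the quotients are bounded by \<open>D\<close>.\<close>

lemma comparable_powers_imp_quasi_norm_bound: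
  fixes A B :: "real^'n^'n"
  assumes "quasi_normed_powers A M \<rho>\<^sub>1" "quasi_normed_powers B M' \<rho>\<^sub>2"
    and cmp: "\<And>k. \<exists>m. (\<forall>x. norm ((M' m ** M (- k)) *v x) \<le> R * norm x) \<and>
                     (\<forall>x. norm ((M k ** M' (- m)) *v x) \<le> R * norm x)"
  shows "equivalent_quasi_norms \<rho>\<^sub>1 \<rho>\<^sub>2"
proof -
  interpret A: quasi_normed_powers A M \<rho>\<^sub>1 by fact
  interpret B: quasi_normed_powers B M' \<rho>\<^sub>2 by fact
  define R' where "R' = max R 1"
  have R': "R' \<ge> 1" "R \<le> R'" by (simp_all add: R'_def)
  define D where "D = fact CARD('n) * R' ^ CARD('n)"
  have D: "D > 0" using R' by (simp add: D_def)
  obtain K1 where K1: "K1 > 0" "\<And>x. norm x \<le> A.A_norm \<Longrightarrow> \<rho>\<^sub>1 x \<le> K1"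
    using A.\<rho>_bounded_on_ball[of A.A_norm] by auto
  obtain m1 where m1: "m1 > 0" "\<And>x. 1 \<le> norm x \<Longrightarrow> norm x \<le> A.A_norm \<Longrightarrow> m1 \<le> \<rho>\<^sub>1 x"
    using A.\<rho>_lower_bound_annulus[of 1 A.A_norm] by auto
  obtain K2 where K2: "K2 > 0" "\<And>x. norm x \<le> R' * A.A_norm \<Longrightarrow> \<rho>\<^sub>2 x \<le> K2"
    using B.\<rho>_bounded_on_ball[of "R' * A.A_norm"] by auto
  obtain m2 where m2: "m2 > 0" "\<And>x. 1 / R' \<le> norm x \<Longrightarrow> norm x \<le> R' * A.A_norm \<Longrightarrow> m2 \<le> \<rho>\<^sub>2 x"
    using B.\<rho>_lower_bound_annulus[of "1 / R'" "R' * A.A_norm"] R' by auto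
  define C where "C = max (D * K2 / m1) (D * K1 / m2)"
  have C: "C > 0" using D K2 m1 by (simp add: C_def less_max_iff_disj)
  have "\<rho>\<^sub>1 x \<le> C * \<rho>\<^sub>2 x \<and> \<rho>\<^sub>2 x \<le> C * \<rho>\<^sub>1 x" for x
  proof (cases "x = 0")
    case True
    then show ?thesis using A.\<rho>_eq_0[of x] B.\<rho>_eq_0[of x] by auto
  next
    case False
    then obtain k where k: "A.exits_at x k" using A.exits_at_ex by blast
    obtain m where m: "\<And>x. norm ((M' m ** M (- k)) *v x) \<le> R * norm x"
      "\<And>x. norm ((M k ** M' (- m)) *v x) \<le> R * norm x" using cmp by blast
    have m': "norm ((M' m ** M (- k)) *v x) \<le> R' * norm x"
      "norm ((M k ** M' (- m)) *v x) \<le> R' * norm x" for x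
      using m[of x] mult_right_mono[OF R'(2) norm_ge_zero[of x]] by linarith+
    define y where "y = M k *v x"
    define z where "z = M' m *v x"
    have y: "1 \<le> norm y" "norm y \<le> A.A_norm"
      using A.exits_at_annulus[OF k] by (simp_all add: y_def)
    have zy: "z = (M' m ** M (- k)) *v y" "y = (M k ** M' (- m)) *v z"
      by (simp_all add: z_def y_def matrix_vector_mul_assoc[symmetric])
    have "norm z \<le> R' * norm y" using m'(1)[of y] zy(1) by simp
    also have "\<dots> \<le> R' * A.A_norm" using y R' by (intro mult_left_mono) auto
    finally have z1: "norm z \<le> R' * A.A_norm" .
    have "1 \<le> R' * norm z" using m'(2)[of z] y unfolding zy(2)[symmetric] by linarith
    then have z2: "1 / R' \<le> norm z" using R' by (simp add: field_simps)
    define \<alpha> where "\<alpha> = A.b powi k"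
    define \<beta> where "\<beta> = B.b powi m"
    have \<alpha>\<beta>: "\<alpha> > 0" "\<beta> > 0" using A.b_gt_1 B.b_gt_1 by (auto simp: \<alpha>_def \<beta>_def)
    have "\<bar>det (M' m ** M (- k))\<bar> \<le> D"
      unfolding D_def by (intro abs_det_bounded matrix_entry_le m')
    then have "\<beta> * inverse \<alpha> \<le> D"
      by (simp add: det_mul abs_mult A.abs_det_M B.abs_det_M \<alpha>_def \<beta>_def power_int_minus)
    then have \<beta>: "\<beta> \<le> D * \<alpha>" using \<alpha>\<beta> by (simp add: field_simps)
    have "\<bar>det (M k ** M' (- m))\<bar> \<le> D"
      unfolding D_def by (intro abs_det_bounded matrix_entry_le m')
    then have "\<alpha> * inverse \<beta> \<le> D"
      by (simp add: det_mul abs_mult A.abs_det_M B.abs_det_M \<alpha>_def \<beta>_def power_int_minus)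
    then have \<alpha>: "\<alpha> \<le> D * \<beta>" using \<alpha>\<beta> by (simp add: field_simps)
    have \<rho>1: "m1 \<le> \<alpha> * \<rho>\<^sub>1 x" "\<alpha> * \<rho>\<^sub>1 x \<le> K1"
      using m1(2)[OF y] K1(2)[OF y(2)] by (simp_all add: y_def A.\<rho>_M \<alpha>_def)
    have \<rho>2: "m2 \<le> \<beta> * \<rho>\<^sub>2 x" "\<beta> * \<rho>\<^sub>2 x \<le> K2"
      using m2(2)[OF z2 z1] K2(2)[OF z1] by (simp_all add: z_def B.\<rho>_M \<beta>_def)
    have "\<rho>\<^sub>1 x \<le> D * K1 / m2 * \<rho>\<^sub>2 x"
    proof -
      have "\<beta> * (\<rho>\<^sub>1 x * m2) \<le> D * \<alpha> * (\<rho>\<^sub>1 x * m2)"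
        using \<beta> A.\<rho>_nonneg[of x] m2(1) by (intro mult_right_mono) auto
      also have "\<dots> = D * m2 * (\<alpha> * \<rho>\<^sub>1 x)" by simp
      also have "\<dots> \<le> D * m2 * K1" using \<rho>1(2) D m2(1) by (intro mult_left_mono) auto
      also have "\<dots> = D * K1 * m2" by simp
      also have "\<dots> \<le> D * K1 * (\<beta> * \<rho>\<^sub>2 x)" using \<rho>2(1) D K1(1) by (intro mult_left_mono) auto
      finally have "\<beta> * (\<rho>\<^sub>1 x * m2) \<le> \<beta> * (D * K1 * \<rho>\<^sub>2 x)" by (simp add: algebra_simps)
      then have "\<rho>\<^sub>1 x * m2 \<le> D * K1 * \<rho>\<^sub>2 x" using \<alpha>\<beta>(2) by simp
      then show ?thesis using m2(1) by (simp add: field_simps)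
    qed
    also have "\<dots> \<le> C * \<rho>\<^sub>2 x" by (intro mult_right_mono B.\<rho>_nonneg) (simp add: C_def)
    finally have 1: "\<rho>\<^sub>1 x \<le> C * \<rho>\<^sub>2 x" .
    have "\<rho>\<^sub>2 x \<le> D * K2 / m1 * \<rho>\<^sub>1 x"
    proof -
      have "\<alpha> * (\<rho>\<^sub>2 x * m1) \<le> D * \<beta> * (\<rho>\<^sub>2 x * m1)"
        using \<alpha> B.\<rho>_nonneg[of x] m1(1) by (intro mult_right_mono) auto
      also have "\<dots> = D * m1 * (\<beta> * \<rho>\<^sub>2 x)" by simp
      also have "\<dots> \<le> D * m1 * K2" using \<rho>2(2) D m1(1) by (intro mult_left_mono) auto
      also have "\<dots> = D * K2 * m1" by simp
      also have "\<dots> \<le> D * K2 * (\<alpha> * \<rho>\<^sub>1 x)" using \<rho>1(1) D K2(1) by (intro mult_left_mono) auto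
      finally have "\<alpha> * (\<rho>\<^sub>2 x * m1) \<le> \<alpha> * (D * K2 * \<rho>\<^sub>1 x)" by (simp add: algebra_simps)
      then have "\<rho>\<^sub>2 x * m1 \<le> D * K2 * \<rho>\<^sub>1 x" using \<alpha>\<beta>(1) by simp
      then show ?thesis using m1(1) by (simp add: field_simps)
    qed
    also have "\<dots> \<le> C * \<rho>\<^sub>1 x" by (intro mult_right_mono A.\<rho>_nonneg) (simp add: C_def)
    finally show ?thesis using 1 by blast
  qed
  then show ?thesis
    unfolding equivalent_quasi_norms_def using C by (intro exI[of _ C]) (auto simp: field_simps)
qed

text \<open>Homogeneity and the condition on the determinants send unit vectors into the sublevel
  set of \<open>\<rho>\<^sub>2\<close> at level \<open>C * D * K1\<close>, which is bounded.\<close>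

lemma equivalent_quasi_norms_imp_bounded_quotients:
  fixes A B :: "real^'n^'n"
  assumes "quasi_normed_powers A M \<rho>\<^sub>1" "quasi_normed_powers B M' \<rho>\<^sub>2"
    and eq: "equivalent_quasi_norms \<rho>\<^sub>1 \<rho>\<^sub>2" and "D > 0"
  shows "\<exists>R. \<forall>k m. \<bar>det A\<bar> powi k \<le> D * \<bar>det B\<bar> powi m \<longrightarrow>
           (\<forall>x. norm ((M' (- m) ** M k) *v x) \<le> R * norm x)"
proof -
  interpret A: quasi_normed_powers A M \<rho>\<^sub>1 by fact
  interpret B: quasi_normed_powers B M' \<rho>\<^sub>2 by fact
  obtain C where C: "C > 0" "\<And>x. \<rho>\<^sub>2 x \<le> C * \<rho>\<^sub>1 x"
    using eq by (auto simp: equivalent_quasi_norms_def)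
  obtain K1 where K1: "K1 > 0" "\<And>x. norm x \<le> 1 \<Longrightarrow> \<rho>\<^sub>1 x \<le> K1"
    using A.\<rho>_bounded_on_ball[of 1] by auto
  obtain R where R: "\<And>y. \<rho>\<^sub>2 y \<le> C * D * K1 \<Longrightarrow> norm y \<le> R"
    using B.sublevel_bounded[of "C * D * K1"] by auto
  have "norm ((M' (- m) ** M k) *v x) \<le> R * norm x"
    if D': "A.b powi k \<le> D * B.b powi m" for k m x
  proof -
    have unit: "norm ((M' (- m) ** M k) *v u) \<le> R" if "norm u = 1" for u
    proof -
      have "\<rho>\<^sub>2 ((M' (- m) ** M k) *v u) = inverse (B.b powi m) * \<rho>\<^sub>2 (M k *v u)"
        by (simp add: matrix_vector_mul_assoc[symmetric] B.\<rho>_M power_int_minus)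
      also have "\<dots> \<le> inverse (B.b powi m) * (C * (A.b powi k * \<rho>\<^sub>1 u))"
        using C(2)[of "M k *v u"] B.b_gt_1 by (intro mult_left_mono) (auto simp: A.\<rho>_M)
      also have "\<dots> \<le> inverse (B.b powi m) * (C * (D * B.b powi m * K1))"
        using D' K1 C that A.\<rho>_nonneg B.b_gt_1 \<open>D > 0\<close> by (intro mult_left_mono mult_mono) auto
      also have "\<dots> = C * D * K1" using B.b_gt_1 by simp
      finally show ?thesis by (rule R)
    qed
    show ?thesis
    proof (cases "x = 0")
      case False
      define u where "u = x /\<^sub>R norm x"
      have "norm u = 1" using False by (simp add: u_def)
      have "x = norm x *\<^sub>R u" using False by (simp add: u_def)
      then have "(M' (- m) ** M k) *v x = norm x *\<^sub>R ((M' (- m) ** M k) *v u)"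
        by (metis matrix_vector_mult_scaleR)
      then have "norm ((M' (- m) ** M k) *v x) = norm x * norm ((M' (- m) ** M k) *v u)" by simp
      also have "\<dots> \<le> norm x * R" by (intro mult_left_mono unit \<open>norm u = 1\<close>) simp
      finally show ?thesis by (simp add: mult.commute)
    qed simp
  qed
  then show ?thesis unfolding A.b_def B.b_def by blast
qed

section \<open>Determinant of the matrix exponential\<close>

lemma det_has_derivative_at_identity:
  fixes E :: "real \<Rightarrow> real^'n^'n"
  assumes "E 0 = mat 1"
    and der: "\<And>i j. ((\<lambda>s. E s $ i $ j) has_field_derivative L $ i $ j) (at 0)"
  shows "((\<lambda>s. det (E s)) has_field_derivative trace L) (at 0)"
proof -
  define S where "S = {p. p permutes (UNIV::'n set)}"
  define d where "d p = (\<Sum>i\<in>UNIV. L $ i $ p i * (\<Prod>j\<in>UNIV - {i}. E 0 $ j $ p j))" for p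
  have "((\<lambda>s. \<Sum>p\<in>S. of_int (sign p) * (\<Prod>i\<in>UNIV. E s $ i $ p i)) has_field_derivative
      (\<Sum>p\<in>S. of_int (sign p) * d p)) (at 0)"
    unfolding d_def by (intro DERIV_sum DERIV_cmult has_field_derivative_prod der)
  moreover have "(\<Sum>p\<in>S. of_int (sign p) * d p) = (\<Sum>p\<in>S. if p = id then trace L else 0)"
  proof (rule sum.cong[OF refl])
    fix p assume p: "p \<in> S"
    show "of_int (sign p) * d p = (if p = id then trace L else 0)"
    proof (cases "p = id")
      case True
      then show ?thesis by (simp add: d_def trace_def assms(1) mat_def sign_id)
    next
      case False
      \<comment> \<open>A permutation other than the identity moves at least two points. After one
        factor of its Leibniz term is differentiated, an off-diagonal entry of the identity matrix
        remains, so only the diagonal term contributes.\<close>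
      have "\<exists>j\<in>UNIV - {i}. p j \<noteq> j" for i
      proof (rule ccontr)
        assume "\<not> ?thesis"
        then have fixpt: "p j = j" if "j \<noteq> i" for j using that by auto
        moreover have "p i = i"
        proof (rule ccontr)
          assume "p i \<noteq> i"
          then have "p (p i) = p i" by (rule fixpt)
          then have "p i = i" using p permutes_inj unfolding S_def by (metis injD mem_Collect_eq)
          with \<open>p i \<noteq> i\<close> show False by simp
        qed
        ultimately have "p x = x" for x by (cases "x = i") auto
        then have "p = id" by (simp add: fun_eq_iff)
        with False show False by simp
      qed
      then have "(\<Prod>j\<in>UNIV - {i}. E 0 $ j $ p j) = 0" for i
        by (intro prod_zero) (auto simp: assms(1) mat_def, metis)
      then have "d p = 0" unfolding d_def by (simp only: mult_zero_right sum.neutral_const)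
      then show ?thesis using False by simp
    qed
  qed
  moreover have "(\<Sum>p\<in>S. if p = id then trace L else 0) = trace L"
    by (simp add: sum.delta S_def finite_permutations permutes_id)
  ultimately show ?thesis unfolding det_def S_def by simp
qed

text \<open>Multiplicativity spreads the derivative at 0 to the differential equation
  \<open>f' = c * f\<close>.\<close>

lemma multiplicative_eq_exp:
  fixes f :: "real \<Rightarrow> real"
  assumes mult: "\<And>s t. f (s + t) = f s * f t" and "f 0 = 1"
    and der: "(f has_field_derivative c) (at 0)"
  shows "f s = exp (c * s)"
proof -
  have f_der: "(f has_field_derivative f s * c) (at s)" for s
  proof -
    have "((\<lambda>t. f s * f (t - s)) has_field_derivative f s * c) (at s)"
    proof (rule DERIV_cmult)
      show "((\<lambda>t. f (t - s)) has_field_derivative c) (at s)"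
        using DERIV_shift[of f c s "- s"] der by simp
    qed
    moreover have "(\<lambda>t. f s * f (t - s)) = f" by (simp add: mult[symmetric])
    ultimately show ?thesis by simp
  qed
  have "((\<lambda>s. f s * exp (- c * s)) has_field_derivative 0) (at s)" for s
  proof -
    have "((\<lambda>s. exp (- c * s)) has_field_derivative - c * exp (- c * s)) (at s)"
      by (auto intro!: derivative_eq_intros)
    from DERIV_mult[OF f_der this] show ?thesis by simp
  qed
  then have "f s * exp (- c * s) = f 0 * exp (- c * 0)"
    by (intro DERIV_isconst_all[where f = "\<lambda>s. f s * exp (- c * s)"]) blast
  then have "f s * exp (- c * s) * exp (c * s) = exp (c * s)" using assms(2) by simp
  then show ?thesis by (simp add: mult.assoc exp_add[symmetric])
qed

lemma trace_pos_if_exp_decay: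
  fixes L :: "real^'n^'n"
  assumes "\<epsilon> > 0" and decay: "\<And>s. s \<ge> 0 \<Longrightarrow> norm (exp (- s *\<^sub>R cmat_of_real L)) \<le> C * exp (- \<epsilon> * s)"
  shows "trace L > 0"
proof (rule ccontr)
  assume "\<not> trace L > 0"
  define E where "E s = matrix_exp (s *\<^sub>R L)" for s
  have E: "cmat_of_real (E s) = exp (s *\<^sub>R cmat_of_real L)" for s
    by (simp add: E_def cmat_of_real_matrix_exp)
  have E_add: "E (s + t) = E s ** E t" for s t
  proof -
    have "cmat_of_real (E (s + t)) = cmat_of_real (E s ** E t)"
      by (simp add: E exp_scaleR_add)
    then show ?thesis by (simp only: cmat_of_real_inject)
  qed
  have E_0: "E 0 = mat 1"
  proof -
    have "cmat_of_real (E 0) = cmat_of_real (mat 1)" by (simp add: E)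
    then show ?thesis by (simp only: cmat_of_real_inject)
  qed
  have E_der: "((\<lambda>s. E s $ i $ j) has_field_derivative L $ i $ j) (at 0)" for i j
  proof -
    have "((\<lambda>s. exp (s *\<^sub>R cmat_of_real L)) has_vector_derivative cmat_of_real L) (at 0)"
      using exp_scaleR_has_vector_derivative_left[of "cmat_of_real L" 0] by simp
    moreover have "bounded_linear (\<lambda>X::'n cmat. cmat_Re X $ i $ j)"
      by (intro bounded_linear_compose[OF bounded_linear_vec_nth]
          bounded_linear_compose[OF bounded_linear_vec_nth] bounded_linear_cmat_Re)
    ultimately have "((\<lambda>s. cmat_Re (exp (s *\<^sub>R cmat_of_real L)) $ i $ j)
        has_vector_derivative cmat_Re (cmat_of_real L) $ i $ j) (at 0)"
      by (rule bounded_linear.has_vector_derivative[rotated])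
    then show ?thesis
      by (simp only: E[symmetric] cmat_Re_of_real has_real_derivative_iff_has_vector_derivative)
  qed
  have det_E: "det (E s) = exp (trace L * s)" for s
    by (rule multiplicative_eq_exp)
      (simp_all add: E_add det_mul E_0 det_has_derivative_at_identity E_der)
  define n where "n = CARD('n)"
  \<comment> \<open>With a nonpositive trace the determinant at time \<open>- s\<close> would be at
    least 1, while the entries decay.\<close>
  have bound: "1 \<le> fact n * \<bar>C * exp (- \<epsilon> * s)\<bar> ^ n" if s: "s \<ge> 0" for s
  proof -
    have "1 \<le> \<bar>det (E (- s))\<bar>"
      using s \<open>\<not> trace L > 0\<close> by (simp add: det_E mult_nonpos_nonneg)
    also have "\<dots> \<le> fact CARD('n) * (C * exp (- \<epsilon> * s)) ^ CARD('n)"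
    proof (rule abs_det_bounded)
      fix i j
      have "\<bar>E (- s) $ i $ j\<bar> = cmod (cmat_rep (cmat_of_real (E (- s))) $ i $ j)" by simp
      also have "\<dots> \<le> norm (cmat_of_real (E (- s)))" by (rule cmat_entry_le_norm)
      also have "\<dots> \<le> C * exp (- \<epsilon> * s)" unfolding E by (rule decay[OF s])
      finally show "\<bar>E (- s) $ i $ j\<bar> \<le> C * exp (- \<epsilon> * s)" .
    qed
    also have "\<dots> \<le> fact n * \<bar>C * exp (- \<epsilon> * s)\<bar> ^ n"
      unfolding n_def by (intro mult_left_mono) (simp_all add: power_abs[symmetric])
    finally show ?thesis .
  qed
  have lim: "((\<lambda>s. fact n * \<bar>C * exp (- \<epsilon> * s)\<bar> ^ n) \<longlongrightarrow> fact n * \<bar>C * 0\<bar> ^ n) at_top"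
  proof (intro tendsto_intros)
    show "((\<lambda>s. exp (- \<epsilon> * s)) \<longlongrightarrow> 0) at_top"
      by (rule filterlim_compose[OF exp_at_bot])
        (use assms(1) in \<open>simp add: filterlim_uminus_at_bot filterlim_tendsto_pos_mult_at_top[OF tendsto_const _ filterlim_ident]\<close>)
  qed
  have "1 \<le> (fact n * \<bar>C * 0\<bar> ^ n :: real)"
    by (rule tendsto_lowerbound[OF lim eventually_mono[OF eventually_ge_at_top[of 0] bound]]) simp_all
  then show False by (simp add: n_def power_0_left)
qed

section \<open>Dilation groups equivalent to a dilation\<close>

text \<open>On an eigenmatrix \<open>V\<close> for \<open>\<mu>\<close> one has
  \<open>V = W (- n) * \<mu> ^ n * V\<close>. If the powers of \<open>\<mu>\<close> stayed in the
  unit disc, the right-hand side would tend to 0.\<close>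

lemma expansive_if_powers_contract:
  fixes A :: "real^'n^'n" and W :: "int \<Rightarrow> 'n cmat"
  assumes W: "\<And>j k. W (j + k) = W j * W k" "W 0 = 1" "W 1 = cmat_of_real A"
    and lim: "(\<lambda>n. W (- int n)) \<longlonglongrightarrow> 0"
  shows "expansive_dilation A"
  unfolding expansive_dilation_def complex_eigenvalue_iff
proof (intro allI impI)
  fix \<mu> assume "cmat_eigenvalue (cmat_of_real A) \<mu>"
  then obtain V where V: "V \<noteq> 0" "W 1 * V = cmat_scalar \<mu> * V"
    by (auto simp: cmat_eigenvalue_def W(3))
  have pow: "W (int n) * V = cmat_scalar (\<mu> ^ n) * V" for n
  proof (induction n)
    case (Suc n)
    have "W (int (Suc n)) * V = W 1 * (W (int n) * V)"
      using W(1)[of 1 "int n"] by (simp add: mult.assoc)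
    also have "\<dots> = cmat_scalar (\<mu> ^ n) * (W 1 * V)"
      unfolding Suc by (rule cmat_scalar_left_commute)
    also have "\<dots> = cmat_scalar (\<mu> ^ Suc n) * V"
      by (simp add: V(2) mult.assoc[symmetric] cmat_scalar_mult[symmetric] mult.commute)
    finally show ?case .
  qed (simp add: W(2))
  show "1 < cmod \<mu>"
  proof (rule ccontr)
    assume "\<not> 1 < cmod \<mu>"
    then have le: "cmod (\<mu> ^ n) \<le> 1" for n by (simp add: norm_power power_le_one)
    have "norm V \<le> norm (W (- int n)) * norm V" for n
    proof -
      have "V = W (- int n) * (W (int n) * V)"
        using W(1)[of "- int n" "int n"] W(2) by (simp add: mult.assoc[symmetric])
      then have "V = W (- int n) * (cmat_scalar (\<mu> ^ n) * V)" by (simp only: pow)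
      then have "norm V \<le> norm (W (- int n)) * norm (cmat_scalar (\<mu> ^ n) * V)"
        by (metis norm_mult_ineq)
      also have "norm (cmat_scalar (\<mu> ^ n) * V) \<le> 1 * norm V"
        by (rule order_trans[OF norm_mult_ineq])
          (simp only: norm_cmat_scalar mult_right_mono[OF le norm_ge_zero])
      finally show ?thesis by (simp add: mult_left_mono)
    qed
    moreover have "(\<lambda>n. norm (W (- int n)) * norm V) \<longlonglongrightarrow> 0 * norm V"
      by (intro tendsto_intros tendsto_norm_zero lim)
    ultimately have "norm V \<le> 0 * norm V"
      by (intro LIMSEQ_le_const) auto
    with V(1) show False by simp
  qed
qed

lemma expanding_powers_cmat:
  fixes A :: "real^'n^'n" and W :: "int \<Rightarrow> 'n cmat"
  assumes W: "\<And>j k. W (j + k) = W j * W k" "W 0 = 1" "W 1 = cmat_of_real A"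
    and lim: "(\<lambda>n. W (- int n)) \<longlonglongrightarrow> 0" and real: "\<And>k. cmat_cnj (W k) = W k"
  shows "expanding_powers A (\<lambda>k. cmat_Re (W k))"
proof
  have cm: "cmat_of_real (cmat_Re (W k)) = W k" for k
    using real by (simp add: cmat_of_real_Re)
  show "cmat_Re (W 0) = mat 1" "cmat_Re (W 1) = A"
    using cmat_Re_of_real[of "mat 1 :: real^'n^'n"] cmat_Re_of_real[of A] by (simp_all add: W)
  have "cmat_of_real (cmat_Re (W (k + l))) = cmat_of_real (cmat_Re (W k) ** cmat_Re (W l))" for k l
    unfolding cmat_of_real_simps cm by (rule W)
  then show "cmat_Re (W (k + l)) = cmat_Re (W k) ** cmat_Re (W l)" for k l
    by (simp only: cmat_of_real_inject)
  fix \<epsilon> :: real assume \<epsilon>: "\<epsilon> > 0"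
  have "\<forall>\<^sub>F n in sequentially. norm (W (- int n)) < \<epsilon> / real CARD('n)"
    using tendstoD[OF lim, of "\<epsilon> / real CARD('n)"] \<epsilon> by simp
  then obtain N where N: "\<And>n. n \<ge> N \<Longrightarrow> norm (W (- int n)) < \<epsilon> / real CARD('n)"
    by (auto simp: eventually_sequentially)
  have "norm (cmat_Re (W (- int k)) *v x) \<le> \<epsilon> * norm x" if "k \<ge> N" for k x
  proof -
    have "norm (cmat_Re (W (- int k)) *v x) \<le> real CARD('n) * norm (W (- int k)) * norm x"
      using norm_matrix_vector_le[of "cmat_Re (W (- int k))" x] by (simp only: cm)
    also have "\<dots> \<le> \<epsilon> * norm x"
      using N[OF that] by (intro mult_right_mono) (simp_all add: field_simps)
    finally show ?thesis .
  qed
  then show "\<exists>N. \<forall>k\<ge>N. \<forall>x. norm (cmat_Re (W (- int k)) *v x) \<le> \<epsilon> * norm x" by blast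
qed

lemma exp_powers_tendsto_0:
  fixes X :: "'a::{real_normed_algebra_1,banach}"
  assumes "\<epsilon> > 0" "a > 0" "\<And>s. s \<ge> 0 \<Longrightarrow> norm (exp (- s *\<^sub>R X)) \<le> C * exp (- \<epsilon> * s)"
  shows "(\<lambda>n. exp (of_int (- int n) *\<^sub>R (a *\<^sub>R X))) \<longlonglongrightarrow> 0"
proof (rule Lim_null_comparison)
  define r where "r = exp (- \<epsilon> * a)"
  have r: "0 \<le> r" "r < 1" using assms by (simp_all add: r_def)
  have "norm (exp (of_int (- int n) *\<^sub>R (a *\<^sub>R X))) \<le> C * r ^ n" for n
    using assms(3)[of "real n * a"] assms(2)
    by (simp add: r_def exp_of_nat_mult[symmetric] mult_ac)
  then show "\<forall>\<^sub>F n in sequentially. norm (exp (of_int (- int n) *\<^sub>R (a *\<^sub>R X))) \<le> C * r ^ n" by simp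
  have "(\<lambda>n. C * r ^ n) \<longlonglongrightarrow> C * 0" by (intro tendsto_intros LIMSEQ_realpow_zero r)
  then show "(\<lambda>n. C * r ^ n) \<longlonglongrightarrow> 0" by simp
qed

lemma shift_prod_scaleR:
  fixes M :: "'a::real_algebra_1"
  shows "shift_prod (c *\<^sub>R M) (map of_real (map ((*) c) ps)) =
    c ^ length ps *\<^sub>R shift_prod M (map of_real ps)"
proof (induction ps)
  case (Cons p ps)
  have "c *\<^sub>R M - of_real (c * p) = c *\<^sub>R (M - of_real p)"
    by (simp add: scaleR_diff_right of_real_def)
  then show ?case using Cons by simp
qed simp

lemma powi_eq_exp: "x > 0 \<Longrightarrow> x powi k = exp (of_int k * ln (x::real))"
  using powr_real_of_int'[of x k] by (simp add: powr_def)

lemma cmat_of_real_dilation_group: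
  "cmat_of_real (dilation_group P t) = exp (ln t *\<^sub>R cmat_of_real P)"
  by (simp add: dilation_group_def cmat_of_real_matrix_exp)

section \<open>Groups with positive generator\<close>

text \<open>The form of \<open>all_eigenvalues_positive\<close> that the decay and uniqueness
  arguments consume; \<open>positive_generator_iff\<close> shows the two to be the same.\<close>

definition positive_generator :: "real^'n^'n \<Rightarrow> bool" where
  "positive_generator P \<longleftrightarrow> (\<exists>ps. shift_prod (cmat_of_real P) (map of_real ps) = 0 \<and> (\<forall>p\<in>set ps. p > 0))"

lemma positive_generator_decay:
  assumes "positive_generator P"
  obtains C \<epsilon> where "\<epsilon> > 0" "\<And>s. s \<ge> 0 \<Longrightarrow> norm (exp (- s *\<^sub>R cmat_of_real P)) \<le> C * exp (- \<epsilon> * s)"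
proof -
  obtain ps where "shift_prod (cmat_of_real P) (map of_real ps) = 0" "\<forall>p\<in>set ps. p > 0"
    using assms by (auto simp: positive_generator_def)
  then show thesis
    using shift_prod_exp_decay[of "cmat_of_real P" ps 1] that by auto
qed

lemma positive_generator_trace: "positive_generator P \<Longrightarrow> trace P > 0"
  by (erule positive_generator_decay) (rule trace_pos_if_exp_decay)

lemma positive_generator_scaleR:
  assumes "positive_generator P" "c > 0"
  shows "positive_generator (c *\<^sub>R P)"
proof -
  obtain ps where ps: "shift_prod (cmat_of_real P) (map of_real ps) = 0" "\<forall>p\<in>set ps. p > 0"
    using assms by (auto simp: positive_generator_def)
  have "shift_prod (cmat_of_real (c *\<^sub>R P)) (map of_real (map ((*) c) ps)) = 0"
    using shift_prod_scaleR[of c "cmat_of_real P" ps] ps(1) by simp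
  moreover have "\<forall>p\<in>set (map ((*) c) ps). p > 0" using ps(2) assms(2) by simp
  ultimately show ?thesis unfolding positive_generator_def by blast
qed

lemma positive_generator_iff: "positive_generator P \<longleftrightarrow> all_eigenvalues_positive P"
proof
  assume "positive_generator P"
  then obtain ps where ps: "shift_prod (cmat_of_real P) (map of_real ps) = 0" "\<forall>p\<in>set ps. p > 0"
    by (auto simp: positive_generator_def)
  have "map of_real ps = (map cmat_scalar (map complex_of_real ps) :: 'a cmat list)"
    by (simp add: cmat_scalar_of_real)
  then have "shift_prod (cmat_of_real P) (map cmat_scalar (map complex_of_real ps)) = 0"
    using ps(1) by (simp only:)
  then have "\<mu> \<in> set (map complex_of_real ps)" if "complex_eigenvalue P \<mu>" for \<mu>
    using shift_prod_eigenvalue that complex_eigenvalue_iff by blast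
  then have "\<exists>p\<in>set ps. \<mu> = complex_of_real p" if "complex_eigenvalue P \<mu>" for \<mu>
    using that by auto
  then show "all_eigenvalues_positive P"
    using ps(2) unfolding all_eigenvalues_positive_def by fastforce
next
  assume P: "all_eigenvalues_positive P"
  obtain ls where ls: "shift_prod (cmat_of_real P) (map cmat_scalar ls) = 0"
    "\<forall>l\<in>set ls. cmat_eigenvalue (cmat_of_real P) l"
    using cmat_eigenvalue_annihilator by blast
  have pos: "complex_of_real (Re l) = l" "Re l > 0" if "l \<in> set ls" for l
    using that ls(2) P by (auto simp: all_eigenvalues_positive_def complex_eigenvalue_iff)
  have "map cmat_scalar ls = (map of_real (map Re ls) :: 'a cmat list)"
    by (simp add: pos(1) flip: cmat_scalar_of_real)
  with ls(1) have "shift_prod (cmat_of_real P) (map of_real (map Re ls)) = 0" by (simp only:)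
  moreover have "\<forall>p\<in>set (map Re ls). p > 0" using pos(2) by auto
  ultimately show "positive_generator P" unfolding positive_generator_def by blast
qed

context
  fixes P :: "real^'n^'n" and t :: real
  assumes P: "positive_generator P" and t: "t > 1"
begin

definition "group_powers k = exp (of_int k *\<^sub>R (ln t *\<^sub>R cmat_of_real P))"

lemma group_powers:
  "group_powers (j + k) = group_powers j * group_powers k" "group_powers 0 = 1"
  "group_powers 1 = cmat_of_real (dilation_group P t)"
  "cmat_cnj (group_powers k) = group_powers k"
  unfolding group_powers_def exp_of_int_scaleR_add
  by (simp_all add: cmat_of_real_dilation_group cmat_cnj_exp)

lemma group_powers_tendsto_0: "(\<lambda>n. group_powers (- int n)) \<longlonglongrightarrow> 0"
proof -
  have "ln t > 0" using t by simp
  then show ?thesis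
    using P unfolding group_powers_def
    by (elim positive_generator_decay) (rule exp_powers_tendsto_0)
qed

lemma dilation_group_expansive: "expansive_dilation (dilation_group P t)"
  by (rule expansive_if_powers_contract[of group_powers]) (simp_all only: group_powers group_powers_tendsto_0)

lemma dilation_group_expanding_powers: "expanding_powers (dilation_group P t) (\<lambda>k. cmat_Re (group_powers k))"
  by (rule expanding_powers_cmat) (simp_all only: group_powers group_powers_tendsto_0)

end

section \<open>Comparison of a dilation in polar form with dilation groups\<close>

context
  fixes A L :: "real^'n^'n" and V :: "int \<Rightarrow> 'n cmat" and B :: real
  assumes L: "positive_generator L"
    and V: "\<And>j k. V (j + k) = V j * V k" "V 0 = 1" "\<And>k. norm (V k) \<le> B"
      "\<And>k. V k * cmat_of_real L = cmat_of_real L * V k" "\<And>k. cmat_cnj (V k) = V k"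
    and A: "cmat_of_real A = exp (cmat_of_real L) * V 1"
begin

abbreviation "expL s \<equiv> exp (s *\<^sub>R cmat_of_real L)"

definition "polar_powers k = expL (of_int k) * V k"

lemma polar_powers_exp_right: "polar_powers k = V k * expL (of_int k)"
  unfolding polar_powers_def by (rule exp_commutes_right[symmetric]) (simp add: V(4))

lemma V_inverse: "V k * V (- k) = 1"
  using V(1)[of k "- k"] V(2) by simp

lemma B_pos: "B > 0"
  using V(3)[of 0] V(2) by simp

lemma polar_powers:
  "polar_powers (j + k) = polar_powers j * polar_powers k" "polar_powers 0 = 1"
  "polar_powers 1 = cmat_of_real A" "cmat_cnj (polar_powers k) = polar_powers k"
  unfolding polar_powers_def
  by (rule polar_powers_hom[OF V(1) V(4)]) (simp_all add: V A cmat_cnj_exp)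

lemma polar_powers_tendsto_0: "(\<lambda>n. polar_powers (- int n)) \<longlonglongrightarrow> 0"
proof (rule Lim_null_comparison)
  obtain C \<epsilon> where "\<epsilon> > 0" "\<And>s. s \<ge> 0 \<Longrightarrow> norm (expL (- s)) \<le> C * exp (- \<epsilon> * s)"
    using L by (rule positive_generator_decay) blast
  then have "(\<lambda>n. expL (of_int (- int n))) \<longlonglongrightarrow> 0"
    using exp_powers_tendsto_0[of \<epsilon> 1 "cmat_of_real L" C] by simp
  then have "(\<lambda>n. norm (expL (of_int (- int n))) * B) \<longlonglongrightarrow> 0 * B"
    by (intro tendsto_intros tendsto_norm_zero)
  then show "(\<lambda>n. norm (expL (of_int (- int n))) * B) \<longlonglongrightarrow> 0" by simp
  have "norm (polar_powers k) \<le> norm (expL (of_int k)) * B" for k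
    unfolding polar_powers_def
    by (rule order_trans[OF norm_mult_ineq mult_left_mono[OF V(3) norm_ge_zero]])
  then show "\<forall>\<^sub>F n in sequentially. norm (polar_powers (- int n)) \<le> norm (expL (of_int (- int n))) * B"
    by (intro always_eventually allI)
qed

lemma expansive_A: "expansive_dilation A"
  by (rule expansive_if_powers_contract[of polar_powers]) (simp_all only: polar_powers polar_powers_tendsto_0)

lemma expanding_powers_A: "expanding_powers A (\<lambda>k. cmat_Re (polar_powers k))"
  by (rule expanding_powers_cmat) (simp_all only: polar_powers polar_powers_tendsto_0)

lemma cmat_of_real_Re_polar: "cmat_of_real (cmat_Re (polar_powers k)) = polar_powers k"
  by (simp add: cmat_of_real_Re polar_powers)

text \<open>The powers of the group member are \<open>exp\<close> of multiples of
  \<open>a * L\<close>. Matched with the powers of \<open>A\<close>, they leave quotients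
  \<open>exp (s * L) * V j\<close> with \<open>\<bar>s\<bar> \<le> a\<close>, because
  \<open>V\<close> commutes with \<open>L\<close>; these are bounded. The scale
  \<open>\<tau>\<close> is kept free and becomes the trace of \<open>L\<close> in the end.\<close>

lemma dilation_group_equivalent:
  assumes \<tau>: "\<tau> > 0" and t: "t > 1"
  shows "equivalent_dilations A (dilation_group ((1 / \<tau>) *\<^sub>R L) t)"
proof -
  define P where "P = (1 / \<tau>) *\<^sub>R L"
  have P: "positive_generator P" unfolding P_def using L \<tau> by (simp add: positive_generator_scaleR)
  define a where "a = ln t / \<tau>"
  have a: "a > 0" using t \<tau> by (simp add: a_def)
  have G: "group_powers P t m = expL (of_int m * a)" for m
    unfolding group_powers_def[OF P t] by (simp add: P_def a_def)
  have Gr: "cmat_of_real (cmat_Re (group_powers P t m)) = group_powers P t m" for m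
    by (simp add: cmat_of_real_Re group_powers[OF P t])
  define R where "R = real CARD('n) * (exp (a * norm (cmat_of_real L)) * B)"
  have bound: "norm (X *v x) \<le> R * norm x"
    if X: "norm (cmat_of_real X) \<le> exp (a * norm (cmat_of_real L)) * B" for X :: "real^'n^'n" and x
  proof -
    have "real CARD('n) * norm (cmat_of_real X) * norm x \<le> R * norm x"
      unfolding R_def by (intro mult_right_mono mult_left_mono X) simp_all
    with norm_matrix_vector_le[of X x] show ?thesis by linarith
  qed
  have prod_bound: "norm (expL s * V j) \<le> exp (a * norm (cmat_of_real L)) * B" if "\<bar>s\<bar> \<le> a" for s j
    using B_pos by (intro order_trans[OF norm_mult_ineq] mult_mono norm_exp_scaleR_le that V(3)) auto
  have cmp: "\<exists>m. (\<forall>x. norm ((cmat_Re (group_powers P t m) ** cmat_Re (polar_powers (- k))) *v x) \<le> R * norm x) \<and>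
      (\<forall>x. norm ((cmat_Re (polar_powers k) ** cmat_Re (group_powers P t (- m))) *v x) \<le> R * norm x)" for k
  proof -
    \<comment> \<open>Of the multiples of \<open>a\<close>, the last one not exceeding
      \<open>k\<close>; the remaining time is at most \<open>a\<close>.\<close>
    define m where "m = \<lfloor>of_int k / a\<rfloor>"
    have "of_int m \<le> of_int k / a" "of_int k / a < of_int m + 1" unfolding m_def by linarith+
    then have m: "of_int m * a \<le> of_int k" "of_int k < (of_int m + 1) * a"
      using a by (simp_all add: field_simps)
    then have close: "\<bar>of_int m * a - of_int k\<bar> \<le> a" "\<bar>of_int k - of_int m * a\<bar> \<le> a"
      by (simp_all add: distrib_right abs_if)
    have "cmat_of_real (cmat_Re (group_powers P t m) ** cmat_Re (polar_powers (- k)))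
        = expL (of_int m * a) * (expL (- of_int k) * V (- k))"
      by (simp only: cmat_of_real_simps Gr cmat_of_real_Re_polar)
        (simp only: G polar_powers_def of_int_minus)
    also have "\<dots> = expL (of_int m * a - of_int k) * V (- k)"
      using exp_scaleR_add[of "of_int m * a" "- of_int k" "cmat_of_real L"] by (simp add: mult.assoc)
    finally have 1: "norm (cmat_of_real (cmat_Re (group_powers P t m) ** cmat_Re (polar_powers (- k))))
        \<le> exp (a * norm (cmat_of_real L)) * B"
      using prod_bound[OF close(1)] by simp
    have "cmat_of_real (cmat_Re (polar_powers k) ** cmat_Re (group_powers P t (- m)))
        = V k * expL (of_int k) * expL (- of_int m * a)"
      by (simp only: cmat_of_real_simps Gr cmat_of_real_Re_polar)
        (simp only: G polar_powers_exp_right of_int_minus)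
    also have "\<dots> = V k * expL (of_int k - of_int m * a)"
      using exp_scaleR_add[of "of_int k" "- of_int m * a" "cmat_of_real L"] by (simp add: mult.assoc)
    also have "\<dots> = expL (of_int k - of_int m * a) * V k"
      by (rule exp_commutes_right) (simp add: V(4))
    finally have 2: "norm (cmat_of_real (cmat_Re (polar_powers k) ** cmat_Re (group_powers P t (- m))))
        \<le> exp (a * norm (cmat_of_real L)) * B"
      using prod_bound[OF close(2)] by simp
    show ?thesis using bound[OF 1] bound[OF 2] by blast
  qed
  have "equivalent_quasi_norms \<rho>\<^sub>1 \<rho>\<^sub>2"
    if "is_quasi_norm A \<rho>\<^sub>1" "is_quasi_norm (dilation_group P t) \<rho>\<^sub>2" for \<rho>\<^sub>1 \<rho>\<^sub>2
  proof (rule comparable_powers_imp_quasi_norm_bound)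
    show "quasi_normed_powers A (\<lambda>k. cmat_Re (polar_powers k)) \<rho>\<^sub>1"
      using that(1) by (intro quasi_normed_powers.intro quasi_normed_powers_axioms.intro expanding_powers_A)
    show "quasi_normed_powers (dilation_group P t) (\<lambda>k. cmat_Re (group_powers P t k)) \<rho>\<^sub>2"
      using that(2) by (intro quasi_normed_powers.intro quasi_normed_powers_axioms.intro
          dilation_group_expanding_powers[OF P t])
  qed (rule cmp)
  then show ?thesis
    unfolding equivalent_dilations_def P_def[symmetric]
    using expansive_A dilation_group_expansive[OF P t] by blast
qed

text \<open>Equivalence is tested on the two step quasi-norms and yields bounded quotients of
  matched powers. After the bounded factor \<open>V\<close> and a bounded remainder of time are
  removed, the flow of \<open>c *\<^sub>R P\<close> stays at bounded distance from that of
  \<open>L\<close>, so \<open>real_flow_unique\<close> applies.\<close>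

lemma equivalent_dilation_group_unique:
  fixes P :: "real^'n^'n"
  assumes P: "positive_generator P" and t: "t > 1"
    and eq: "equivalent_dilations A (dilation_group P t)"
  shows "\<exists>c. c *\<^sub>R P = L"
proof -
  define D where "D = dilation_group P t"
  define Q where "Q = cmat_of_real P"
  define a where "a = ln t"
  have a: "a > 0" using t by (simp add: a_def)
  have G: "group_powers P t m = exp ((of_int m * a) *\<^sub>R Q)" for m
    by (simp add: group_powers_def[OF P t] Q_def a_def)
  have Gr: "cmat_of_real (cmat_Re (group_powers P t m)) = group_powers P t m" for m
    by (simp add: cmat_of_real_Re group_powers[OF P t])
  interpret A: expanding_powers A "\<lambda>k. cmat_Re (polar_powers k)" by (rule expanding_powers_A)
  interpret D: expanding_powers D "\<lambda>k. cmat_Re (group_powers P t k)"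
    unfolding D_def by (rule dilation_group_expanding_powers[OF P t])
  have step_eq: "equivalent_quasi_norms A.step_norm D.step_norm"
    using eq A.step_norm_quasi_norm D.step_norm_quasi_norm
    unfolding equivalent_dilations_def D_def[symmetric] by blast
  have A_step: "quasi_normed_powers A (\<lambda>k. cmat_Re (polar_powers k)) A.step_norm"
    by (intro quasi_normed_powers.intro quasi_normed_powers_axioms.intro
        A.step_norm_quasi_norm A.expanding_powers_axioms)
  have D_step: "quasi_normed_powers D (\<lambda>k. cmat_Re (group_powers P t k)) D.step_norm"
    by (intro quasi_normed_powers.intro quasi_normed_powers_axioms.intro
        D.step_norm_quasi_norm D.expanding_powers_axioms)
  obtain R where R: "\<And>k m x. \<bar>det A\<bar> powi k \<le> 1 * \<bar>det D\<bar> powi m \<Longrightarrow>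
      norm ((cmat_Re (group_powers P t (- m)) ** cmat_Re (polar_powers k)) *v x) \<le> R * norm x"
    using equivalent_quasi_norms_imp_bounded_quotients[OF A_step D_step step_eq zero_less_one] by blast
  \<comment> \<open>The ratio at which powers of \<open>A\<close> and of \<open>D\<close> have equal
    determinants in absolute value.\<close>
  define \<gamma> where "\<gamma> = ln A.b / ln D.b"
  have b: "A.b > 1" "D.b > 1" by (rule A.b_gt_1 D.b_gt_1)+
  define c where "c = \<gamma> * a"
  define K where "K = exp (a * norm Q) * (real CARD('n) * R) * B"
  have "norm (exp (- of_int k *\<^sub>R (c *\<^sub>R Q)) * expL (of_int k)) \<le> K" for k
  proof -
    \<comment> \<open>Rounding up, since the bound on quotients requires the determinant of the
      power of \<open>A\<close> not to exceed that of the power of \<open>D\<close>.\<close>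
    define m where "m = \<lceil>\<gamma> * of_int k\<rceil>"
    have m: "\<gamma> * of_int k \<le> of_int m" "of_int m < \<gamma> * of_int k + 1" unfolding m_def by linarith+
    have "of_int k * ln A.b = \<gamma> * of_int k * ln D.b" using b by (simp add: \<gamma>_def)
    also have "\<dots> \<le> of_int m * ln D.b" using m(1) b by (intro mult_right_mono) auto
    finally have "A.b powi k \<le> 1 * D.b powi m" using b by (simp add: powi_eq_exp)
    then have "norm ((cmat_Re (group_powers P t (- m)) ** cmat_Re (polar_powers k)) *v x) \<le> R * norm x" for x
      by (intro R) (simp only: A.b_def D.b_def)
    then have "norm (cmat_of_real (cmat_Re (group_powers P t (- m)) ** cmat_Re (polar_powers k))) \<le> real CARD('n) * R"
      by (rule norm_cmat_of_real_le)
    then have core: "norm (exp ((- of_int m * a) *\<^sub>R Q) * polar_powers k) \<le> real CARD('n) * R"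
      unfolding cmat_of_real_simps Gr cmat_of_real_Re_polar by (simp only: G of_int_minus)
    define r where "r = of_int m * a - c * of_int k"
    have "r = (of_int m - \<gamma> * of_int k) * a" by (simp add: r_def c_def left_diff_distrib)
    moreover have "0 \<le> (of_int m - \<gamma> * of_int k) * a" "(of_int m - \<gamma> * of_int k) * a \<le> 1 * a"
      using m a by (auto intro!: mult_nonneg_nonneg mult_right_mono)
    ultimately have r: "\<bar>r\<bar> \<le> a" by simp
    have split: "exp (- of_int k *\<^sub>R (c *\<^sub>R Q)) = exp (r *\<^sub>R Q) * exp ((- of_int m * a) *\<^sub>R Q)"
    proof -
      have "- of_int k *\<^sub>R (c *\<^sub>R Q) = (r + - of_int m * a) *\<^sub>R Q"
        by (simp add: r_def mult.commute)
      then show ?thesis by (simp only: exp_scaleR_add)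
    qed
    have "expL (of_int k) = polar_powers k * V (- k)"
      by (simp add: polar_powers_def mult.assoc V_inverse)
    then have "exp (- of_int k *\<^sub>R (c *\<^sub>R Q)) * expL (of_int k)
        = exp (r *\<^sub>R Q) * (exp ((- of_int m * a) *\<^sub>R Q) * polar_powers k) * V (- k)"
      unfolding split by (simp only: mult.assoc)
    also have "norm \<dots> \<le> norm (exp (r *\<^sub>R Q)) * norm (exp ((- of_int m * a) *\<^sub>R Q) * polar_powers k) * norm (V (- k))"
      by (meson mult_right_mono norm_ge_zero norm_mult_ineq order_trans)
    also have "\<dots> \<le> K"
      unfolding K_def using order_trans[OF norm_ge_zero core] B_pos
      by (intro mult_mono norm_exp_scaleR_le r core V(3)) auto
    finally show ?thesis .
  qed
  moreover obtain ps where "shift_prod Q (map of_real ps) = 0"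
    using P by (auto simp: positive_generator_def Q_def)
  then have "shift_prod (c *\<^sub>R Q) (map of_real (map ((*) c) ps)) = 0"
    by (simp only: shift_prod_scaleR) simp
  moreover obtain ks where "shift_prod (cmat_of_real L) (map of_real ks) = 0"
    using L by (auto simp: positive_generator_def)
  ultimately have "c *\<^sub>R Q = cmat_of_real L" using real_flow_unique by blast
  then have "cmat_of_real (c *\<^sub>R P) = cmat_of_real L" by (simp add: Q_def)
  then show ?thesis by (simp only: cmat_of_real_inject) blast
qed

end

lemma trace_scaleR: "trace (c *\<^sub>R P) = c * trace (P :: real^'n^'n)"
  by (simp add: trace_def sum_distrib_left)

theorem theorem3p1:
  fixes A :: "real^'n^'n"
  assumes "expansive_dilation A"
  shows "\<exists>P::real^'n^'n.
           generates_dilations P \<and> all_eigenvalues_positive P \<and> trace P = 1 \<and>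
           (\<forall>t>1. equivalent_dilations A (dilation_group P t)) \<and>
           (\<forall>P'::real^'n^'n.
              generates_dilations P' \<and> all_eigenvalues_positive P' \<and> trace P' = 1 \<and>
              (\<exists>t>1. equivalent_dilations A (dilation_group P' t)) \<longrightarrow> P = P')"
proof -
  obtain L :: "real^'n^'n" and V ks B where
    ks: "shift_prod (cmat_of_real L) (map of_real ks) = 0" "\<And>\<kappa>. \<kappa> \<in> set ks \<Longrightarrow> \<kappa> > 0"
    and V: "\<And>j k :: int. V (j + k) = V j * V k" "V 0 = 1" "\<And>k. norm (V k) \<le> B"
      "\<And>k. V k * cmat_of_real L = cmat_of_real L * V k" "\<And>k. cmat_cnj (V k) = V k"
    and A: "cmat_of_real A = exp (cmat_of_real L) * V 1"
    by (rule expansive_polar_form[OF assms]) blast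
  have L: "positive_generator L" using ks by (auto simp: positive_generator_def)
  note polar = L V A
  define P where "P = (1 / trace L) *\<^sub>R L"
  have tr: "trace L > 0" using L by (rule positive_generator_trace)
  have P: "positive_generator P" unfolding P_def using L tr by (simp add: positive_generator_scaleR)
  have "trace P = 1" using tr by (simp add: P_def trace_scaleR)
  moreover have "generates_dilations P"
    unfolding generates_dilations_def using dilation_group_expansive[OF P] by blast
  moreover have "all_eigenvalues_positive P" using P by (simp add: positive_generator_iff)
  moreover have "\<forall>t>1. equivalent_dilations A (dilation_group P t)"
    unfolding P_def using dilation_group_equivalent[OF polar tr] by blast
  moreover have "P = P'"
    if P': "all_eigenvalues_positive P'" "trace P' = 1"
      and t: "t > 1" "equivalent_dilations A (dilation_group P' t)" for P' t
  proof -
    obtain c where c: "c *\<^sub>R P' = L"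
      using equivalent_dilation_group_unique[OF polar _ t] P'(1) by (auto simp: positive_generator_iff)
    then have "trace L = c" using P'(2) trace_scaleR[of c P'] by simp
    then have "(1 / trace L) *\<^sub>R (c *\<^sub>R P') = P'" using tr by simp
    then show "P = P'" by (simp only: P_def c)
  qed
  ultimately show ?thesis by blast
qed

end
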